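(* Let $V$ be a vertex operator algebra and $g$ an automorphism of $V$ with $g^T=1$ for some integer $T\ge1$. There exists a bijection between admissible $g$-twisted $V$-modules and $\frac1T\mathbb N$-graded $g$-twisted $\phi$-coordinated $V$-modules.
   Context: All vector spaces are over $\mathbb C$; $\mathbb N=\{0,1,2,\dots\}$. $(V,Y,\mathbf 1,\omega)$ is a vertex operator algebra; automorphisms fix $\omega$; $V^r=\{v: gv=e^{2\pi\sqrt{-1}r/T}v\}$, $0\le r\le T-1$. A weak $g$-twisted $V$-module is a vector space $M$ with a linear map $Y_M(v,z)=\sum_{n\in\frac1T\mathbb Z}v_nz^{-n-1}$, $v_n\in\mathrm{End}\,M$, such that $Y_M(\mathbf 1,z)=\mathrm{id}_M$; for $v\in V^r$ only $n\in\frac rT+\mathbb Z$ occur; $v_nw=0$ for $n$ large; and for $u\in V^r$, $v\in V$: $z_0^{-1}\delta(\frac{z_1-z_2}{z_0})Y_M(u,z_1)Y_M(v,z_2)-z_0^{-1}\delta(\frac{z_2-z_1}{-z_0})Y_M(v,z_2)Y_M(u,z_1)=z_2^{-1}(\frac{z_1-z_0}{z_2})^{-r/T}\delta(\frac{z_1-z_0}{z_2})Y_M(Y(u,z_0)v,z_2)$. It is admissible if equipped with a grading $M=\bigoplus_{n\in\frac1T\mathbb N}M(n)$ with $v_kM(n)\subseteq M(n+\mathrm{wt}\,v-k-1)$ for homogeneous $v$, $k\in\frac1T\mathbb Z$. A $g$-twisted $\phi$-coordinated $V$-module is a vector space $W$ with a linear map $Y_W(\cdot,x):V\to \mathrm{Hom}(W,W((x^{1/T})))$,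 $Y_W(v,x)=\sum_{n\in\frac1T\mathbb Z}v_nx^{-n-1}$, such that: (1) $Y_W(\mathbf 1,x)=\mathrm{id}_W$; (2) $Y_W(u,x)w\in x^{-r/T}W((x))$ for $u\in V^r$, $w\in W$; (3) for all $u,v\in V$ there is $k\in\mathbb N$ with $(x_1-x_2)^kY_W(u,x_1)Y_W(v,x_2)\in \mathrm{Hom}(W,W((x_1^{1/T},x_2^{1/T})))$ and $x_2^k(e^{x_0}-1)^kY_W(Y(u,x_0)v,x_2)=\big((x_1-x_2)^kY_W(u,x_1)Y_W(v,x_2)\big)|_{x_1^{1/T}=(x_2e^{x_0})^{1/T}}$. It is $\frac1T\mathbb N$-graded if equipped with a grading $W=\bigoplus_{n\in\frac1T\mathbb N}W(n)$ with $v_mW(n)\subseteq W(n-m-1)$ for all $v\in V$, $m\in\frac1T\mathbb Z$. *)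

theory Defs
  imports Complex_Main "HOL-Library.Groups_Big_Fun"
    "HOL-Computational_Algebra.Formal_Power_Series"
begin

text \<open>
  Vector spaces over the complex numbers are whole types with an explicit scalar multiplication.
  A vertex operator map is given by its modes: \<open>Y v n w\<close> is \<open>v\<^sub>n w\<close>, where
  \<open>Y(v,x) = \<Sum> v\<^sub>n x^(-n-1)\<close>. Modes are indexed by integers for the algebra itself and by
  rationals for twisted modules, the latter vanishing outside \<open>(1/T)\<int>\<close>.
  Sums over an infinite index set that have only finitely many nonzero terms are written with
  \<^const>\<open>Sum_any\<close>; finiteness is always guaranteed by the truncation conditions.
\<close>

definition direct_sum :: "(complex \<Rightarrow> 'a \<Rightarrow> 'a) \<Rightarrow> ('i \<Rightarrow> 'a::ab_group_add set) \<Rightarrow> bool" where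
  "direct_sum s A \<longleftrightarrow>
     (\<forall>i. module.subspace s (A i)) \<and>
     (\<forall>x. \<exists>!f. finite {i. f i \<noteq> 0} \<and> (\<forall>i. f i \<in> A i) \<and> x = Sum_any f)"

definition bilinear_modes ::
  "(complex \<Rightarrow> 'v::ab_group_add \<Rightarrow> 'v) \<Rightarrow> (complex \<Rightarrow> 'w::ab_group_add \<Rightarrow> 'w)
   \<Rightarrow> ('v \<Rightarrow> 'n \<Rightarrow> 'w \<Rightarrow> 'w) \<Rightarrow> bool" where
  "bilinear_modes sV sW Y \<longleftrightarrow>
     (\<forall>v n. Vector_Spaces.linear sW sW (Y v n)) \<and>
     (\<forall>n w. Vector_Spaces.linear sV sW (\<lambda>v. Y v n w))"

text \<open>The weight space \<open>V\<^sub>(\<^sub>h\<^sub>)\<close>, using \<open>L(0) = \<omega>\<^sub>1\<close>.\<close>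

definition weight_space ::
  "(complex \<Rightarrow> 'v \<Rightarrow> 'v) \<Rightarrow> ('v \<Rightarrow> int \<Rightarrow> 'v \<Rightarrow> 'v) \<Rightarrow> 'v \<Rightarrow> int \<Rightarrow> 'v set" where
  "weight_space s Y \<omega> h = {v. Y \<omega> 1 v = s (of_int h) v}"

text \<open>
  The axiom \<open>jacobi\<close> is the Jacobi identity
  \<open>z0^(-1) \<delta>((z1-z2)/z0) Y(u,z1)Y(v,z2) - z0^(-1) \<delta>((z2-z1)/(-z0)) Y(v,z2)Y(u,z1)
   = z2^(-1) \<delta>((z1-z0)/z2) Y(Y(u,z0)v,z2)\<close>,
  read off at the coefficient of \<open>z0^(-l-1) z1^(-m-1) z2^(-n-1)\<close>. On the left, the coefficient of
  \<open>z0^(-l-1)\<close> of the two delta functions is \<open>(z1-z2)^l\<close>, resp. \<open>(-z2+z1)^l\<close>, expanded in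
  nonnegative powers of the second variable; on the right, \<open>(-1)^i binom(i-m-1, i) = binom(m, i)\<close>.
\<close>

locale vertex_operator_algebra = vector_space s
  for s :: "complex \<Rightarrow> 'v::ab_group_add \<Rightarrow> 'v" +
  fixes Y :: "'v \<Rightarrow> int \<Rightarrow> 'v \<Rightarrow> 'v" and vac :: 'v and \<omega> :: 'v
  assumes bilinear: "bilinear_modes s s Y"
    and truncation: "\<And>u v. \<exists>N. \<forall>n\<ge>N. Y u n v = 0"
    and vacuum: "\<And>n v. Y vac n v = (if n = -1 then v else 0)"
    and creation: "\<And>v n. n \<ge> 0 \<Longrightarrow> Y v n vac = 0" "\<And>v. Y v (-1) vac = v"
    and jacobi: "\<And>u v w l m n.
          Sum_any (\<lambda>i::nat. s ((-1) ^ i * (of_int l gchoose i))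
                              (Y u (m + l - int i) (Y v (n + int i) w)))
        - Sum_any (\<lambda>i::nat. s ((-1) powi (l - int i) * (of_int l gchoose i))
                              (Y v (n + l - int i) (Y u (m + int i) w)))
        = Sum_any (\<lambda>i::nat. s (of_int m gchoose i) (Y (Y u (l + int i) v) (m + n - int i) w))"
    and virasoro: "\<exists>c. \<forall>m n v.
          Y \<omega> (m + 1) (Y \<omega> (n + 1) v) - Y \<omega> (n + 1) (Y \<omega> (m + 1) v)
        = s (of_int (m - n)) (Y \<omega> (m + n + 1) v)
          + (if m + n = 0 then s (of_int (m ^ 3 - m) / 12 * c) v else 0)"
    and L_minus_one_derivative: "\<And>v n w. Y (Y \<omega> 0 v) n w = s (- of_int n) (Y v (n - 1) w)"
    and grading: "direct_sum s (weight_space s Y \<omega>)"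
    and finite_dim: "\<And>h. \<exists>B. finite B \<and> weight_space s Y \<omega> h \<subseteq> span B"
    and bounded_below: "\<exists>N. \<forall>h<N. weight_space s Y \<omega> h = {0}"

definition voa_automorphism ::
  "(complex \<Rightarrow> 'v::ab_group_add \<Rightarrow> 'v) \<Rightarrow> ('v \<Rightarrow> int \<Rightarrow> 'v \<Rightarrow> 'v) \<Rightarrow> 'v \<Rightarrow> 'v \<Rightarrow> ('v \<Rightarrow> 'v) \<Rightarrow> bool"
where
  "voa_automorphism s Y vac \<omega> g \<longleftrightarrow>
     Vector_Spaces.linear s s g \<and> bij g \<and> g vac = vac \<and> g \<omega> = \<omega> \<and>
     (\<forall>u n v. g (Y u n v) = Y (g u) n (g v))"

text \<open>The eigenspace \<open>V^r\<close>, to be used for \<open>0 \<le> r \<le> T - 1\<close>.\<close>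

definition eigenspace ::
  "(complex \<Rightarrow> 'v \<Rightarrow> 'v) \<Rightarrow> ('v \<Rightarrow> 'v) \<Rightarrow> nat \<Rightarrow> nat \<Rightarrow> 'v set" where
  "eigenspace s g T r = {v. g v = s (exp (2 * of_real pi * \<i> * of_nat r / of_nat T)) v}"

definition frac_int :: "nat \<Rightarrow> rat set" where
  "frac_int T = {of_int k / of_nat T | k. True}"

definition frac_nat :: "nat \<Rightarrow> rat set" where
  "frac_nat T = {of_nat k / of_nat T | k. True}"

text \<open>
  The conditions shared by twisted modules and twisted \<open>\<phi>\<close>-coordinated modules: \<open>Y\<close> is a linear
  map into \<open>Hom(W, W((x^(1/T))))\<close>, \<open>Y(1,x)\<close> is the identity, and \<open>Y(v,x)\<close> only has modes \<open>v\<^sub>n\<close>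
  with \<open>n \<in> r/T + \<int>\<close> when \<open>v \<in> V^r\<close>; equivalently \<open>Y(v,x)w \<in> x^(-r/T) W((x))\<close>.
\<close>

definition twisted_vertex_operators ::
  "(complex \<Rightarrow> 'v::ab_group_add \<Rightarrow> 'v) \<Rightarrow> 'v \<Rightarrow> ('v \<Rightarrow> 'v) \<Rightarrow> nat
   \<Rightarrow> (complex \<Rightarrow> 'w::ab_group_add \<Rightarrow> 'w) \<Rightarrow> ('v \<Rightarrow> rat \<Rightarrow> 'w \<Rightarrow> 'w) \<Rightarrow> bool" where
  "twisted_vertex_operators sV vac g T sW Y \<longleftrightarrow>
     bilinear_modes sV sW Y \<and>
     (\<forall>v n w. n \<notin> frac_int T \<longrightarrow> Y v n w = 0) \<and>
     (\<forall>v w. \<exists>N. \<forall>n\<ge>N. Y v n w = 0) \<and>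
     (\<forall>n w. Y vac n w = (if n = -1 then w else 0)) \<and>
     (\<forall>r<T. \<forall>v\<in>eigenspace sV g T r. \<forall>n w. n - of_nat r / of_nat T \<notin> \<int> \<longrightarrow> Y v n w = 0)"

text \<open>
  The twisted Jacobi identity is again read off at the coefficient of
  \<open>z0^(-l-1) z1^(-m-1) z2^(-n-1)\<close>. The factor \<open>z2^(-1) ((z1-z0)/z2)^(-r/T) \<delta>((z1-z0)/z2)\<close> is
  the sum of \<open>z2^(-q-1) (z1-z0)^q\<close> over \<open>q \<in> -r/T + \<int>\<close>, so its powers of \<open>z1\<close> lie in
  \<open>-r/T + \<int>\<close>; for \<open>m \<notin> r/T + \<int>\<close> both sides vanish and there is no condition.
\<close>

definition weak_twisted_module ::
  "(complex \<Rightarrow> 'v::ab_group_add \<Rightarrow> 'v) \<Rightarrow> ('v \<Rightarrow> int \<Rightarrow> 'v \<Rightarrow> 'v) \<Rightarrow> 'v \<Rightarrow> ('v \<Rightarrow> 'v) \<Rightarrow> nat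
   \<Rightarrow> (complex \<Rightarrow> 'w::ab_group_add \<Rightarrow> 'w) \<Rightarrow> ('v \<Rightarrow> rat \<Rightarrow> 'w \<Rightarrow> 'w) \<Rightarrow> bool" where
  "weak_twisted_module sV YV vac g T sW Y \<longleftrightarrow>
     twisted_vertex_operators sV vac g T sW Y \<and>
     (\<forall>r<T. \<forall>u\<in>eigenspace sV g T r. \<forall>v w l. \<forall>m n.
        m - of_nat r / of_nat T \<in> \<int> \<longrightarrow> n \<in> frac_int T \<longrightarrow>
          Sum_any (\<lambda>i::nat. sW ((-1) ^ i * (of_int l gchoose i))
                              (Y u (m + of_int l - of_nat i) (Y v (n + of_nat i) w)))
        - Sum_any (\<lambda>i::nat. sW ((-1) powi (l - int i) * (of_int l gchoose i))
                              (Y v (n + of_int l - of_nat i) (Y u (m + of_nat i) w)))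
        = Sum_any (\<lambda>i::nat. sW (of_rat m gchoose i)
                              (Y (YV u (l + int i) v) (m + n - of_nat i) w)))"

text \<open>
  The coefficient of \<open>x1^p x2^q\<close> in \<open>(x1 - x2)^k Y(u,x1) Y(v,x2) w\<close>.
\<close>

definition cleared_product_coeff ::
  "(complex \<Rightarrow> 'w::ab_group_add \<Rightarrow> 'w) \<Rightarrow> ('v \<Rightarrow> rat \<Rightarrow> 'w \<Rightarrow> 'w)
   \<Rightarrow> nat \<Rightarrow> 'v \<Rightarrow> 'v \<Rightarrow> 'w \<Rightarrow> rat \<Rightarrow> rat \<Rightarrow> 'w" where
  "cleared_product_coeff sW Y k u v w p q =
     (\<Sum>i\<le>k. sW ((-1) ^ i * of_nat (k choose i))
               (Y u (of_nat k - of_nat i - p - 1) (Y v (of_nat i - q - 1) w)))"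

text \<open>
  In the last condition, the first part says that \<open>(x1-x2)^k Y(u,x1) Y(v,x2)\<close> maps \<open>W\<close> to
  \<open>W((x1^(1/T), x2^(1/T)))\<close>, and the second one compares the coefficients of \<open>x0^j x2^t\<close> of
  \<open>x2^k (e^x0 - 1)^k Y(Y(u,x0)v,x2) w\<close> and of the series obtained by substituting
  \<open>x1^p = x2^p e^(p x0)\<close>, for \<open>p \<in> (1/T)\<int>\<close>. The latter has no negative powers of \<open>x0\<close>.
\<close>

definition phi_coordinated_module ::
  "(complex \<Rightarrow> 'v::ab_group_add \<Rightarrow> 'v) \<Rightarrow> ('v \<Rightarrow> int \<Rightarrow> 'v \<Rightarrow> 'v) \<Rightarrow> 'v \<Rightarrow> ('v \<Rightarrow> 'v) \<Rightarrow> nat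
   \<Rightarrow> (complex \<Rightarrow> 'w::ab_group_add \<Rightarrow> 'w) \<Rightarrow> ('v \<Rightarrow> rat \<Rightarrow> 'w \<Rightarrow> 'w) \<Rightarrow> bool" where
  "phi_coordinated_module sV YV vac g T sW Y \<longleftrightarrow>
     twisted_vertex_operators sV vac g T sW Y \<and>
     (\<forall>u v. \<exists>k.
        (\<forall>w. \<exists>N. \<forall>p q. p < N \<or> q < N \<longrightarrow> cleared_product_coeff sW Y k u v w p q = 0) \<and>
        (\<forall>w. \<forall>j::int. \<forall>t\<in>frac_int T.
           Sum_any (\<lambda>i::nat. sW (fps_nth ((fps_exp 1 - 1) ^ k) i)
                               (Y (YV u (int i - j - 1) v) (of_nat k - t - 1) w))
         = (if j < 0 then 0
            else Sum_any (\<lambda>p. sW (fps_nth (fps_exp (of_rat p)) (nat j))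
                                (cleared_product_coeff sW Y k u v w p (t - p))))))"

text \<open>
  A grading indexed by \<open>(1/T)\<nat>\<close>, extended by zero to all rational degrees.
\<close>

definition frac_nat_grading ::
  "nat \<Rightarrow> (complex \<Rightarrow> 'w::ab_group_add \<Rightarrow> 'w) \<Rightarrow> (rat \<Rightarrow> 'w set) \<Rightarrow> bool" where
  "frac_nat_grading T sW W \<longleftrightarrow> direct_sum sW W \<and> (\<forall>n. n \<notin> frac_nat T \<longrightarrow> W n = {0})"

text \<open>
  The sets of all module structures (vertex operators together with a grading) on the vector
  space given by \<open>sW\<close>.
\<close>

definition admissible_twisted_modules ::
  "(complex \<Rightarrow> 'v::ab_group_add \<Rightarrow> 'v) \<Rightarrow> ('v \<Rightarrow> int \<Rightarrow> 'v \<Rightarrow> 'v) \<Rightarrow> 'v \<Rightarrow> 'v \<Rightarrow> ('v \<Rightarrow> 'v) \<Rightarrow> nat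
   \<Rightarrow> (complex \<Rightarrow> 'w::ab_group_add \<Rightarrow> 'w)
   \<Rightarrow> (('v \<Rightarrow> rat \<Rightarrow> 'w \<Rightarrow> 'w) \<times> (rat \<Rightarrow> 'w set)) set" where
  "admissible_twisted_modules sV YV vac \<omega> g T sW = {(Y, M).
     weak_twisted_module sV YV vac g T sW Y \<and> frac_nat_grading T sW M \<and>
     (\<forall>h. \<forall>v\<in>weight_space sV YV \<omega> h. \<forall>k\<in>frac_int T. \<forall>n\<in>frac_nat T.
        Y v k ` M n \<subseteq> M (n + of_int h - k - 1))}"

definition graded_phi_coordinated_modules ::
  "(complex \<Rightarrow> 'v::ab_group_add \<Rightarrow> 'v) \<Rightarrow> ('v \<Rightarrow> int \<Rightarrow> 'v \<Rightarrow> 'v) \<Rightarrow> 'v \<Rightarrow> ('v \<Rightarrow> 'v) \<Rightarrow> nat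
   \<Rightarrow> (complex \<Rightarrow> 'w::ab_group_add \<Rightarrow> 'w)
   \<Rightarrow> (('v \<Rightarrow> rat \<Rightarrow> 'w \<Rightarrow> 'w) \<times> (rat \<Rightarrow> 'w set)) set" where
  "graded_phi_coordinated_modules sV YV vac g T sW = {(Y, W).
     phi_coordinated_module sV YV vac g T sW Y \<and> frac_nat_grading T sW W \<and>
     (\<forall>v. \<forall>m\<in>frac_int T. \<forall>n\<in>frac_nat T. Y v m ` W n \<subseteq> W (n - m - 1))}"

text \<open>Isomorphism of graded module structures, for either kind of module.\<close>

definition isomorphic_modules ::
  "(complex \<Rightarrow> 'w::ab_group_add \<Rightarrow> 'w)
   \<Rightarrow> ('v \<Rightarrow> rat \<Rightarrow> 'w \<Rightarrow> 'w) \<times> (rat \<Rightarrow> 'w set)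
   \<Rightarrow> ('v \<Rightarrow> rat \<Rightarrow> 'w \<Rightarrow> 'w) \<times> (rat \<Rightarrow> 'w set) \<Rightarrow> bool" where
  "isomorphic_modules sW X X' \<longleftrightarrow>
     (\<exists>f. Vector_Spaces.linear sW sW f \<and> bij f \<and>
          (\<forall>v n w. f (fst X v n w) = fst X' v n (f w)) \<and>
          (\<forall>n. f ` snd X n = snd X' n))"

end

(*
  Write Y_M(v,z) for the operators of a twisted module. The operators Y_M(z^L(0) v, z) satisfy the
  phi-coordinated associativity, not for V itself but for Zhu's vertex operators
  Y[u,x] = Y(e^(x L(0)) u, e^x - 1). Hence composing with an isomorphism from V onto Zhu's vertex
  algebra turns twisted modules into phi-coordinated ones, and this is reversible.

  The isomorphism is obtained without exponentials of Virasoro operators. The zero mode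
  L[0] = Res (1+z) log(1+z) Y(omega,z) is L(0) plus terms lowering the weight, so each v of weight h
  is the leading term of a unique L[0]-eigenvector of eigenvalue h, its image. As L[0] acts on the
  modes of Y[u,x] as L(0) does on those of Y(u,x), the images of u_j v and of u, v are related by
  comparing two L[0]-eigenvectors with the same eigenvalue and the same leading term.

  On the module side, residues of delta functions show that the phi-coordinated axiom amounts to the
  Jacobi identity with (1+z)^m z^l replaced by e^((m+1)x) (e^x-1)^l. Commutativity, which is not part
  of the axiom, follows from skew symmetry in V and the linear independence of exponentials.
*)

theory Submission
  imports Defs "HOL-Computational_Algebra.Formal_Laurent_Series"
begin

text \<open>Zhu's operators are forced by x1 = x2 e^x0. Conjugation by x2^L(0) rescales the variable
  of a vertex operator, so iterating Y_M((x2 e^x0)^L(0) u, x2 e^x0) with Y_M(x2^L(0) v, x2) gives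
  Y_M(x2^L(0) Y(e^(x0 L(0)) u, e^x0 - 1) v, x2). The factors x^L(0) also absorb every weight shift,
  so the grading condition on the other side does not mention weights. The series (1+z) log(1+z) is
  log(1+z) (1+z)^(2-1): the variable x, the factor (1+z)^L(0) on omega, and dx = (1+z)^(-1) dz.
  Subtracting c/24 from omega, as Zhu does, leaves this zero mode unchanged, because x has no
  residue. Identities of generating functions F are stated as equalities of the functionals f -> Res
  f F. Multiplication by (e^x-1)^(-k), the reflection x -> -x and the substitution z = e^x - 1 then
  act on the test series f, and continuity reduces each equality to one test series of each order.
  All arguments about L[0] descend through the weights and stop because the weights are bounded
  below.\<close>

lemma Sum_any_reindex_inj:
  fixes f :: "'b \<Rightarrow> 'c::comm_monoid_add"
  assumes "inj h"
  shows "Sum_any (\<lambda>i. f (h i)) = Sum_any (\<lambda>a. if a \<in> range h then f a else 0)"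
proof -
  have *: "{a. (if a \<in> range h then f a else 0) \<noteq> 0} = h ` {i. f (h i) \<noteq> 0}" by auto
  show ?thesis unfolding Sum_any.expand_set *
    using inj_on_subset[OF assms] by (subst sum.reindex) auto
qed

lemma Sum_any_eq_sum:
  fixes f :: "'b \<Rightarrow> 'c::comm_monoid_add"
  assumes "finite A" "\<And>a. a \<notin> A \<Longrightarrow> f a = 0"
  shows "Sum_any f = sum f A"
  using assms by (intro Sum_any.expand_superset) auto

lemma Sum_any_uminus:
  fixes f :: "'b \<Rightarrow> 'c::ab_group_add"
  shows "Sum_any (\<lambda>i. - f i) = - Sum_any f"
  by (simp add: Sum_any.expand_set sum_negf)

lemma Sum_any_diff:
  fixes f g :: "'b \<Rightarrow> 'c::ab_group_add"
  assumes "finite {i. f i \<noteq> 0}" "finite {i. g i \<noteq> 0}"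
  shows "Sum_any (\<lambda>i. f i - g i) = Sum_any f - Sum_any g"
proof -
  have "finite {i. - g i \<noteq> 0}" using assms(2) by simp
  from Sum_any.distrib[OF assms(1) this] show ?thesis by (simp add: Sum_any_uminus)
qed

lemma Sum_any_nat_shift:
  fixes f :: "nat \<Rightarrow> 'c::comm_monoid_add"
  assumes "f 0 = 0"
  shows "Sum_any f = Sum_any (\<lambda>i. f (Suc i))"
proof -
  have "(if a \<in> range Suc then f a else 0) = f a" for a
    using assms by (cases a) auto
  then show ?thesis using Sum_any_reindex_inj[of Suc f] by simp
qed

subsection \<open>Exponential and binomial series\<close>

text \<open>The series e^(cx), e^x - 1, (1+z)^a and log(1+z) are taken as Laurent series because
  negative powers of e^x - 1 and log(1+z) occur throughout.\<close>

definition lexp :: "complex \<Rightarrow> complex fls" where "lexp c = fps_to_fls (fps_exp c)"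

definition lexpm1 :: "complex fls" where "lexpm1 = lexp 1 - 1"

definition lbinom :: "complex \<Rightarrow> complex fls" where "lbinom a = fps_to_fls (fps_binomial a)"

definition llog :: "complex fls" where "llog = fps_to_fls (fps_ln 1)"

lemma lexp_add: "lexp (a + b) = lexp a * lexp b"
  by (simp add: lexp_def fps_exp_add_mult fls_times_fps_to_fls)

lemma lexp_0 [simp]: "lexp 0 = 1"
  by (simp add: lexp_def)

lemma lexp_uminus_mult [simp]: "lexp (- a) * lexp a = 1" "lexp a * lexp (- a) = 1"
  by (simp_all flip: lexp_add)

lemma lexp_nonzero [simp]: "lexp a \<noteq> 0"
  by (metis lexp_uminus_mult(1) mult_zero_right zero_neq_one)

lemma lexp_deriv: "fls_deriv (lexp a) = fls_const a * lexp a"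
  by (simp add: lexp_def fls_deriv_fps_to_fls fls_times_fps_to_fls)

lemma lexpm1_fps: "lexpm1 = fps_to_fls (fps_exp 1 - 1)"
  by (simp add: lexpm1_def lexp_def)

lemma subdegree_fps_exp_minus_1: "subdegree (fps_exp (1::complex) - 1) = 1"
  by (rule subdegreeI) auto

lemma subdegree_lexp [simp]: "fls_subdegree (lexp a) = 0"
proof -
  have "subdegree (fps_exp a) = 0" by (rule subdegreeI) auto
  then show ?thesis by (simp add: lexp_def fls_subdegree_fls_to_fps)
qed

lemma subdegree_lexpm1 [simp]: "fls_subdegree lexpm1 = 1"
  using fls_subdegree_fls_to_fps[of "fps_exp (1::complex) - 1"]
  by (simp only: lexpm1_fps subdegree_fps_exp_minus_1 of_nat_1)

lemma lexpm1_nonzero [simp]: "lexpm1 \<noteq> 0"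
  using subdegree_lexpm1 by fastforce

lemma subdegree_powi: "fls_subdegree (f powi n) = n * fls_subdegree (f :: complex fls)"
  by (cases "f = 0") (auto simp: power_int_def fls_subdegree_pow fls_inverse_subdegree power_inverse)

lemma lexpm1_deriv: "fls_deriv lexpm1 = lexp 1"
  by (simp add: lexpm1_def lexp_deriv fls_const_1)

lemma lbinom_add: "lbinom (a + b) = lbinom a * lbinom b"
  by (simp add: lbinom_def fps_binomial_add_mult fls_times_fps_to_fls)

lemma lbinom_0 [simp]: "lbinom 0 = 1"
  by (simp add: lbinom_def)

lemma lbinom_1: "lbinom 1 = 1 + fls_X"
  by (simp add: lbinom_def fps_binomial_1)

lemma subdegree_fps_ln: "subdegree (fps_ln (1::complex)) = 1"
  by (rule subdegreeI) (auto simp: fps_ln_nth)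

lemma subdegree_llog [simp]: "fls_subdegree llog = 1"
  by (simp add: llog_def fls_subdegree_fls_to_fps subdegree_fps_ln)

lemma llog_nonzero [simp]: "llog \<noteq> 0"
  using subdegree_llog by fastforce

lemma fps_ln_nonzero [simp]: "fps_ln (1::complex) \<noteq> 0"
  using subdegree_fps_ln by fastforce

lemma subdegree_lbinom [simp]: "fls_subdegree (lbinom a) = 0"
proof -
  have "subdegree (fps_binomial a) = 0" by (rule subdegreeI) auto
  then show ?thesis by (simp add: lbinom_def fls_subdegree_fls_to_fps)
qed

lemma lbinom_nonzero [simp]: "lbinom a \<noteq> 0"
  by (metis ab_left_minus lbinom_0 lbinom_add mult_zero_right zero_neq_one)

lemma lbinom_deriv: "fls_deriv (lbinom a) = fls_const a * lbinom (a - 1)"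
proof -
  have "fps_binomial (a - 1) = fps_binomial a * inverse (1 + fps_X)"
    using fps_binomial_add_mult[of a "-1"] by (simp add: fps_binomial_minus_one)
  then have "fps_deriv (fps_binomial a) = fps_const a * fps_binomial (a - 1)"
    by (simp add: fps_binomial_deriv fps_divide_unit mult_ac)
  then show ?thesis by (simp add: lbinom_def fls_deriv_fps_to_fls fls_times_fps_to_fls)
qed

lemma llog_deriv: "fls_deriv llog = lbinom (-1)"
  by (simp add: llog_def lbinom_def fls_deriv_fps_to_fls fps_ln_deriv fps_binomial_minus_one)

text \<open>Both sides solve (1+z) F' = a F with constant term 1, and this equation determines
  F.\<close>

lemma fps_exp_compose_ln: "fps_exp a oo fps_ln 1 = fps_binomial (a::complex)"
proof -
  have "fps_deriv (fps_exp a oo fps_ln 1) = fps_const a * (fps_exp a oo fps_ln 1) * inverse (1 + fps_X)"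
    by (simp add: fps_compose_deriv fps_ln_deriv fps_compose_mult_distrib)
  then have "fps_deriv (fps_exp a oo fps_ln 1) = fps_const a * (fps_exp a oo fps_ln 1) / (1 + fps_X)"
    by (simp add: fps_divide_unit)
  then show ?thesis using fps_binomial_ODE_unique'[of "fps_exp a oo fps_ln 1" a] by simp
qed

lemma lexp_compose_ln: "fls_compose_fps (lexp a) (fps_ln 1) = lbinom a"
  by (simp add: lexp_def lbinom_def fps_exp_compose_ln)

lemma lexpm1_compose_ln: "fls_compose_fps lexpm1 (fps_ln 1) = fls_X"
  by (simp add: lexpm1_def lexp_compose_ln fls_compose_fps_diff lbinom_1)

lemma X_compose_ln: "fls_compose_fps (fls_X_intpow j) (fps_ln 1) = llog powi j"
proof -
  have "fls_X_intpow j = (fls_X :: complex fls) powi j"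
    by simp
  then show ?thesis by (simp only: fls_compose_fps_powi[OF fps_ln_nonzero fps_ln_0] fls_compose_fps_X llog_def)
qed

lemma fls_deriv_powi:
  fixes f :: "complex fls"
  assumes "f \<noteq> 0"
  shows "fls_deriv (f powi l) = of_int l * (fls_deriv f * f powi (l - 1))"
proof (induction l rule: int_induct[where k = 0])
  case base
  show ?case by simp
next
  case (step1 i)
  have "f powi (i - 1) * f = f powi i"
    using assms power_int_add_1[of f "i - 1"] by simp
  then have "fls_deriv (f powi i * f) = of_int (i + 1) * (fls_deriv f * f powi i)"
    unfolding fls_deriv_mult step1.IH by (simp add: algebra_simps)
  then show ?case using assms by (simp add: power_int_add_1)
next
  case (step2 i)
  have *: "f powi (i - 1 - 1) * f = f powi (i - 1)" "f powi (i - 1) * f = f powi i"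
    using assms power_int_add_1[of f "i - 1 - 1"] power_int_add_1[of f "i - 1"] by simp_all
  have "fls_deriv (f powi (i - 1)) * f + f powi (i - 1) * fls_deriv f = of_int i * (fls_deriv f * f powi (i - 1))"
    using step2.IH unfolding *(2)[symmetric] fls_deriv_mult by (simp add: add.commute)
  then have "fls_deriv (f powi (i - 1)) * f = of_int (i - 1) * (fls_deriv f * (f powi (i - 1 - 1) * f))"
    unfolding *(1) by (simp add: algebra_simps)
  then have "fls_deriv (f powi (i - 1)) * f = (of_int (i - 1) * (fls_deriv f * f powi (i - 1 - 1))) * f"
    by (simp only: mult.assoc)
  then show ?case using assms by (simp only: mult_cancel_right) simp
qed

lemma residue_lexp_nonneg:
  "l \<ge> 0 \<Longrightarrow> fls_residue (lexp b * lexpm1 powi l) = 0"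
  by (rule fls_residue_power_series) (simp add: subdegree_powi)

text \<open>Under z = e^x - 1 this is the residue of (1+z)^(b-1) z^(-s-1), the loss of 1 in the
  exponent coming from dx = (1+z)^(-1) dz. The proof avoids changing variables: the residue of the
  derivative of e^((b-1)x) (e^x-1)^(-s-1) vanishes, which is the absorption recursion for binomial
  coefficients.\<close>

lemma residue_lexp_neg:
  "fls_residue (lexp b * lexpm1 powi (- int s - 1)) = (b - 1) gchoose s"
proof (induction s arbitrary: b)
  case 0
  have b: "lexp c * lexpm1 powi (- 1) = (lexp c - 1) * lexpm1 powi (-1) + lexpm1 powi (-1)" for c
    by (simp add: algebra_simps)
  have "fls_residue (lexpm1 powi (-1)) = 1"
  proof -
    \<comment> \<open>The residue of a logarithmic derivative is the order of vanishing, and e^x /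
      (e^x - 1) = 1 + 1 / (e^x - 1).\<close>
    have "fls_residue (fls_deriv lexpm1 * inverse lexpm1) = 1"
      by (simp only: fls_residue_deriv_times_inverse_eq_subdegree) simp
    moreover have "fls_deriv lexpm1 * inverse lexpm1 = 1 + lexpm1 powi (-1)"
      by (simp only: lexpm1_deriv) (simp add: field_simps power_int_minus, simp add: lexpm1_def)
    ultimately show ?thesis by simp
  qed
  moreover have "fls_residue ((lexp c - 1) * lexpm1 powi (-1)) = 0" for c
  proof (cases "lexp c - 1 = 0")
    case False
    have "fls_nth (lexp c - 1) n = 0" if "n < 1" for n
      using that by (cases "n = 0") (auto simp: lexp_def)
    with False have "fls_subdegree (lexp c - 1) \<ge> 1" by (intro fls_subdegree_geI) auto
    with False show ?thesis by (intro fls_residue_power_series) (simp add: subdegree_powi)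
  qed simp
  ultimately have "fls_residue (lexp b * lexpm1 powi (- 1)) = 1"
    by (simp only: b[of b] fls_residue_add) simp
  then show ?case by simp
next
  case (Suc s)
  let ?f = "\<lambda>l. lexpm1 powi (l::int)"
  have p: "fls_deriv (?f l) = of_int l * (lexp 1 * ?f (l - 1))" for l
    by (simp add: fls_deriv_powi lexpm1_deriv)
  let ?c = "b - 1" and ?l = "- int s - 1"
  have "fls_residue (fls_deriv (lexp ?c * ?f ?l)) = 0" by (rule fls_residue_deriv)
  moreover have "fls_deriv (lexp ?c * ?f ?l) = fls_const ?c * (lexp ?c * ?f ?l)
      + of_int ?l * (lexp b * ?f (?l - 1))"
    using lexp_add[of ?c 1] by (simp only: fls_deriv_mult lexp_deriv p) (simp add: algebra_simps)
  ultimately have r: "?c * fls_residue (lexp ?c * ?f ?l) + of_int ?l * fls_residue (lexp b * ?f (?l - 1)) = 0"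
    by (simp only: fls_residue_add fls_residue_fls_const_times fls_residue_of_int_times)
  have e: "- int (Suc s) - 1 = ?l - 1" by simp
  define R where "R = fls_residue (lexp b * ?f (?l - 1))"
  have "?c * ((?c - 1) gchoose s) + of_int ?l * R = 0"
    using r unfolding Suc.IH[of ?c] R_def .
  then have "?c * ((?c - 1) gchoose s) = of_nat (Suc s) * R"
    by (simp add: algebra_simps add_eq_0_iff)
  then have "?c * ((?c - 1) gchoose s) = of_nat (Suc s) * fls_residue (lexp b * ?f (- int (Suc s) - 1))"
    unfolding e R_def .
  moreover have "of_nat (Suc s) * (?c gchoose Suc s) = ?c * ((?c - 1) gchoose s)"
    by (rule gbinomial_absorption)
  ultimately show ?case by (metis mult_cancel_left of_nat_eq_0_iff nat.distinct(2))
qed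

text \<open>The coefficients of the difference of the two expansions of \<open>(z1 - z2)^l\<close>.\<close>

lemma delta_coefficients:
  fixes l a :: int
  shows "fls_residue (lexp (of_int (- a)) * lexpm1 powi l) =
    (if a \<le> l then (-1) ^ nat (l - a) * (of_int l gchoose nat (l - a)) else 0)
    - (if a \<ge> 0 then (-1) powi (l - a) * (of_int l gchoose nat a) else 0)"
\<comment> \<open>For l >= 0 the two expansions of the polynomial agree, in accordance with the
  absence of a pole.\<close>
proof (cases "l \<ge> 0")
  case True
  then obtain n where n: "l = int n" using nonneg_int_cases by blast
  have "(of_nat n gchoose nat (l - a) :: complex) = 0" if "a < 0"
    using that n by (simp flip: binomial_gbinomial)
  moreover have "(of_nat n gchoose nat a :: complex) = 0" if "a > l"
    using that n by (simp flip: binomial_gbinomial)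
  moreover have "(of_nat n gchoose nat a :: complex) = (of_nat n gchoose nat (l - a))" if "0 \<le> a" "a \<le> l"
    using that n binomial_symmetric[of "nat a" n]
    by (simp flip: binomial_gbinomial add: nat_diff_distrib)
  moreover have "(- 1) powi (l - a) = ((- 1) ^ nat (l - a) :: complex)" if "a \<le> l"
    using that by (simp add: power_int_def)
  ultimately show ?thesis unfolding residue_lexp_nonneg[OF True] using n by auto
next
  case False
  define s where "s = nat (- l - 1)"
  have l: "l = - int s - 1" using False by (simp add: s_def)
  have neg: "(-1) ^ i * (of_int l gchoose i) = (of_nat (s + i) gchoose s :: complex)" for i
  proof -
    have "(of_int l gchoose i :: complex) = (-1) ^ i * (of_nat (s + i) gchoose i)"
      by (subst gbinomial_negated_upper) (simp add: l algebra_simps)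
    moreover have "(of_nat (s + i) gchoose i :: complex) = of_nat (s + i) gchoose s"
      using binomial_symmetric[of i "s + i"] by (simp only: flip: binomial_gbinomial) simp
    ultimately show ?thesis by simp
  qed
  \<comment> \<open>For l < 0 the supports of the two expansions are disjoint. In the gap between
    them the residue is binom(i, s) with 0 <= i < s, hence 0.\<close>
  consider "a \<ge> 0" | "a \<le> l" | "l < a" "a < 0" by linarith
  then show ?thesis
  proof cases
    case 1
    then obtain b where b: "a = int b" using nonneg_int_cases by blast
    have "(-1) powi (l - a) = - ((-1) ^ s * (-1) ^ b :: complex)"
      by (simp add: l b power_int_diff power_int_minus divide_inverse flip: power_inverse)
    then have "(-1) powi (l - a) * (of_int l gchoose nat a) = - ((-1) ^ s * (of_nat (s + b) gchoose s :: complex))"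
      using neg[of b] by (simp add: b mult.assoc)
    also have "\<dots> = - ((- of_int a - 1) gchoose s)"
      using gbinomial_negated_upper[of "- of_int a - 1 :: complex" s] by (simp add: b algebra_simps)
    finally show ?thesis using 1 False unfolding l residue_lexp_neg by simp
  next
    case 2
    define i where "i = nat (l - a)"
    have "- of_int a - 1 = (of_nat (s + i) :: complex)" using 2 by (simp add: i_def l)
    moreover have "fls_residue (lexp (of_int (- a)) * lexpm1 powi l) = (- of_int a - 1) gchoose s"
      using residue_lexp_neg[of "of_int (- a)" s] by (simp add: l)
    moreover have "a \<le> l" "\<not> a \<ge> 0" using 2 False by auto
    ultimately show ?thesis using neg[of i] by (simp only: i_def if_True if_False diff_0_right)
  next
    case 3
    define i where "i = nat (- a - 1)"
    have "- of_int a - 1 = (of_nat i :: complex)" "i < s" using 3 by (simp_all add: i_def l)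
    then show ?thesis using 3 unfolding l residue_lexp_neg by (simp flip: binomial_gbinomial)
  qed
qed

unbundle fps_syntax

subsection \<open>Continuous functionals on Laurent series\<close>

locale complex_space = vector_space s for s :: "complex \<Rightarrow> 'w::ab_group_add \<Rightarrow> 'w"
begin

text \<open>Linear functionals that are continuous for the topology given by the order of vanishing.\<close>

definition cont :: "(complex fls \<Rightarrow> 'w) \<Rightarrow> bool" where
  "cont \<phi> \<longleftrightarrow> (\<forall>f g. \<phi> (f + g) = \<phi> f + \<phi> g) \<and> (\<forall>c f. \<phi> (fls_const c * f) = s c (\<phi> f)) \<and>
     (\<exists>M. \<forall>f. (\<forall>i<M. f $$ i = 0) \<longrightarrow> \<phi> f = 0)"

lemma contI:
  assumes "\<And>f g. \<phi> (f + g) = \<phi> f + \<phi> g" "\<And>c f. \<phi> (fls_const c * f) = s c (\<phi> f)"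
    and "\<And>f. (\<forall>i<M. f $$ i = 0) \<Longrightarrow> \<phi> f = 0"
  shows "cont \<phi>"
  using assms unfolding cont_def by blast

lemma contD:
  assumes "cont \<phi>"
  shows "\<phi> (f + g) = \<phi> f + \<phi> g" "\<phi> (fls_const c * f) = s c (\<phi> f)" "\<phi> 0 = 0"
    "\<phi> (f - g) = \<phi> f - \<phi> g"
proof -
  show 1: "\<phi> (f + g) = \<phi> f + \<phi> g" and "\<phi> (fls_const c * f) = s c (\<phi> f)" for f g c
    using assms by (auto simp: cont_def)
  from this(1)[of 0 0] show "\<phi> 0 = 0" by simp
  from 1[of "f - g" g] show "\<phi> (f - g) = \<phi> f - \<phi> g" by simp
qed

lemma contE:
  assumes "cont \<phi>"
  obtains M where "\<And>f. (\<forall>i<M. f $$ i = 0) \<Longrightarrow> \<phi> f = 0"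
  using assms by (auto simp: cont_def)

lemma cont_zero: "cont (\<lambda>f. 0)"
  by (simp add: cont_def)

lemma cont_add: "cont \<phi> \<Longrightarrow> cont \<psi> \<Longrightarrow> cont (\<lambda>f. \<phi> f + \<psi> f)"
proof -
  assume 1: "cont \<phi>" and 2: "cont \<psi>"
  obtain M where M: "\<And>f. (\<forall>i<M. f $$ i = 0) \<Longrightarrow> \<phi> f = 0" by (rule contE[OF 1]) blast
  obtain N where N: "\<And>f. (\<forall>i<N. f $$ i = 0) \<Longrightarrow> \<psi> f = 0" by (rule contE[OF 2]) blast
  show ?thesis
    by (rule contI[where M = "max M N"])
      (simp_all add: contD(1,2)[OF 1] contD(1,2)[OF 2] scale_right_distrib M N)
qed

lemma cont_scale:
  assumes "cont \<phi>"
  shows "cont (\<lambda>f. s c (\<phi> f))"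
proof -
  obtain M where "\<And>f. (\<forall>i<M. f $$ i = 0) \<Longrightarrow> \<phi> f = 0" by (rule contE[OF assms]) blast
  then show ?thesis
    by (intro contI[where M = M])
      (simp_all only: contD(1,2)[OF assms] scale_right_distrib scale_left_commute[of c] scale_zero_right)
qed

lemma cont_uminus: "cont \<phi> \<Longrightarrow> cont (\<lambda>f. - \<phi> f)"
  using cont_scale[of \<phi> "-1"] by simp

lemma cont_diff: "cont \<phi> \<Longrightarrow> cont \<psi> \<Longrightarrow> cont (\<lambda>f. \<phi> f - \<psi> f)"
  using cont_add[OF _ cont_uminus, of \<phi> \<psi>] by simp

lemma cont_sum: "(\<And>i. i \<in> A \<Longrightarrow> cont (\<phi> i)) \<Longrightarrow> cont (\<lambda>f. \<Sum>i\<in>A. \<phi> i f)"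
  by (induction A rule: infinite_finite_induct) (auto intro: cont_zero cont_add)

lemma fls_mult_nth_eq_0:
  fixes f g :: "complex fls"
  assumes "\<forall>i<M - fls_subdegree g. f $$ i = 0" "i < M"
  shows "(f * g) $$ i = 0"
proof (cases "f = 0 \<or> g = 0")
  case False
  then have "fls_subdegree f \<ge> M - fls_subdegree g"
    using assms(1) by (intro fls_subdegree_geI) auto
  with False assms(2) show ?thesis by (intro fls_eq0_below_subdegree) auto
qed auto

lemma cont_mult: "cont \<phi> \<Longrightarrow> cont (\<lambda>f. \<phi> (f * g))"
proof -
  assume 1: "cont \<phi>"
  obtain M where M: "\<And>f. (\<forall>i<M. f $$ i = 0) \<Longrightarrow> \<phi> f = 0" by (rule contE[OF 1]) blast
  show ?thesis
    by (rule contI[where M = "M - fls_subdegree g"])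
      (auto simp: ring_distribs contD(1,2)[OF 1] mult.assoc intro!: M fls_mult_nth_eq_0)
qed

lemma cont_mult_left: "cont \<phi> \<Longrightarrow> cont (\<lambda>f. \<phi> (g * f))"
  using cont_mult[of \<phi> g] by (simp add: mult.commute)

lemma cont_compose:
  assumes "cont \<phi>" "G $ 0 = 0" "G \<noteq> 0"
  shows "cont (\<lambda>f. \<phi> (fls_compose_fps f G))"
proof -
  obtain M where M: "\<And>f. (\<forall>i<M. f $$ i = 0) \<Longrightarrow> \<phi> f = 0" by (rule contE[OF assms(1)]) blast
  \<comment> \<open>With the bound \<open>max 0 M\<close> the series f has no pole, so it is a power
    series F, and the order of F o G is the product of the orders, hence at least that of F.\<close>
  have "\<phi> (fls_compose_fps f G) = 0" if "\<forall>i<max 0 M. f $$ i = 0" for f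
  proof (rule M, intro allI impI)
    fix i assume i: "i < M"
    show "fls_compose_fps f G $$ i = 0"
    proof (cases "f = 0")
      case False
      then have sd: "fls_subdegree f \<ge> max 0 M" using that by (intro fls_subdegree_geI) auto
      define F where "F = fls_regpart f"
      have f: "f = fps_to_fls F" using sd by (simp add: F_def)
      have "F \<noteq> 0" using False f by auto
      have "int (subdegree F) \<ge> M" using sd by (simp add: f fls_subdegree_fls_to_fps)
      moreover have "subdegree (F oo G) = subdegree F * subdegree G"
        by (rule subdegree_fps_compose) (use assms in auto)
      moreover have "subdegree G \<ge> 1"
        using assms by (metis Suc_leI gr0I nth_subdegree_nonzero One_nat_def)
      ultimately have "int (subdegree (F oo G)) \<ge> M"
        by (metis (no_types, opaque_lifting) dual_order.trans mult.right_neutral mult_le_mono2 of_nat_mono)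
      then have "(F oo G) $ nat i = 0" if "i \<ge> 0"
        using i that by (intro nth_less_subdegree_zero) linarith
      then show ?thesis using assms by (auto simp: f)
    qed simp
  qed
  then show ?thesis
    by (intro contI[where M = "max 0 M"])
      (auto simp: fls_compose_fps_add fls_compose_fps_mult assms contD(1,2)[OF assms(1)])
qed

lemma cont_residue: "cont (\<lambda>f. s (fls_residue (f * g)) w)"
proof -
  have "cont (\<lambda>f. s (fls_residue f) w)"
    by (rule contI[where M = 0]) (auto simp: scale_left_distrib)
  from cont_mult[OF this] show ?thesis .
qed

text \<open>Subtracting a multiple of the series of order N raises the order of f without changing
  the value of the difference of the two functionals. After finitely many steps the order passes the
  bound from which that difference vanishes. Only the orders matter, so the basis may be adapted to
  the problem.\<close>

lemma cont_eq_on_filtered_basis: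
  assumes "cont \<phi>" "cont \<psi>" "\<And>n. b n \<noteq> 0 \<and> fls_subdegree (b n) = n"
    and eq: "\<And>n. \<phi> (b n) = \<psi> (b n)"
  shows "\<phi> f = \<psi> f"
proof -
  define \<chi> where "\<chi> f = \<phi> f - \<psi> f" for f
  have \<chi>: "cont \<chi>" unfolding \<chi>_def using assms(1,2) by (rule cont_diff)
  obtain M where M: "\<And>f. (\<forall>i<M. f $$ i = 0) \<Longrightarrow> \<chi> f = 0" by (rule contE[OF \<chi>]) blast
  have b0: "\<chi> (b n) = 0" for n using eq by (simp add: \<chi>_def)
  have "(\<forall>i<N. f $$ i = 0) \<Longrightarrow> \<chi> f = 0" for N f
  proof (induction "nat (M - N)" arbitrary: N f)
    case 0
    then show ?case by (intro M) auto
  next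
    case (Suc k)
    define c where "c = f $$ N / b N $$ N"
    have bN: "b N $$ N \<noteq> 0" using assms(3)[of N] nth_fls_subdegree_nonzero by metis
    have "(\<forall>i<N + 1. (f - fls_const c * b N) $$ i = 0)"
    proof (intro allI impI)
      fix i assume "i < N + 1"
      then consider "i < N" | "i = N" by linarith
      then show "(f - fls_const c * b N) $$ i = 0"
        using Suc.prems bN assms(3)[of N] by cases (auto simp: c_def)
    qed
    moreover have "k = nat (M - (N + 1))" using Suc.hyps(2) by linarith
    ultimately have "\<chi> (f - fls_const c * b N) = 0" using Suc.hyps(1) by blast
    then show ?case using b0[of N] by (simp add: contD(2,4)[OF \<chi>])
  qed
  then have "\<chi> f = 0" using fls_eq0_below_subdegree[of _ f] by blast
  then show ?thesis by (simp add: \<chi>_def)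
qed

lemma cont_eq:
  assumes "cont \<phi>" "cont \<psi>" "\<And>n. \<phi> (fls_X_intpow n) = \<psi> (fls_X_intpow n)"
  shows "\<phi> f = \<psi> f"
  by (rule cont_eq_on_filtered_basis[where b = fls_X_intpow]) (use assms in auto)

text \<open>The generating series of the d_i x^(-i-1) then has finitely many negative
  powers.\<close>

definition bounded_above :: "(int \<Rightarrow> 'w) \<Rightarrow> bool" where
  "bounded_above d \<longleftrightarrow> (\<exists>K. \<forall>i\<ge>K. d i = 0)"

text \<open>This is Res f(x) D(x) for D(x) the sum of the d_i x^(-i-1). The mode d_n is recovered
  with f = x^n.\<close>

definition pair :: "complex fls \<Rightarrow> (int \<Rightarrow> 'w) \<Rightarrow> 'w" where
  "pair f d = Sum_any (\<lambda>i. s (f $$ i) (d i))"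

lemma pair_eq_sum:
  assumes "\<And>i. i \<ge> K \<Longrightarrow> d i = 0" "\<And>i. i < N \<Longrightarrow> f $$ i = 0"
  shows "pair f d = (\<Sum>i\<in>{N..<K}. s (f $$ i) (d i))"
  unfolding pair_def
proof (rule Sum_any_eq_sum)
  fix a assume "a \<notin> {N..<K}"
  then have "a < N \<or> a \<ge> K" by auto
  then show "s (f $$ a) (d a) = 0" using assms by auto
qed simp

lemma cont_pair: "bounded_above d \<Longrightarrow> cont (\<lambda>f. pair f d)"
proof -
  assume "bounded_above d"
  then obtain K where K: "\<And>i. i \<ge> K \<Longrightarrow> d i = 0" by (auto simp: bounded_above_def)
  note p = pair_eq_sum[where d = d and K = K, OF K]
  show ?thesis
  proof (rule contI[where M = K])
    fix f g :: "complex fls"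
    let ?N = "min (fls_subdegree f) (fls_subdegree g)"
    have "pair h d = (\<Sum>i\<in>{?N..<K}. s (h $$ i) (d i))" if "h \<in> {f, g, f + g}" for h
      by (rule p) (use that in auto)
    then show "pair (f + g) d = pair f d + pair g d"
      by (simp add: scale_left_distrib sum.distrib)
  next
    fix c and f :: "complex fls"
    have "pair h d = (\<Sum>i\<in>{fls_subdegree f..<K}. s (h $$ i) (d i))" if "h \<in> {f, fls_const c * f}" for h
      by (rule p) (use that in auto)
    then show "pair (fls_const c * f) d = s c (pair f d)"
      by (simp add: scale_sum_right)
  next
    fix f :: "complex fls"
    assume "\<forall>i<K. f $$ i = 0"
    then show "pair f d = 0" using p[of K f] by simp
  qed
qed

lemma pair_X_intpow: "pair (fls_X_intpow n) d = d n"
proof -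
  have "pair (fls_X_intpow n) d = (\<Sum>i\<in>{n}. s (fls_X_intpow n $$ i) (d i))"
    unfolding pair_def by (rule Sum_any_eq_sum) auto
  then show ?thesis by simp
qed

lemma pair_0_right [simp]: "pair f (\<lambda>i. 0) = 0"
  by (simp add: pair_def)

lemma pair_add_right:
  assumes "bounded_above d" "bounded_above e"
  shows "pair f (\<lambda>i. d i + e i) = pair f d + pair f e"
proof -
  obtain K where K: "\<And>i. i \<ge> K \<Longrightarrow> d i = 0" using assms by (auto simp: bounded_above_def)
  obtain L where L: "\<And>i. i \<ge> L \<Longrightarrow> e i = 0" using assms by (auto simp: bounded_above_def)
  let ?N = "fls_subdegree f" and ?K = "max K L"
  have "pair f h = (\<Sum>i\<in>{?N..<?K}. s (f $$ i) (h i))" if "h \<in> {d, e, \<lambda>i. d i + e i}" for h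
    by (rule pair_eq_sum) (use that K L in auto)
  then show ?thesis by (simp add: scale_right_distrib sum.distrib)
qed

lemma pair_scale_right: "pair f (\<lambda>i. s c (d i)) = s c (pair f d)"
proof (cases "c = 0")
  case False
  have "s c (s (f $$ i) (d i)) = s (f $$ i) (s c (d i))" for i by (simp add: mult.commute)
  then show ?thesis using False
    by (simp add: pair_def Sum_any.expand_set scale_sum_right mult.commute)
qed simp

lemma pair_mult_X_intpow: "pair (f * fls_X_intpow n) d = pair f (\<lambda>i. d (i + n))"
proof -
  have "inj (\<lambda>i::int. i + n)" by auto
  moreover have "a \<in> range (\<lambda>i. i + n)" for a
    by (rule image_eqI[where x = "a - n"]) auto
  ultimately show ?thesis
    using Sum_any_reindex_inj[of "\<lambda>i. i + n" "\<lambda>i. s ((f * fls_X_intpow n) $$ i) (d i)"]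
    by (simp add: pair_def fls_X_intpow_times_conv_shift)
qed

lemma pair_fps: "pair (fps_to_fls F) d = Sum_any (\<lambda>i::nat. s (F $ i) (d (int i)))"
proof -
  have "inj int" by simp
  moreover have "(if a \<in> range int then s (fps_to_fls F $$ a) (d a) else 0) = s (fps_to_fls F $$ a) (d a)" for a
    by (cases "a \<ge> 0") (auto simp: image_iff elim: nonneg_int_cases)
  ultimately show ?thesis
    using Sum_any_reindex_inj[of int "\<lambda>i. s (fps_to_fls F $$ i) (d i)"] by (simp add: pair_def)
qed

lemma pair_vanish:
  assumes "\<And>i. i \<ge> K \<Longrightarrow> d i = 0" "f = 0 \<or> fls_subdegree f \<ge> K"
  shows "pair f d = 0"
  using pair_eq_sum[of K d "K" f] assms by auto

end

lemma linear_pair: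
  assumes "Vector_Spaces.linear s1 s2 L" "complex_space.bounded_above d"
  shows "L (complex_space.pair s1 f d) = complex_space.pair s2 f (\<lambda>i. L (d i))"
proof -
  interpret l: Vector_Spaces.linear s1 s2 L by fact
  interpret a: complex_space s1 by unfold_locales
  interpret b: complex_space s2 by unfold_locales
  obtain K where K: "\<And>i. i \<ge> K \<Longrightarrow> d i = 0" using assms(2) by (auto simp: a.bounded_above_def)
  show ?thesis
    using a.pair_eq_sum[of K d "fls_subdegree f" f] b.pair_eq_sum[of K "\<lambda>i. L (d i)" "fls_subdegree f" f] K
    by (simp add: l.sum l.scale l.zero)
qed

lemma cont_linear:
  assumes "Vector_Spaces.linear s1 s2 L" "complex_space.cont s1 \<phi>"
  shows "complex_space.cont s2 (\<lambda>f. L (\<phi> f))"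
proof -
  interpret l: Vector_Spaces.linear s1 s2 L by fact
  interpret a: complex_space s1 by unfold_locales
  interpret b: complex_space s2 by unfold_locales
  obtain M where M: "\<And>f. (\<forall>i<M. f $$ i = 0) \<Longrightarrow> \<phi> f = 0" by (rule a.contE[OF assms(2)]) blast
  show ?thesis
    by (rule b.contI[where M = M]) (auto simp: a.contD(1,2)[OF assms(2)] l.add l.scale M l.zero)
qed

context complex_space
begin

text \<open>The hypotheses say that all Taylor coefficients of the sum of the C_q e^(qx) vanish. By
  linearity the powers q^j may be replaced by values p(q) of any polynomial, in particular one that
  vanishes on S except at the chosen point.\<close>

lemma exponentials_independent:
  assumes "finite S" "\<And>j::nat. (\<Sum>q\<in>S. s (of_rat q ^ j) (C q)) = 0" "q \<in> S"
  shows "C q = 0"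
proof -
  have "(\<Sum>q\<in>S. s (poly p (of_rat q)) (C q)) = 0" for p :: "complex poly"
  proof -
    have "(\<Sum>q\<in>S. s (poly p (of_rat q)) (C q)) = (\<Sum>q\<in>S. \<Sum>j\<le>degree p. s (coeff p j) (s (of_rat q ^ j) (C q)))"
      by (simp add: poly_altdef scale_sum_left)
    also have "\<dots> = (\<Sum>j\<le>degree p. s (coeff p j) (\<Sum>q\<in>S. s (of_rat q ^ j) (C q)))"
      by (subst sum.swap) (simp add: scale_sum_right)
    finally show ?thesis using assms(2) by simp
  qed
  from this[of "\<Prod>r\<in>S - {q}. [:- of_rat r, 1:]"]
  have "(\<Sum>t\<in>S. s (\<Prod>r\<in>S - {q}. of_rat t - of_rat r) (C t)) = 0"
    by (simp add: poly_prod)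
  moreover have "(\<Prod>r\<in>S - {q}. of_rat t - of_rat r :: complex) = 0" if "t \<in> S" "t \<noteq> q" for t
    using that assms(1) by auto
  ultimately have "s (\<Prod>r\<in>S - {q}. of_rat q - of_rat r) (C q) = 0"
    using sum.remove[OF assms(1,3), of "\<lambda>t. s (\<Prod>r\<in>S - {q}. of_rat t - of_rat r) (C t)"] by simp
  moreover have "(\<Prod>r\<in>S - {q}. of_rat q - of_rat r :: complex) \<noteq> 0" using assms(1) by auto
  ultimately show ?thesis by simp
qed

end

subsection \<open>The two sides of the Jacobi identity\<close>

context complex_space
begin

text \<open>
  \<open>jacobi_left\<close> and \<open>jacobi_right\<close> extract a coefficient of \<open>(z1 - z2)^l P(z1, z2)\<close>, expanded in
  nonnegative powers of \<open>z2\<close>, resp. of \<open>z1\<close>; \<open>mult_diff P\<close> stands for \<open>(z1 - z2) P\<close>.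
\<close>

definition jacobi_left :: "int \<Rightarrow> rat \<Rightarrow> rat \<Rightarrow> (rat \<Rightarrow> rat \<Rightarrow> 'w) \<Rightarrow> 'w" where
  "jacobi_left l m n P = Sum_any (\<lambda>i::nat. s ((-1) ^ i * (of_int l gchoose i))
     (P (m + of_int l - of_nat i) (n + of_nat i)))"

definition jacobi_right :: "int \<Rightarrow> rat \<Rightarrow> rat \<Rightarrow> (rat \<Rightarrow> rat \<Rightarrow> 'w) \<Rightarrow> 'w" where
  "jacobi_right l m n Q = Sum_any (\<lambda>i::nat. s ((-1) powi (l - int i) * (of_int l gchoose i))
     (Q (m + of_nat i) (n + of_int l - of_nat i)))"

definition mult_diff :: "(rat \<Rightarrow> rat \<Rightarrow> 'w) \<Rightarrow> rat \<Rightarrow> rat \<Rightarrow> 'w" where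
  "mult_diff P a b = P (a + 1) b - P a (b + 1)"

text \<open>In Y(u,z1)Y(v,z2)w only the modes of v are truncated, in the opposite order only those
  of u. Each bound makes one of the two expansions a finite sum.\<close>

definition left_bounded :: "(rat \<Rightarrow> rat \<Rightarrow> 'w) \<Rightarrow> bool" where
  "left_bounded P \<longleftrightarrow> (\<exists>N. \<forall>a b. b \<ge> N \<longrightarrow> P a b = 0)"

definition right_bounded :: "(rat \<Rightarrow> rat \<Rightarrow> 'w) \<Rightarrow> bool" where
  "right_bounded P \<longleftrightarrow> (\<exists>N. \<forall>a b. a \<ge> N \<longrightarrow> P a b = 0)"

lemma left_bounded_mult_diff: "left_bounded P \<Longrightarrow> left_bounded (mult_diff P)"
proof -
  assume "left_bounded P"
  then obtain N where N: "\<And>a b. b \<ge> N \<Longrightarrow> P a b = 0" by (auto simp: left_bounded_def)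
  have "mult_diff P a b = 0" if "b \<ge> N" for a b
    using that N[of "a + 1" b] N[of a "b + 1"] by (simp add: mult_diff_def N)
  then show ?thesis by (auto simp: left_bounded_def)
qed

lemma right_bounded_mult_diff: "right_bounded P \<Longrightarrow> right_bounded (mult_diff P)"
proof -
  assume "right_bounded P"
  then obtain N where N: "\<And>a b. a \<ge> N \<Longrightarrow> P a b = 0" by (auto simp: right_bounded_def)
  have "mult_diff P a b = 0" if "a \<ge> N" for a b
    using that N[of "a + 1" b] N[of a "b + 1"] by (simp add: mult_diff_def N)
  then show ?thesis by (auto simp: right_bounded_def)
qed

lemma finite_above_rat:
  fixes x N :: rat
  shows "finite {i::nat. x + of_nat i < N}"
proof (rule finite_subset)
  show "{i::nat. x + of_nat i < N} \<subseteq> {..nat \<lceil>N - x\<rceil>}"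
  proof
    fix i assume "i \<in> {i::nat. x + of_nat i < N}"
    then have "of_nat i \<le> N - x" by simp
    then show "i \<in> {..nat \<lceil>N - x\<rceil>}" by (simp add: le_nat_iff) linarith
  qed
qed simp

lemma finite_left:
  assumes "left_bounded P"
  shows "finite {i::nat. s (c i) (P (f i) (n + of_nat i)) \<noteq> 0}"
proof -
  obtain N where N: "\<And>a b. b \<ge> N \<Longrightarrow> P a b = 0" using assms by (auto simp: left_bounded_def)
  have "s (c i) (P (f i) (n + of_nat i)) = 0" if "\<not> n + of_nat i < N" for i
    using that by (simp add: N)
  then show ?thesis by (intro finite_subset[OF _ finite_above_rat[of n N]] subsetI) blast
qed

lemma finite_right:
  assumes "right_bounded P"
  shows "finite {i::nat. s (c i) (P (n + of_nat i) (f i)) \<noteq> 0}"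
proof -
  obtain N where N: "\<And>a b. a \<ge> N \<Longrightarrow> P a b = 0" using assms by (auto simp: right_bounded_def)
  have "s (c i) (P (n + of_nat i) (f i)) = 0" if "\<not> n + of_nat i < N" for i
    using that by (simp add: N)
  then show ?thesis by (intro finite_subset[OF _ finite_above_rat[of n N]] subsetI) blast
qed

lemma gchoose_Suc_pascal:
  "(of_int l gchoose Suc i :: complex) = (of_int (l - 1) gchoose Suc i) + (of_int (l - 1) gchoose i)"
  using gbinomial_Suc_Suc[of "of_int (l - 1) :: complex" i] by simp

text \<open>Pascal's rule, that is (z1-z2)^l = (z1-z2)^(l-1) (z1-z2). It trades the exponent l for a
  factor moved into P, which drives the induction in \<open>jacobi_delta\<close>.\<close>

lemma jacobi_left_mult_diff:
  assumes "left_bounded P"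
  shows "jacobi_left l m n P = jacobi_left (l - 1) m n (mult_diff P)"
proof -
  let ?c = "\<lambda>i. (-1) ^ i * (of_int (l - 1) gchoose i) :: complex"
  define A where "A i = s (?c i) (P (m + of_int l - of_nat i) (n + of_nat i))" for i
  \<comment> \<open>The second half of Pascal's rule, at index i - 1. The value 0 at i = 0 allows
    the index to be shifted.\<close>
  define B where "B i = (if i = 0 then 0 else - s (?c (i - 1)) (P (m + of_int l - of_nat i) (n + of_nat i)))" for i
  have fA: "finite {i. A i \<noteq> 0}" unfolding A_def by (rule finite_left[OF assms])
  have fB: "finite {i. B i \<noteq> 0}"
    by (rule finite_subset[OF _ finite_left[OF assms, where c = "\<lambda>i. ?c (i - 1)" and f = "\<lambda>i. m + of_int l - of_nat i" and n = n]])
      (auto simp: B_def)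
  have B0: "B 0 = 0" by (simp add: B_def)
  have fB': "finite {i. B (Suc i) \<noteq> 0}"
    using finite_vimageI[OF fB, of Suc] by (simp add: vimage_def)
  have "jacobi_left l m n P = Sum_any (\<lambda>i. A i + B i)"
    unfolding jacobi_left_def
  proof (rule Sum_any.cong)
    fix i
    show "s ((-1) ^ i * (of_int l gchoose i)) (P (m + of_int l - of_nat i) (n + of_nat i)) = A i + B i"
    proof (cases i)
      case (Suc k)
      have "(-1) ^ i * (of_int l gchoose i) = ?c i - ?c k"
        unfolding Suc gchoose_Suc_pascal[of l k] by (simp add: algebra_simps)
      then show ?thesis by (simp add: A_def B_def Suc scale_left_diff_distrib)
    qed (simp add: A_def B_def)
  qed
  also have "\<dots> = Sum_any A + Sum_any (\<lambda>i. B (Suc i))"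
    by (simp only: Sum_any.distrib[OF fA fB] Sum_any_nat_shift[of B, OF B0])
  also have "\<dots> = Sum_any (\<lambda>i. A i + B (Suc i))"
    by (simp only: Sum_any.distrib[OF fA fB'])
  also have "\<dots> = jacobi_left (l - 1) m n (mult_diff P)"
    unfolding jacobi_left_def
    by (rule Sum_any.cong) (simp add: A_def B_def mult_diff_def algebra_simps)
  finally show ?thesis .
qed

lemma jacobi_right_mult_diff:
  assumes "right_bounded P"
  shows "jacobi_right l m n P = jacobi_right (l - 1) m n (mult_diff P)"
proof -
  let ?c = "\<lambda>i. (-1) powi (l - 1 - int i) * (of_int (l - 1) gchoose i) :: complex"
  define A where "A i = - s (?c i) (P (m + of_nat i) (n + of_int l - of_nat i))" for i
  define B where "B i = (if i = 0 then 0 else s (?c (i - 1)) (P (m + of_nat i) (n + of_int l - of_nat i)))" for i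
  have fA: "finite {i. A i \<noteq> 0}"
    using finite_right[OF assms, where c = ?c and f = "\<lambda>i. n + of_int l - of_nat i" and n = m]
    by (simp add: A_def)
  have fB: "finite {i. B i \<noteq> 0}"
    by (rule finite_subset[OF _ finite_right[OF assms, where c = "\<lambda>i. ?c (i - 1)" and f = "\<lambda>i. n + of_int l - of_nat i" and n = m]])
      (auto simp: B_def)
  have B0: "B 0 = 0" by (simp add: B_def)
  have fB': "finite {i. B (Suc i) \<noteq> 0}"
    using finite_vimageI[OF fB, of Suc] by (simp add: vimage_def)
  have pm: "(-1) powi (k - 1) = - ((-1) powi k :: complex)" for k :: int
    by (simp add: power_int_diff)
  have "jacobi_right l m n P = Sum_any (\<lambda>i. A i + B i)"
    unfolding jacobi_right_def
  proof (rule Sum_any.cong)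
    fix i
    show "s ((-1) powi (l - int i) * (of_int l gchoose i)) (P (m + of_nat i) (n + of_int l - of_nat i)) = A i + B i"
    proof (cases i)
      case 0
      then show ?thesis using pm[of l] by (simp add: A_def B_def)
    next
      case (Suc k)
      have "(-1) powi (l - 1 - int i) = - ((-1) powi (l - int i) :: complex)"
        using pm[of "l - int i"] by (simp add: algebra_simps)
      moreover have "l - 1 - int k = l - int i" using Suc by simp
      ultimately have "(-1) powi (l - int i) * (of_int l gchoose i) = - ?c i + ?c k"
        unfolding Suc gchoose_Suc_pascal[of l k] by (simp add: algebra_simps)
      then show ?thesis by (simp only: A_def B_def scale_left_distrib scale_minus_left) (simp add: Suc)
    qed
  qed
  also have "\<dots> = Sum_any A + Sum_any (\<lambda>i. B (Suc i))"
    by (simp only: Sum_any.distrib[OF fA fB] Sum_any_nat_shift[of B, OF B0])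
  also have "\<dots> = Sum_any (\<lambda>i. A i + B (Suc i))"
    by (simp only: Sum_any.distrib[OF fA fB'])
  also have "\<dots> = jacobi_right (l - 1) m n (mult_diff P)"
    unfolding jacobi_right_def
    by (rule Sum_any.cong) (simp add: A_def B_def mult_diff_def algebra_simps)
  finally show ?thesis .
qed

lemma gchoose_0_Suc: "(0::complex) gchoose Suc i = 0"
  using gbinomial_0(2) by blast

lemma jacobi_left_0: "jacobi_left 0 m n P = P m n"
proof -
  have "jacobi_left 0 m n P = (\<Sum>i\<in>{0::nat}. s ((-1) ^ i * (of_int 0 gchoose i))
     (P (m + of_int 0 - of_nat i) (n + of_nat i)))"
    unfolding jacobi_left_def
  proof (rule Sum_any_eq_sum)
    fix i :: nat assume "i \<notin> {0}"
    then obtain j where "i = Suc j" by (cases i) auto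
    then show "s ((-1) ^ i * (of_int 0 gchoose i)) (P (m + of_int 0 - of_nat i) (n + of_nat i)) = 0"
      by (simp add: gchoose_0_Suc)
  qed simp
  then show ?thesis by simp
qed

lemma jacobi_right_0: "jacobi_right 0 m n P = P m n"
proof -
  have "jacobi_right 0 m n P = (\<Sum>i\<in>{0::nat}. s ((-1) powi (0 - int i) * (of_int 0 gchoose i))
     (P (m + of_nat i) (n + of_int 0 - of_nat i)))"
    unfolding jacobi_right_def
  proof (rule Sum_any_eq_sum)
    fix i :: nat assume "i \<notin> {0}"
    then obtain j where "i = Suc j" by (cases i) auto
    then show "s ((-1) powi (0 - int i) * (of_int 0 gchoose i)) (P (m + of_nat i) (n + of_int 0 - of_nat i)) = 0"
      by (simp add: gchoose_0_Suc)
  qed simp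
  then show ?thesis by simp
qed

lemma jacobi_left_sum:
  "jacobi_left (int k) m n P = (\<Sum>i\<le>k. s ((-1) ^ i * of_nat (k choose i)) (P (m + of_nat k - of_nat i) (n + of_nat i)))"
  unfolding jacobi_left_def
  by (subst Sum_any_eq_sum[where A = "{..k}"]) (auto simp: binomial_eq_0 simp flip: binomial_gbinomial)

lemma jacobi_right_sum:
  "jacobi_right (int k) m n P = (\<Sum>i\<le>k. s ((-1) powi (int k - int i) * of_nat (k choose i)) (P (m + of_nat i) (n + of_nat k - of_nat i)))"
  unfolding jacobi_right_def
  by (subst Sum_any_eq_sum[where A = "{..k}"]) (auto simp: binomial_eq_0 simp flip: binomial_gbinomial)

text \<open>If P is bounded on both sides, both expansions of (z1-z2)^l can be applied to the same
  P. Their difference has the coefficients of \<open>delta_coefficients\<close>.\<close>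

lemma residue_delta:
  assumes "left_bounded P" "right_bounded P"
  shows "Sum_any (\<lambda>a::int. s (fls_residue (lexp (of_int (- a)) * lexpm1 powi l))
            (P (m + of_int a) (n + of_int (l - a)))) = jacobi_left l m n P - jacobi_right l m n P"
proof -
  define p where "p a = P (m + of_int a) (n + of_int (l - a))" for a :: int
  obtain N where N: "\<And>a b. b \<ge> N \<Longrightarrow> P a b = 0" using assms by (auto simp: left_bounded_def)
  obtain K where K: "\<And>a b. a \<ge> K \<Longrightarrow> P a b = 0" using assms by (auto simp: right_bounded_def)
  have "finite {a. p a \<noteq> 0}"
  proof (rule finite_subset)
    show "{a. p a \<noteq> 0} \<subseteq> {l - \<lceil>N - n\<rceil>..\<lceil>K - m\<rceil>}"
    proof
      fix a assume "a \<in> {a. p a \<noteq> 0}"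
      then have "\<not> n + of_int (l - a) \<ge> N" "\<not> m + of_int a \<ge> K" using N K by (auto simp: p_def)
      then have "of_int (l - a) \<le> N - n" "of_int a \<le> K - m" by linarith+
      then have "l - a \<le> \<lceil>N - n\<rceil>" "a \<le> \<lceil>K - m\<rceil>" by linarith+
      then show "a \<in> {l - \<lceil>N - n\<rceil>..\<lceil>K - m\<rceil>}" by simp
    qed
  qed simp
  then have fin: "finite {a. (if a \<in> S then s (c a) (p a) else 0) \<noteq> 0}" for c and S :: "int set"
    by (rule rev_finite_subset) auto
  define cl where "cl a = (-1) ^ nat (l - a) * (of_int l gchoose nat (l - a) :: complex)" for a
  define cr where "cr a = (-1) powi (l - a) * (of_int l gchoose nat a :: complex)" for a
  \<comment> \<open>Both sums are reindexed by the shift a of the first mode: a = l - i on the left,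
    a = i on the right.\<close>
  have rl: "range (\<lambda>i::nat. l - int i) = {a. a \<le> l}"
    by (auto intro!: image_eqI[of _ _ "nat (l - x)" for x])
  have rr: "range (\<lambda>i::nat. int i) = {a. a \<ge> 0}"
    by (auto intro!: image_eqI[of _ _ "nat x" for x])
  have L: "jacobi_left l m n P = Sum_any (\<lambda>a. if a \<in> {a. a \<le> l} then s (cl a) (p a) else 0)"
  proof -
    have "jacobi_left l m n P = Sum_any (\<lambda>i. s (cl (l - int i)) (p (l - int i)))"
      unfolding jacobi_left_def cl_def p_def by (rule Sum_any.cong) (simp add: add_diff_eq)
    also have "\<dots> = Sum_any (\<lambda>a. if a \<in> range (\<lambda>i::nat. l - int i) then s (cl a) (p a) else 0)"
      by (rule Sum_any_reindex_inj) (auto simp: inj_def)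
    finally show ?thesis unfolding rl .
  qed
  have R: "jacobi_right l m n P = Sum_any (\<lambda>a. if a \<in> {a. a \<ge> 0} then s (cr a) (p a) else 0)"
  proof -
    have "jacobi_right l m n P = Sum_any (\<lambda>i. s (cr (int i)) (p (int i)))"
      unfolding jacobi_right_def cr_def p_def by (rule Sum_any.cong) (simp add: add_diff_eq)
    also have "\<dots> = Sum_any (\<lambda>a. if a \<in> range (\<lambda>i::nat. int i) then s (cr a) (p a) else 0)"
      by (rule Sum_any_reindex_inj) auto
    finally show ?thesis unfolding rr .
  qed
  show ?thesis unfolding L R Sum_any_diff[OF fin fin, symmetric] delta_coefficients p_def[symmetric]
    by (rule Sum_any.cong) (auto simp: scale_left_diff_distrib cl_def cr_def)
qed

text \<open>Locality makes (z1-z2)^k P and (z1-z2)^k Q one series R, so the right-hand side is the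
  difference of the two expansions of (z1-z2)^(l-k) applied to R. Each induction step moves one
  factor z1 - z2 into P and Q until they coincide.\<close>

lemma jacobi_delta:
  assumes "left_bounded P" "right_bounded Q"
    and "\<And>m n. jacobi_left (int k) m n P = jacobi_right (int k) m n Q"
  shows "Sum_any (\<lambda>a::int. s (fls_residue (lexp (of_int (- a)) * lexpm1 powi (l - int k)))
            (jacobi_left (int k) (m + of_int a) (n + of_int (l - int k - a)) P))
         = jacobi_left l m n P - jacobi_right l m n Q"
  using assms
proof (induction k arbitrary: P Q l)
  case 0
  have "P = Q" using 0(3) by (simp add: jacobi_left_0 jacobi_right_0 fun_eq_iff)
  with residue_delta[of P l m n] 0(1,2) show ?case by (simp add: jacobi_left_0)
next
  case (Suc k)
  have L: "jacobi_left (int (Suc k)) m n P = jacobi_left (int k) m n (mult_diff P)" for m n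
    by (subst jacobi_left_mult_diff[OF Suc.prems(1)]) simp
  have R: "jacobi_right (int (Suc k)) m n Q = jacobi_right (int k) m n (mult_diff Q)" for m n
    by (subst jacobi_right_mult_diff[OF Suc.prems(2)]) simp
  have e: "l - int (Suc k) = (l - 1) - int k" by simp
  have "jacobi_left (int k) m n (mult_diff P) = jacobi_right (int k) m n (mult_diff Q)" for m n
    using Suc.prems(3)[of m n] by (simp only: L R)
  from Suc.IH[OF left_bounded_mult_diff[OF Suc.prems(1)] right_bounded_mult_diff[OF Suc.prems(2)] this, of "l - 1"]
  show ?case unfolding L e
    by (simp only: jacobi_left_mult_diff[OF Suc.prems(1), of l] jacobi_right_mult_diff[OF Suc.prems(2), of l])
qed

end

subsection \<open>Expansions in exponentials\<close>

context complex_space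
begin

text \<open>For finitely supported A this is Res f(x) F(x), with F the exponential sum of the A_p
  e^(px): the counterpart of \<open>pair\<close> after x1^p has become x2^p e^(px).\<close>

definition exp_sum :: "complex fls \<Rightarrow> (rat \<Rightarrow> 'w) \<Rightarrow> 'w" where
  "exp_sum f A = Sum_any (\<lambda>p. s (fls_residue (f * lexp (of_rat p))) (A p))"

lemma exp_sum_eq_sum:
  assumes "finite S" "\<And>p. p \<notin> S \<Longrightarrow> A p = 0"
  shows "exp_sum f A = (\<Sum>p\<in>S. s (fls_residue (f * lexp (of_rat p))) (A p))"
  unfolding exp_sum_def by (rule Sum_any_eq_sum) (use assms in auto)

lemma cont_exp_sum:
  assumes "finite {p. A p \<noteq> 0}"
  shows "cont (\<lambda>f. exp_sum f A)"
proof -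
  have "(\<lambda>f. exp_sum f A) = (\<lambda>f. \<Sum>p\<in>{p. A p \<noteq> 0}. s (fls_residue (f * lexp (of_rat p))) (A p))"
    using exp_sum_eq_sum[OF assms, of A] by (simp add: fun_eq_iff)
  then show ?thesis by (simp only:) (intro cont_sum cont_residue)
qed

lemma exp_sum_add:
  assumes "finite {p. A p \<noteq> 0}" "finite {p. B p \<noteq> 0}"
  shows "exp_sum f (\<lambda>p. A p + B p) = exp_sum f A + exp_sum f B"
proof -
  let ?S = "{p. A p \<noteq> 0} \<union> {p. B p \<noteq> 0}"
  have "exp_sum f C = (\<Sum>p\<in>?S. s (fls_residue (f * lexp (of_rat p))) (C p))"
    if "C \<in> {A, B, \<lambda>p. A p + B p}" for C
    by (rule exp_sum_eq_sum) (use that assms in auto)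
  then show ?thesis by (simp add: scale_right_distrib sum.distrib)
qed

lemma exp_sum_scale:
  assumes "finite {p. A p \<noteq> 0}"
  shows "exp_sum f (\<lambda>p. s c (A p)) = s c (exp_sum f A)"
proof -
  let ?S = "{p. A p \<noteq> 0}"
  have "exp_sum f C = (\<Sum>p\<in>?S. s (fls_residue (f * lexp (of_rat p))) (C p))"
    if "C \<in> {A, \<lambda>p. s c (A p)}" for C
    by (rule exp_sum_eq_sum) (use that assms in auto)
  then show ?thesis by (simp only: insert_iff simp_thms scale_sum_right scale_left_commute[of c])
qed

lemma exp_sum_shift: "exp_sum f (\<lambda>p. A (p - r)) = exp_sum (f * lexp (of_rat r)) A"
proof -
  have "bij (\<lambda>p. p + r)" by (rule bijI) (auto simp: inj_def surj_def intro: exI[of _ "y - r" for y])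
  then have "Sum_any (\<lambda>p. s (fls_residue (f * lexp (of_rat p))) (A (p - r)))
     = Sum_any (\<lambda>p. s (fls_residue (f * lexp (of_rat (p + r)))) (A (p + r - r)))"
    by (rule Sum_any.reindex_cong) (simp add: fun_eq_iff)
  then show ?thesis unfolding exp_sum_def by (simp add: of_rat_add lexp_add mult_ac)
qed

text \<open>Multiplying an exponential sum by e^x - 1 takes differences of its coefficients. This is
  what one more factor x1 - x2 does.\<close>

lemma exp_sum_diff_shift:
  assumes "finite {p. A p \<noteq> 0}"
  shows "exp_sum f (\<lambda>p. A (p - 1) - A p) = exp_sum (f * lexpm1) A"
proof -
  have 1: "finite {p. A (p - 1) \<noteq> 0}"
    using finite_vimageI[OF assms, of "\<lambda>p. p - 1"] by (simp add: vimage_def inj_def)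
  have 2: "finite {p. s (-1) (A p) \<noteq> 0}" using assms by simp
  have "exp_sum f (\<lambda>p. A (p - 1) + s (-1) (A p)) = exp_sum (f * lexp (of_rat 1)) A - exp_sum f A"
    by (subst exp_sum_add[OF 1 2]) (simp only: exp_sum_shift exp_sum_scale[OF assms], simp)
  also have "\<dots> = exp_sum (f * lexpm1) A"
    using contD(4)[OF cont_exp_sum[OF assms], of "f * lexp 1" f] by (simp add: lexpm1_def algebra_simps)
  finally show ?thesis by simp
qed

lemma residue_X_intpow_mult: "fls_residue (fls_X_intpow (- j - 1) * f) = f $$ j"
  for f :: "complex fls"
  by (metis fls_residue_shift_nth)

lemma exp_sum_X_intpow:
  "exp_sum (fls_X_intpow (- j - 1)) A =
   (if j < 0 then 0 else Sum_any (\<lambda>p. s (fps_nth (fps_exp (of_rat p)) (nat j)) (A p)))"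
  unfolding exp_sum_def residue_X_intpow_mult by (auto simp: lexp_def)

lemma exp_sum_inj:
  assumes A: "finite {p. A p \<noteq> 0}" and B: "finite {p. B p \<noteq> 0}"
    and eq: "\<And>f. exp_sum f A = exp_sum f B"
  shows "A q = B q"
proof (cases "q \<in> {p. A p \<noteq> 0} \<union> {p. B p \<noteq> 0}")
  case True
  let ?S = "{p. A p \<noteq> 0} \<union> {p. B p \<noteq> 0}" and ?C = "\<lambda>p. A p - B p"
  have "(\<Sum>q\<in>?S. s (of_rat q ^ j) (?C q)) = 0" for j :: nat
  proof -
    have *: "exp_sum f C = (\<Sum>p\<in>?S. s (fls_residue (f * lexp (of_rat p))) (C p))" if "C \<in> {A, B}" for f C
      by (rule exp_sum_eq_sum) (use that assms in auto)
    have "(\<Sum>p\<in>?S. s (fls_residue (fls_X_intpow (- int j - 1) * lexp (of_rat p))) (?C p)) = 0"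
      using eq[of "fls_X_intpow (- int j - 1)"] by (simp add: * scale_right_diff_distrib sum_subtractf)
    then have "(\<Sum>p\<in>?S. s (1 / fact j) (s (of_rat p ^ j) (?C p))) = 0"
      unfolding residue_X_intpow_mult by (simp add: lexp_def)
    then have "s (1 / fact j) (\<Sum>p\<in>?S. s (of_rat p ^ j) (?C p)) = 0"
      by (simp only: scale_sum_right)
    then show ?thesis by simp
  qed
  from exponentials_independent[OF _ this True] A B show ?thesis by simp
qed auto

text \<open>Testing with x^(-j-1) reads off the coefficient of x^j, and exponential sums have none
  for j < 0. Since e^x - 1 is invertible among Laurent series, its k-th power can be moved to the
  other side.\<close>

lemma phi_coefficients_iff:
  assumes "bounded_above d" "finite {p. A p \<noteq> 0}"
  shows "(\<forall>j::int. Sum_any (\<lambda>i::nat. s (fps_nth ((fps_exp 1 - 1) ^ k) i) (d (int i - j - 1))) =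
      (if j < 0 then 0 else Sum_any (\<lambda>p. s (fps_nth (fps_exp (of_rat p)) (nat j)) (A p))))
    \<longleftrightarrow> (\<forall>f. pair f d = exp_sum (f * lexpm1 powi (- int k)) A)" (is "?L \<longleftrightarrow> ?R")
proof -
  have k: "fps_to_fls ((fps_exp 1 - 1) ^ k) = lexpm1 powi (int k)"
    by (simp add: lexpm1_fps fps_to_fls_power)
  have c: "f * lexpm1 powi (int k) * lexpm1 powi (- int k) = f"
          "f * lexpm1 powi (- int k) * lexpm1 powi (int k) = f" for f
    by (simp_all add: mult.assoc power_int_minus)
  have "Sum_any (\<lambda>i::nat. s (fps_nth ((fps_exp 1 - 1) ^ k) i) (d (int i - j - 1)))
      = pair (fls_X_intpow (- j - 1) * lexpm1 powi (int k)) d" for j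
  proof -
    have "pair (fls_X_intpow (- j - 1) * lexpm1 powi (int k)) d
        = pair (fps_to_fls ((fps_exp 1 - 1) ^ k) * fls_X_intpow (- j - 1)) d" by (simp only: k mult.commute)
    also have "\<dots> = pair (fps_to_fls ((fps_exp 1 - 1) ^ k)) (\<lambda>i. d (i + (- j - 1)))"
      by (rule pair_mult_X_intpow)
    also have "\<dots> = Sum_any (\<lambda>i::nat. s (fps_nth ((fps_exp 1 - 1) ^ k) i) (d (int i + (- j - 1))))"
      by (rule pair_fps)
    finally show ?thesis by (simp add: algebra_simps)
  qed
  then have L: "?L \<longleftrightarrow> (\<forall>j. pair (fls_X_intpow (- j - 1) * lexpm1 powi (int k)) d = exp_sum (fls_X_intpow (- j - 1)) A)"
    by (simp only: exp_sum_X_intpow)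
  show ?thesis
  proof
    assume "?L"
    have "pair (f * lexpm1 powi (int k)) d = exp_sum f A" for f
    proof (rule cont_eq)
      show "cont (\<lambda>f. pair (f * lexpm1 powi int k) d)" by (rule cont_mult[OF cont_pair[OF assms(1)]])
      show "cont (\<lambda>f. exp_sum f A)" by (rule cont_exp_sum[OF assms(2)])
      show "pair (fls_X_intpow n * lexpm1 powi int k) d = exp_sum (fls_X_intpow n) A" for n
        using \<open>?L\<close>[unfolded L, rule_format, of "- n - 1"] by simp
    qed
    from this[of "f * lexpm1 powi (- int k)" for f] show "?R" by (simp only: c) simp
  next
    assume R: "?R"
    show "?L" unfolding L using R[rule_format, of "fls_X_intpow (- j - 1) * lexpm1 powi (int k)" for j]
      by (simp only: c) simp
  qed
qed

lemma jacobi_left_add: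
  "jacobi_left (int k) m n (\<lambda>a b. P a b + Q a b) = jacobi_left (int k) m n P + jacobi_left (int k) m n Q"
  by (simp add: jacobi_left_sum scale_right_distrib sum.distrib)

lemma jacobi_left_Suc:
  assumes "left_bounded P"
  shows "jacobi_left (int (Suc k)) m n P = jacobi_left (int k) (m + 1) n P - jacobi_left (int k) m (n + 1) P"
  using jacobi_left_mult_diff[OF assms, of "int (Suc k)" m n]
  by (simp add: jacobi_left_sum mult_diff_def scale_right_diff_distrib sum_subtractf algebra_simps)

lemma jacobi_right_swap:
  "jacobi_right (int k) m n (\<lambda>a b. P b a) = s ((-1) ^ k) (jacobi_left (int k) n m P)"
proof -
  have "(-1) powi (int k - int i) = ((-1) ^ k * (-1) ^ i :: complex)" for i
    by (simp add: power_int_diff divide_inverse flip: power_inverse)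
  then show ?thesis
    by (simp add: jacobi_right_sum jacobi_left_sum scale_sum_right mult_ac)
qed

text \<open>This is \<open>jacobi_delta\<close> with the integer shift a replaced by the exponent p
  of x1. The sum over all rational p adds nothing, because P lives on the coset of m in its first
  index.\<close>

lemma jacobi_delta_exp_sum:
  fixes m :: rat
  assumes "left_bounded P" "right_bounded Q"
    and loc: "\<And>m n. jacobi_left (int k) m n P = jacobi_right (int k) m n Q"
    and coset: "\<And>a b. a - m \<notin> \<int> \<Longrightarrow> P a b = 0"
  shows "jacobi_left l m n P - jacobi_right l m n Q =
    exp_sum (lexp (of_rat m + 1) * lexpm1 powi l * lexpm1 powi (- int k))
      (\<lambda>p. jacobi_left (int k) (- p - 1) (m + n + of_int l + 1 + p - of_nat k) P)"
proof -
  define F where "F p = s (fls_residue (lexp (of_rat m + 1) * lexpm1 powi l * lexpm1 powi (- int k) * lexp (of_rat p)))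
     (jacobi_left (int k) (- p - 1) (m + n + of_int l + 1 + p - of_nat k) P)" for p :: rat
  \<comment> \<open>The exponent p = -m-1-a corresponds to the mode index -p-1 = m + a.\<close>
  define h where "h a = - m - 1 - rat_of_int a" for a
  have F: "F p = s (fls_residue (lexp (of_rat m + 1 + of_rat p) * lexpm1 powi (l - int k)))
     (jacobi_left (int k) (- p - 1) (m + n + of_int l + 1 + p - of_nat k) P)" for p
    by (simp add: F_def lexp_add power_int_diff power_int_minus field_simps)
  have "F p = 0" if "p \<notin> range h" for p
  proof -
    have "- p - 1 + of_nat k - of_nat i - m \<notin> \<int>" for i :: nat
    proof
      assume "- p - 1 + of_nat k - of_nat i - m \<in> \<int>"
      then obtain z where "- p - 1 + of_nat k - of_nat i - m = of_int z" by (auto elim: Ints_cases)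
      then have "p = h (z + int i - int k)" by (simp add: h_def algebra_simps)
      with that show False by blast
    qed
    then show ?thesis by (simp add: F jacobi_left_sum coset)
  qed
  then have "Sum_any F = Sum_any (\<lambda>p. if p \<in> range h then F p else 0)"
    by (intro Sum_any.cong) auto
  also have "\<dots> = Sum_any (\<lambda>a. F (h a))"
    by (rule Sum_any_reindex_inj[symmetric]) (auto simp: inj_def h_def)
  also have "\<dots> = jacobi_left l m n P - jacobi_right l m n Q"
  proof (subst jacobi_delta[OF assms(1,2) loc, symmetric], rule Sum_any.cong)
    fix a
    have "- h a - 1 = m + of_int a" "m + n + of_int l + 1 + h a - of_nat k = n + of_int (l - int k - a)"
      by (simp_all add: h_def)
    moreover have "of_rat m + 1 + of_rat (h a) = (of_int (- a) :: complex)"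
      by (simp add: h_def of_rat_diff of_rat_minus)
    ultimately show "F (h a) = s (fls_residue (lexp (of_int (- a)) * lexpm1 powi (l - int k)))
            (jacobi_left (int k) (m + of_int a) (n + of_int (l - int k - a)) P)"
      by (simp only: F)
  qed
  finally show ?thesis by (simp only: exp_sum_def F_def[abs_def])
qed

end

subsection \<open>The Jacobi identity for \<open>\<phi>\<close>-coordinated modules\<close>

lemma frac_int_of_int [simp]: "T \<ge> 1 \<Longrightarrow> of_int k \<in> frac_int T"
  by (auto simp: frac_int_def intro!: exI[of _ "k * int T"])

lemma frac_int_of_nat [simp]: "T \<ge> 1 \<Longrightarrow> of_nat k \<in> frac_int T"
  using frac_int_of_int[of T "int k"] by simp

lemma frac_int_1 [simp]: "T \<ge> 1 \<Longrightarrow> 1 \<in> frac_int T"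
  using frac_int_of_int[of T 1] by simp

lemma frac_int_frac [simp]: "of_nat r / of_nat T \<in> frac_int T"
  by (auto simp: frac_int_def intro!: exI[of _ "int r"])

lemma frac_int_add: "a \<in> frac_int T \<Longrightarrow> b \<in> frac_int T \<Longrightarrow> a + b \<in> frac_int T"
  unfolding frac_int_def by (clarsimp simp flip: add_divide_distrib) (metis of_int_add)

lemma frac_int_uminus: "a \<in> frac_int T \<Longrightarrow> - a \<in> frac_int T"
  unfolding frac_int_def by clarsimp (metis minus_divide_left of_int_minus)

lemma frac_int_diff: "a \<in> frac_int T \<Longrightarrow> b \<in> frac_int T \<Longrightarrow> a - b \<in> frac_int T"
  using frac_int_add[of a T "- b"] frac_int_uminus[of b T] by simp

lemma finite_frac_int_Icc:
  assumes "T \<ge> 1"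
  shows "finite {p \<in> frac_int T. a \<le> p \<and> p \<le> b}"
proof (rule finite_subset)
  show "{p \<in> frac_int T. a \<le> p \<and> p \<le> b} \<subseteq>
      (\<lambda>k. of_int k / of_nat T) ` {\<lceil>a * of_nat T\<rceil>..\<lfloor>b * of_nat T\<rfloor>}"
  proof
    fix p assume "p \<in> {p \<in> frac_int T. a \<le> p \<and> p \<le> b}"
    then obtain k where k: "p = of_int k / of_nat T" "a \<le> p" "p \<le> b" by (auto simp: frac_int_def)
    then have "a * of_nat T \<le> of_int k" "of_int k \<le> b * of_nat T"
      using assms mult_right_mono[of a p "of_nat T"] mult_right_mono[of p b "of_nat T"] by simp_all
    then have "k \<in> {\<lceil>a * of_nat T\<rceil>..\<lfloor>b * of_nat T\<rfloor>}" by (simp add: ceiling_le_iff le_floor_iff)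
    then show "p \<in> (\<lambda>k. of_int k / of_nat T) ` {\<lceil>a * of_nat T\<rceil>..\<lfloor>b * of_nat T\<rfloor>}"
      using k(1) by blast
  qed
qed simp

text \<open>Substitute x -> -x: a residue changes sign, x^l gives (-1)^l, and e^(-x) - 1 = -e^(-x)
  (e^x - 1) gives (-1)^k and the factor e^(kx) that turns c into k - c.\<close>

lemma residue_reflect:
  "fls_residue (fls_X_intpow l * lexp c * lexpm1 powi (- int k)) =
   - ((-1) powi l * (-1) ^ k * fls_residue (fls_X_intpow l * lexp (of_nat k - c) * lexpm1 powi (- int k)))"
proof -
  define G :: "complex fps" where "G = fps_const (-1) * fps_X"
  have G: "G \<noteq> 0" "G $ 0 = 0" by (auto simp: G_def)
  note hom = fls_compose_fps_mult[OF G] fls_compose_fps_powi[OF G] fls_compose_fps_diff[OF G]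
  have e: "fls_compose_fps (lexp a) G = lexp (- a)" for a by (simp add: lexp_def G_def)
  have "lexp (-1) - 1 = - lexp (-1) * lexpm1"
    by (simp add: lexpm1_def algebra_simps flip: lexp_add)
  then have m: "fls_compose_fps lexpm1 G = fls_const (-1) * (lexp (- 1) * lexpm1)"
    unfolding lexpm1_def hom e by (simp add: G lexpm1_def)
  have le: "lexp (- 1) powi (- int k) = lexp (of_nat k)"
  proof -
    have "lexp (- 1) ^ k = lexp (- of_nat k)"
      by (induction k) (simp_all flip: lexp_add)
    moreover have "inverse (lexp (- of_nat k)) = lexp (of_nat k)"
      by (rule inverse_unique) simp
    ultimately show ?thesis by (simp add: power_int_minus)
  qed
  have x: "fls_compose_fps (fls_X_intpow l) G = fls_const ((-1) powi l) * fls_X_intpow l"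
    by (rule fls_eqI) (simp add: G_def fls_nth_fls_compose_fps_linear del: fps_const_neg)
  have "(-1 :: complex fls) powi (- int k) = fls_const ((-1) ^ k)"
    by (simp add: power_int_minus fls_const_power flip: power_inverse)
  then have "fls_compose_fps (fls_X_intpow l * lexp c * lexpm1 powi (- int k)) G =
     fls_const ((-1) powi l * (-1) ^ k) * (fls_X_intpow l * lexp (of_nat k - c) * lexpm1 powi (- int k))"
    unfolding hom e m x power_int_mult_distrib le
    by (simp add: lexp_add mult_ac flip: fls_const_power_int)
       (simp add: diff_conv_add_uminus lexp_add mult_ac del: add_uminus_conv_diff)
  note reflected = this
  have "F $$ (-1) = - (fls_compose_fps F G $$ (-1))" for F
    unfolding G_def by (subst fls_nth_fls_compose_fps_linear) auto
  from this[of "fls_X_intpow l * lexp c * lexpm1 powi (- int k)"]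
  show ?thesis unfolding reflected by simp
qed

lemma sum_unity_root_powers:
  fixes i T :: nat
  assumes "0 < i" "i < T"
  shows "(\<Sum>r<T. cis (2 * pi * real i / real T) ^ r) = 0"
proof -
  let ?z = "cis (2 * pi * real i / real T)"
  have b: "bij_betw (\<lambda>k. cis (2 * pi * real k / real T)) {..<T} {z. z ^ T = 1}"
    using assms by (intro bij_betw_roots_unity) simp
  from bij_betw_apply[OF b, of i] have "?z ^ T = 1" using assms by simp
  moreover have "?z \<noteq> 1"
    using bij_betw_imp_inj_on[OF b, THEN inj_onD, of i 0] assms by auto
  ultimately show ?thesis using sum_gp_strict[of ?z T] by simp
qed

section \<open>Skew symmetry in the algebra and the eigenspaces of the automorphism\<close>

context vertex_operator_algebra
begin

sublocale complex_space s
  by unfold_locales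

lemma linear_right: "Vector_Spaces.linear s s (Y v n)"
  and linear_left: "Vector_Spaces.linear s s (\<lambda>v. Y v n w)"
  using bilinear by (auto simp: bilinear_modes_def)

lemma bounded_above_modes: "bounded_above (\<lambda>j. Y u j v)"
  using truncation[of u v] by (auto simp: bounded_above_def)

lemma gchoose_minus_1: "(- 1 :: complex) gchoose i = (- 1) ^ i"
  by (subst gbinomial_negated_upper) (simp flip: binomial_gbinomial)

lemma Y_zero_right [simp]: "Y u n 0 = 0"
proof -
  interpret l: Vector_Spaces.linear s s "Y u n" by (rule linear_right)
  show ?thesis by (rule l.zero)
qed

lemma Y_zero_left [simp]: "Y 0 n w = 0"
proof -
  interpret l: Vector_Spaces.linear s s "\<lambda>v. Y v n w" by (rule linear_left)
  show ?thesis by (rule l.zero)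
qed

text \<open>Y(v,x)u = e^(xL(-1)) Y(u,-x)v, with L(-1)^i a / i! written as the mode a_(-1-i) applied
  to the vacuum. In this form it can be transported to a module using only the module axiom for
  pairs (a, vacuum). It is the Jacobi identity on the vacuum at m = -1, n = 0, where creation kills
  one sum and all but one term of the other.\<close>

lemma skew_symmetry:
  "Y v l u = Sum_any (\<lambda>i::nat. s (- ((-1) powi l * (-1) ^ i)) (Y (Y u (l + int i) v) (- 1 - int i) vac))"
proof -
  let ?S = "\<lambda>i::nat. s ((-1) powi (l - int i) * (of_int l gchoose i)) (Y v (0 + l - int i) (Y u (- 1 + int i) vac))"
  let ?R = "\<lambda>i::nat. s (of_int (- 1) gchoose i) (Y (Y u (l + int i) v) (- 1 + 0 - int i) vac)"
  have "Sum_any (\<lambda>i::nat. s ((-1) ^ i * (of_int l gchoose i)) (Y u (- 1 + l - int i) (Y v (0 + int i) vac))) = 0"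
    by (simp add: creation)
  moreover have "Sum_any ?S = (\<Sum>i\<in>{0}. ?S i)"
    by (rule Sum_any_eq_sum) (auto simp: creation)
  ultimately have "- s ((-1) powi l) (Y v l u) = Sum_any ?R"
    using jacobi[of l u "-1" v 0 vac] by (simp add: creation)
  moreover have "s (- ((-1) powi l)) (- s ((-1) powi l) (Y v l u)) = Y v l u"
    by (simp flip: power_int_mult_distrib)
  ultimately have "Y v l u = s (- ((-1) powi l)) (Sum_any ?R)" by simp
  also have "\<dots> = Sum_any (\<lambda>i. s (- ((-1) powi l)) (?R i))"
    by (simp add: Sum_any.expand_set scale_sum_right)
  finally show ?thesis by (simp add: gchoose_minus_1)
qed

end

locale twisted_setup = vertex_operator_algebra sV YV vac \<omega> + W: complex_space sW
  for sV :: "complex \<Rightarrow> 'v::ab_group_add \<Rightarrow> 'v" and YV vac \<omega>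
    and sW :: "complex \<Rightarrow> 'w::ab_group_add \<Rightarrow> 'w" +
  fixes g :: "'v \<Rightarrow> 'v" and T :: nat
  assumes automorphism: "voa_automorphism sV YV vac \<omega> g"
    and T: "T \<ge> 1" and g_power: "g ^^ T = id"
begin

abbreviation "E r \<equiv> eigenspace sV g T r"

lemma linear_g: "Vector_Spaces.linear sV sV g"
  using automorphism by (simp add: voa_automorphism_def)

lemma eigenspace_decomposition: "\<exists>f. (\<forall>r<T. f r \<in> E r) \<and> u = (\<Sum>r<T. f r)"
proof -
  interpret g: Vector_Spaces.linear sV sV g by (rule linear_g)
  define z where "z k = cis (2 * pi * real_of_int k / real T)" for k :: int
  have z_add: "z (a + b) = z a * z b" for a b
    by (simp add: z_def cis_mult ring_distribs add_divide_distrib)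
  have zT: "z (int T * k) = 1" for k
    using T by (simp add: z_def cis_multiple_2pi[of "real_of_int k", unfolded mult.assoc] mult.assoc)
  \<comment> \<open>The projection onto the r-th eigenspace, as a discrete Fourier transform over
    the powers of g.\<close>
  define f where "f r = sV (1 / of_nat T) (\<Sum>i<T. sV (z (- int r * int i)) ((g ^^ i) u))" for r
  have "g (f r) = sV (z (int r)) (f r)" for r
  proof -
    \<comment> \<open>Applying g shifts the sum cyclically; the ends match because g^T and the T-th
      power of the root of unity are both 1.\<close>
    have sh: "(\<Sum>i<T. h (Suc i)) = (\<Sum>i<T. h i)" if "h T = h 0" for h :: "nat \<Rightarrow> 'v"
      using that sum.lessThan_Suc_shift[of h T] sum.lessThan_Suc[of h T] by (simp add: add.commute)
    define h where "h i = sV (z (- int r * (int i - 1))) ((g ^^ i) u)" for i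
    have "z (- int r * (int T - 1)) = z (int T * (- int r)) * z (- int r * (0 - 1))"
      by (simp only: z_add[symmetric]) (simp add: algebra_simps)
    then have "h T = h 0" by (simp only: h_def g_power zT) simp
    have "g (f r) = sV (1 / of_nat T) (\<Sum>i<T. h (Suc i))"
      by (simp add: f_def g.scale g.sum h_def)
    also have "\<dots> = sV (1 / of_nat T) (\<Sum>i<T. h i)" by (simp only: sh[OF \<open>h T = h 0\<close>])
    also have "\<dots> = sV (1 / of_nat T) (\<Sum>i<T. sV (z (int r)) (sV (z (- int r * int i)) ((g ^^ i) u)))"
      by (simp add: h_def z_add[symmetric] algebra_simps)
    also have "\<dots> = sV (z (int r)) (f r)" by (simp add: f_def scale_sum_right mult.commute)
    finally show ?thesis .
  qed
  moreover have "z (int r) = exp (2 * of_real pi * \<i> * of_nat r / of_nat T)" for r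
    by (simp add: z_def cis_conv_exp mult_ac)
  ultimately have "f r \<in> E r" for r by (simp add: eigenspace_def)
  moreover have "u = (\<Sum>r<T. f r)"
  proof -
    have zc: "(\<Sum>r<T. z (- int r * int i)) = (if i = 0 then of_nat T else 0)" if "i < T" for i
    proof (cases "i = 0")
      case False
      have "z (- int r * int i) = cnj (cis (2 * pi * real i / real T) ^ r)" for r
        by (simp add: z_def DeMoivre cis_cnj mult_ac)
      then have "(\<Sum>r<T. z (- int r * int i)) = cnj (\<Sum>r<T. cis (2 * pi * real i / real T) ^ r)" by simp
      then show ?thesis using sum_unity_root_powers[of i T] that False by simp
    qed (simp add: z_def)
    have "(\<Sum>r<T. f r) = sV (1 / of_nat T) (\<Sum>i<T. sV (\<Sum>r<T. z (- int r * int i)) ((g ^^ i) u))"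
      unfolding f_def scale_sum_right[symmetric] by (subst sum.swap) (simp add: scale_sum_left)
    also have "(\<Sum>i<T. sV (\<Sum>r<T. z (- int r * int i)) ((g ^^ i) u)) =
       (\<Sum>i<T. if i = 0 then sV (of_nat T) u else 0)"
    proof (rule sum.cong)
      fix i assume "i \<in> {..<T}"
      then show "sV (\<Sum>r<T. z (- int r * int i)) ((g ^^ i) u) = (if i = 0 then sV (of_nat T) u else 0)"
        by (subst zc) auto
    qed simp
    also have "\<dots> = sV (of_nat T) u" using T by simp
    finally show ?thesis using T by simp
  qed
  ultimately show ?thesis by blast
qed

end

section \<open>Products of twisted vertex operators and their exponential expansions\<close>

locale twisted_operators = twisted_setup sV YV vac \<omega> sW g T
  for sV :: "complex \<Rightarrow> 'v::ab_group_add \<Rightarrow> 'v" and YV vac \<omega>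
    and sW :: "complex \<Rightarrow> 'w::ab_group_add \<Rightarrow> 'w" and g T +
  fixes Y :: "'v \<Rightarrow> rat \<Rightarrow> 'w \<Rightarrow> 'w"
  assumes operators: "twisted_vertex_operators sV vac g T sW Y"
begin

lemma Y_linear_right: "Vector_Spaces.linear sW sW (Y v n)"
  and Y_linear_left: "Vector_Spaces.linear sV sW (\<lambda>v. Y v n w)"
  using operators by (auto simp: twisted_vertex_operators_def bilinear_modes_def)

lemma Y_add_left: "Y (u + v) n w = Y u n w + Y v n w"
  and Y_scale_left: "Y (sV c u) n w = sW c (Y u n w)"
  and Y_0_left [simp]: "Y 0 n w = 0"
proof -
  interpret l: Vector_Spaces.linear sV sW "\<lambda>v. Y v n w" by (rule Y_linear_left)
  show "Y (u + v) n w = Y u n w + Y v n w" "Y (sV c u) n w = sW c (Y u n w)" "Y 0 n w = 0"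
    by (rule l.add, rule l.scale, rule l.zero)
qed

lemma Y_0_right [simp]: "Y u n 0 = 0"
proof -
  interpret l: Vector_Spaces.linear sW sW "Y u n" by (rule Y_linear_right)
  show ?thesis by (rule l.zero)
qed

lemma Y_frac: "n \<notin> frac_int T \<Longrightarrow> Y v n w = 0"
  and Y_truncation: "\<exists>N. \<forall>n\<ge>N. Y v n w = 0"
  and Y_vacuum: "Y vac n w = (if n = - 1 then w else 0)"
  and Y_eigenspace: "r < T \<Longrightarrow> v \<in> E r \<Longrightarrow> n - of_nat r / of_nat T \<notin> \<int> \<Longrightarrow> Y v n w = 0"
  using operators by (auto simp: twisted_vertex_operators_def)

definition product :: "'v \<Rightarrow> 'v \<Rightarrow> 'w \<Rightarrow> rat \<Rightarrow> rat \<Rightarrow> 'w" where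
  "product u v w a b = Y u a (Y v b w)"

text \<open>The indices a and b belong to u and v in both orders, so \<open>product\<close> and
  \<open>opposite\<close> describe coefficients of the same monomial.\<close>

definition opposite :: "'v \<Rightarrow> 'v \<Rightarrow> 'w \<Rightarrow> rat \<Rightarrow> rat \<Rightarrow> 'w" where
  "opposite u v w a b = Y v b (Y u a w)"

lemma opposite_eq: "opposite u v w = (\<lambda>a b. product v u w b a)"
  by (simp add: opposite_def product_def fun_eq_iff)

definition modes :: "'v \<Rightarrow> 'v \<Rightarrow> 'w \<Rightarrow> rat \<Rightarrow> int \<Rightarrow> 'w" where
  "modes u v w N j = Y (YV u j v) N w"

text \<open>
  The coefficient of \<open>x1^p x2^(k-1-N-p)\<close> in \<open>(x1-x2)^k Y(u,x1) Y(v,x2) w\<close>; on substituting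
  \<open>x1 = x2 e^x0\<close>, these contribute to the coefficient in which \<open>Y(Y(u,x0)v,x2)\<close> enters through its
  mode of index \<open>N\<close>.
\<close>

definition cleared :: "nat \<Rightarrow> 'v \<Rightarrow> 'v \<Rightarrow> 'w \<Rightarrow> rat \<Rightarrow> rat \<Rightarrow> 'w" where
  "cleared k u v w N p = W.jacobi_left (int k) (- p - 1) (N + p - of_nat k) (product u v w)"

lemma cleared_product_coeff_eq:
  "cleared_product_coeff sW Y k u v w p q = W.jacobi_left (int k) (- p - 1) (- q - 1) (product u v w)"
  unfolding cleared_product_coeff_def W.jacobi_left_sum product_def
  by (simp add: algebra_simps)

lemma cleared_eq: "cleared k u v w N p = cleared_product_coeff sW Y k u v w p (of_nat k - 1 - N - p)"
  by (simp add: cleared_product_coeff_eq cleared_def algebra_simps)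

definition cleared_bounded :: "nat \<Rightarrow> 'v \<Rightarrow> 'v \<Rightarrow> bool" where
  "cleared_bounded k u v \<longleftrightarrow>
     (\<forall>w. \<exists>N. \<forall>p q. p < N \<or> q < N \<longrightarrow> cleared_product_coeff sW Y k u v w p q = 0)"

definition exp_expansion :: "nat \<Rightarrow> 'v \<Rightarrow> 'v \<Rightarrow> bool" where
  "exp_expansion k u v \<longleftrightarrow> (\<forall>w. \<forall>N\<in>frac_int T. \<forall>f.
     W.pair f (modes u v w N) = W.exp_sum (f * lexpm1 powi (- int k)) (cleared k u v w N))"

lemma bounded_above_modes: "W.bounded_above (modes u v w N)"
  using truncation[of u v] unfolding W.bounded_above_def modes_def by (metis Y_0_left)

lemma left_bounded_product: "W.left_bounded (product u v w)"
  using Y_truncation[of v w] unfolding W.left_bounded_def product_def by (metis Y_0_right)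

lemma right_bounded_opposite: "W.right_bounded (opposite u v w)"
  using Y_truncation[of u w] unfolding W.right_bounded_def opposite_def by (metis Y_0_right)

lemma jacobi_left_product_frac:
  assumes "a \<notin> frac_int T \<or> b \<notin> frac_int T"
  shows "W.jacobi_left (int k) a b (product u v w) = 0"
proof -
  have "a + of_nat k - of_nat i \<in> frac_int T \<Longrightarrow> a \<in> frac_int T" for i
    using frac_int_diff[OF _ frac_int_of_int[OF T], of "a + of_nat k - of_nat i" "int k - int i"] by simp
  moreover have "b + of_nat i \<in> frac_int T \<Longrightarrow> b \<in> frac_int T" for i
    using frac_int_diff[of "b + of_nat i" T "of_nat i"] T by simp
  ultimately have "product u v w (a + of_nat k - of_nat i) (b + of_nat i) = 0" for i
    using assms Y_frac by (metis Y_0_right product_def)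
  then show ?thesis by (simp add: W.jacobi_left_sum)
qed

lemma jacobi_right_opposite_frac:
  assumes "a \<notin> frac_int T \<or> b \<notin> frac_int T"
  shows "W.jacobi_right (int k) a b (opposite u v w) = 0"
  unfolding opposite_eq W.jacobi_right_swap using jacobi_left_product_frac[of b a] assms by auto

text \<open>The exponents p and k-1-N-p of the two variables are both bounded below, which confines
  p to a bounded part of (1/T)Z. The substitution x1 = x2 e^x0 is therefore a finite sum in each
  degree.\<close>

lemma finite_cleared:
  assumes "cleared_bounded k u v"
  shows "finite {p. cleared k u v w N p \<noteq> 0}"
proof -
  obtain M where M: "\<And>p q. p < M \<or> q < M \<Longrightarrow> cleared_product_coeff sW Y k u v w p q = 0"
    using assms unfolding cleared_bounded_def by blast
  have "p \<in> {p \<in> frac_int T. M \<le> p \<and> p \<le> of_nat k - 1 - N - M}" if "cleared k u v w N p \<noteq> 0" for p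
  proof -
    have "- p - 1 \<in> frac_int T"
      using that jacobi_left_product_frac unfolding cleared_def by blast
    then have "p \<in> frac_int T"
      using frac_int_uminus[of "- p - 1 + 1" T] frac_int_add[of "- p - 1" T 1] T by simp
    moreover have "\<not> p < M" "\<not> of_nat k - 1 - N - p < M"
      using that M unfolding cleared_eq by blast+
    ultimately show ?thesis by simp
  qed
  then show ?thesis
    by (intro finite_subset[OF _ finite_frac_int_Icc[OF T]] subsetI) blast
qed

lemma phi_coordinated_module_iff:
  "phi_coordinated_module sV YV vac g T sW Y \<longleftrightarrow> (\<forall>u v. \<exists>k. cleared_bounded k u v \<and> exp_expansion k u v)"
proof -
  have "(\<forall>w. \<forall>j::int. \<forall>t\<in>frac_int T.
           Sum_any (\<lambda>i::nat. sW (fps_nth ((fps_exp 1 - 1) ^ k) i)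
                               (Y (YV u (int i - j - 1) v) (of_nat k - t - 1) w))
         = (if j < 0 then 0
            else Sum_any (\<lambda>p. sW (fps_nth (fps_exp (of_rat p)) (nat j))
                                (cleared_product_coeff sW Y k u v w p (t - p)))))
       \<longleftrightarrow> exp_expansion k u v" (is "?L \<longleftrightarrow> _") if b: "cleared_bounded k u v" for u v k
  proof -
    have eq: "(\<forall>j::int. Sum_any (\<lambda>i::nat. sW (fps_nth ((fps_exp 1 - 1) ^ k) i)
                               (Y (YV u (int i - j - 1) v) N w))
         = (if j < 0 then 0
            else Sum_any (\<lambda>p. sW (fps_nth (fps_exp (of_rat p)) (nat j))
                                (cleared k u v w N p))))
       \<longleftrightarrow> (\<forall>f. W.pair f (modes u v w N) = W.exp_sum (f * lexpm1 powi (- int k)) (cleared k u v w N))" for N w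
      using W.phi_coefficients_iff[OF bounded_above_modes[of u v w N] finite_cleared[OF b, of w N]]
      unfolding modes_def .
    \<comment> \<open>The power t of x2 and the mode index N determine each other by N = k - t - 1,
      and both range over (1/T)Z.\<close>
    have st: "(\<forall>t\<in>frac_int T. Q (of_nat k - t - 1) t) \<longleftrightarrow> (\<forall>N\<in>frac_int T. Q N (of_nat k - 1 - N))" for Q
    proof
      assume L: "\<forall>t\<in>frac_int T. Q (of_nat k - t - 1) t"
      show "\<forall>N\<in>frac_int T. Q N (of_nat k - 1 - N)"
      proof
        fix N assume "N \<in> frac_int T"
        then have "of_nat k - 1 - N \<in> frac_int T" using T by (simp add: frac_int_diff)
        with L have "Q (of_nat k - (of_nat k - 1 - N) - 1) (of_nat k - 1 - N)" by blast
        then show "Q N (of_nat k - 1 - N)" by simp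
      qed
    next
      assume R: "\<forall>N\<in>frac_int T. Q N (of_nat k - 1 - N)"
      show "\<forall>t\<in>frac_int T. Q (of_nat k - t - 1) t"
      proof
        fix t assume "t \<in> frac_int T"
        then have "of_nat k - t - 1 \<in> frac_int T" using T by (simp add: frac_int_diff)
        with R have "Q (of_nat k - t - 1) (of_nat k - 1 - (of_nat k - t - 1))" by blast
        then show "Q (of_nat k - t - 1) t" by simp
      qed
    qed
    have "?L \<longleftrightarrow> (\<forall>w. \<forall>N\<in>frac_int T. \<forall>j::int. Sum_any (\<lambda>i::nat. sW (fps_nth ((fps_exp 1 - 1) ^ k) i)
                               (Y (YV u (int i - j - 1) v) N w))
         = (if j < 0 then 0
            else Sum_any (\<lambda>p. sW (fps_nth (fps_exp (of_rat p)) (nat j))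
                                (cleared k u v w N p))))"
      unfolding cleared_eq
      using st[of "\<lambda>N t. Sum_any (\<lambda>i::nat. sW (fps_nth ((fps_exp 1 - 1) ^ k) i)
                               (Y (YV u (int i - j - 1) v) N w))
         = (if j < 0 then 0
            else Sum_any (\<lambda>p. sW (fps_nth (fps_exp (of_rat p)) (nat j))
                                (cleared_product_coeff sW Y k u v w p (t - p))))" for w j]
      by blast
    then show ?thesis unfolding eq exp_expansion_def .
  qed
  then show ?thesis
    unfolding phi_coordinated_module_def cleared_bounded_def[symmetric] using operators by blast
qed

text \<open>The exponent m + 1 instead of m comes from dz = e^x dx under z = e^x - 1. The mode index
  m+n+l+1 is constant in the pairing, since no weight shift occurs in these coordinates.\<close>

definition phi_jacobi :: bool where
  "phi_jacobi \<longleftrightarrow> (\<forall>r<T. \<forall>u\<in>E r. \<forall>v w l. \<forall>m n.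
     m - of_nat r / of_nat T \<in> \<int> \<longrightarrow> n \<in> frac_int T \<longrightarrow>
       W.jacobi_left l m n (product u v w) - W.jacobi_right l m n (opposite u v w)
       = W.pair (lexp (of_rat m + 1) * lexpm1 powi l) (modes u v w (m + n + of_int l + 1)))"

lemma coset_imp_frac: "m - of_nat r / of_nat T \<in> \<int> \<Longrightarrow> m \<in> frac_int T"
  using frac_int_add[of "m - of_nat r / of_nat T" T "of_nat r / of_nat T"] T
  by (auto elim!: Ints_cases)

text \<open>Locality turns the left side into an exponential sum with the coefficients
  \<open>cleared\<close>; the expansion axiom evaluates that sum as the residue on the
  right.\<close>

lemma locality_imp_jacobi:
  assumes "cleared_bounded k u v" "exp_expansion k u v" "r < T" "u \<in> E r"
    and loc: "\<And>m n. W.jacobi_left (int k) m n (product u v w) = W.jacobi_right (int k) m n (opposite u v w)"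
    and m: "m - of_nat r / of_nat T \<in> \<int>" and n: "n \<in> frac_int T"
  shows "W.jacobi_left l m n (product u v w) - W.jacobi_right l m n (opposite u v w)
       = W.pair (lexp (of_rat m + 1) * lexpm1 powi l) (modes u v w (m + n + of_int l + 1))"
proof -
  have "product u v w a b = 0" if "a - m \<notin> \<int>" for a b
  proof -
    have "a - of_nat r / of_nat T \<notin> \<int>"
      using that Ints_diff[OF _ m, of "a - of_nat r / of_nat T"] by auto
    then show ?thesis using assms(3,4) by (simp add: product_def Y_eigenspace)
  qed
  from W.jacobi_delta_exp_sum[OF left_bounded_product right_bounded_opposite loc this]
  have "W.jacobi_left l m n (product u v w) - W.jacobi_right l m n (opposite u v w) =
    W.exp_sum (lexp (of_rat m + 1) * lexpm1 powi l * lexpm1 powi (- int k))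
      (cleared k u v w (m + n + of_int l + 1))"
    unfolding cleared_def .
  moreover have "m + n + of_int l + 1 \<in> frac_int T"
    using coset_imp_frac[OF m] n T by (simp add: frac_int_add)
  ultimately show ?thesis using assms(2) by (simp add: exp_expansion_def)
qed

lemma cleared_Suc: "cleared (Suc k) u v w N p = cleared k u v w N (p - 1) - cleared k u v w N p"
  unfolding cleared_def W.jacobi_left_Suc[OF left_bounded_product]
  by (simp add: algebra_simps)

lemma cleared_bounded_Suc:
  assumes "cleared_bounded k u v"
  shows "cleared_bounded (Suc k) u v"
  unfolding cleared_bounded_def
proof
  fix w
  obtain M where M: "\<And>p q. p < M \<or> q < M \<Longrightarrow> cleared_product_coeff sW Y k u v w p q = 0"
    using assms unfolding cleared_bounded_def by blast
  have "cleared_product_coeff sW Y (Suc k) u v w p q =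
      cleared_product_coeff sW Y k u v w (p - 1) q - cleared_product_coeff sW Y k u v w p (q - 1)" for p q
    unfolding cleared_product_coeff_eq W.jacobi_left_Suc[OF left_bounded_product] by simp
  then have "cleared_product_coeff sW Y (Suc k) u v w p q = 0" if "p < M \<or> q < M" for p q
    using that M by auto
  then show "\<exists>N. \<forall>p q. p < N \<or> q < N \<longrightarrow> cleared_product_coeff sW Y (Suc k) u v w p q = 0" by blast
qed

lemma exp_sum_cleared_Suc:
  assumes "finite {p. cleared k u v w N p \<noteq> 0}"
  shows "W.exp_sum (f * lexpm1 powi (- int (Suc k))) (cleared (Suc k) u v w N)
    = W.exp_sum (f * lexpm1 powi (- int k)) (cleared k u v w N)"
proof -
  have "f * lexpm1 powi (- int (Suc k)) * lexpm1 = f * lexpm1 powi (- int k)"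
    by (simp add: mult.assoc flip: power_int_add_1)
  then show ?thesis
    unfolding cleared_Suc[abs_def] W.exp_sum_diff_shift[OF assms] by (simp only:)
qed

lemma exp_expansion_Suc:
  assumes "cleared_bounded k u v" "exp_expansion k u v"
  shows "exp_expansion (Suc k) u v"
  using assms(2) unfolding exp_expansion_def exp_sum_cleared_Suc[OF finite_cleared[OF assms(1)]] .

text \<open>The axiom provides some k for each ordered pair; raising k gives (u,v) and (v,u) a
  common one.\<close>

lemma cleared_mono:
  assumes "cleared_bounded k u v \<and> exp_expansion k u v" "k \<le> k'"
  shows "cleared_bounded k' u v \<and> exp_expansion k' u v"
  using assms(2,1) by (induction k' rule: dec_induct) (auto intro: cleared_bounded_Suc exp_expansion_Suc)

text \<open>Y_W(Y(x,x0)1, x2) = Y_W(x, x2 e^x0). Already for k = 0 the product with the vacuum is an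
  exponential sum, with the single exponent -N-1, and raising k to the value of the axiom does not
  change the functional.\<close>

lemma pair_modes_vacuum:
  assumes "cleared_bounded k x vac" "exp_expansion k x vac" "N \<in> frac_int T"
  shows "W.pair f (modes x vac w N) = sW (fls_residue (f * lexp (- of_rat N - 1))) (Y x N w)"
proof -
  have c0: "cleared 0 x vac w N p = (if p = - N - 1 then Y x N w else 0)" for p
    by (auto simp: cleared_def W.jacobi_left_0[simplified] product_def Y_vacuum)
  have fin: "finite {p. cleared k x vac w N p \<noteq> 0}" for k
  proof (induction k)
    case 0
    show ?case by (rule finite_subset[of _ "{- N - 1}"]) (auto simp: c0 split: if_splits)
  next
    case (Suc k)
    have "finite {p. cleared k x vac w N (p - 1) \<noteq> 0}"
      using finite_vimageI[OF Suc, of "\<lambda>p. p - 1"] by (simp add: vimage_def inj_def)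
    with Suc have "finite ({p. cleared k x vac w N (p - 1) \<noteq> 0} \<union> {p. cleared k x vac w N p \<noteq> 0})" by simp
    then show ?case by (rule rev_finite_subset) (auto simp: cleared_Suc)
  qed
  have "W.exp_sum (f * lexpm1 powi (- int k)) (cleared k x vac w N) = W.exp_sum f (cleared 0 x vac w N)"
    by (induction k) (simp_all only: exp_sum_cleared_Suc[OF fin], simp)
  also have "\<dots> = (\<Sum>p\<in>{- N - 1}. sW (fls_residue (f * lexp (of_rat p))) (cleared 0 x vac w N p))"
    by (rule W.exp_sum_eq_sum) (auto simp: c0)
  finally show ?thesis
    using assms(2,3) by (simp add: exp_expansion_def c0 of_rat_diff of_rat_minus)
qed

end

context complex_space
begin

lemma exp_sum_reflect:
  "exp_sum f (\<lambda>q. A (t - q)) = Sum_any (\<lambda>p. s (fls_residue (f * lexp (of_rat (t - p)))) (A p))"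
  unfolding exp_sum_def
proof (rule Sum_any.reindex_cong)
  show "bij (\<lambda>p. t - p)" by (rule bijI) (auto simp: inj_def surj_def intro: exI[of _ "t - y" for y])
qed (simp add: fun_eq_iff)

end

context twisted_operators
begin

lemma exp_expansionD:
  "exp_expansion k u v \<Longrightarrow> N \<in> frac_int T \<Longrightarrow>
    W.pair f (modes u v w N) = W.exp_sum (f * lexpm1 powi (- int k)) (cleared k u v w N)"
  by (simp add: exp_expansion_def)

text \<open>On the coefficient with mode index N, e^(xL(-1)) acts as e^(-(N+1)x). Skew symmetry
  followed by x -> -x under the residue gives the factor e^((N+1)x) and the sign -(-1)^l.\<close>

lemma modes_skew:
  assumes "\<And>x. \<exists>k. cleared_bounded k x vac \<and> exp_expansion k x vac" "N \<in> frac_int T"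
  shows "modes v u w N l =
    sW (- ((-1) powi l)) (W.pair (fls_X_intpow l * lexp (of_rat N + 1)) (modes u v w N))"
proof -
  let ?c = "of_rat N + 1 :: complex"
  let ?x = "\<lambda>i. YV u (l + int i) v"
  obtain K where K: "\<And>n. n \<ge> K \<Longrightarrow> YV u n v = 0" using truncation by blast
  let ?A = "{..<nat (K - l)}"
  have x0: "?x i = 0" if "i \<notin> ?A" for i using that by (intro K) auto
  interpret y: Vector_Spaces.linear sV sW "\<lambda>v. Y v N w" by (rule Y_linear_left)
  \<comment> \<open>The Taylor coefficients of e^(-(N+1)x), read off from the vacuum case.\<close>
  have vac: "Y (YV x (- 1 - int i) vac) N w = sW ((- ?c) ^ i / fact i) (Y x N w)" for x i
  proof -
    obtain k where "cleared_bounded k x vac" "exp_expansion k x vac" using assms(1) by blast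
    from pair_modes_vacuum[OF this assms(2), of "fls_X_intpow (- int i - 1)" w]
    have "modes x vac w N (- int i - 1) = sW ((lexp (- of_rat N - 1)) $$ int i) (Y x N w)"
      unfolding W.residue_X_intpow_mult W.pair_X_intpow .
    moreover have "- int i - 1 = - 1 - int i" by simp
    ultimately show ?thesis by (simp add: modes_def lexp_def)
  qed
  have "YV v l u = (\<Sum>i\<in>?A. sV (- ((-1) powi l * (-1) ^ i)) (YV (?x i) (- 1 - int i) vac))"
  proof (subst skew_symmetry, rule Sum_any_eq_sum)
    fix i assume "i \<notin> ?A"
    then show "sV (- ((-1) powi l * (-1) ^ i)) (YV (?x i) (- 1 - int i) vac) = 0"
      by (simp add: x0)
  qed simp
  then have "modes v u w N l = (\<Sum>i\<in>?A. sW (- ((-1) powi l * (-1) ^ i)) (sW ((- ?c) ^ i / fact i) (Y (?x i) N w)))"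
    unfolding modes_def by (simp only: y.sum y.scale vac)
  also have "\<dots> = sW (- ((-1) powi l)) (\<Sum>i\<in>?A. sW (?c ^ i / fact i) (modes u v w N (int i + l)))"
  proof -
    have "- ((-1) powi l * (-1) ^ i) * ((- c) ^ i / fact i) = - ((-1) powi l) * (c ^ i / fact i)" for i and c :: complex
      by (subst power_minus) (simp flip: power_mult_distrib add: mult.assoc)
    from this[of _ ?c] show ?thesis by (simp only: W.scale_scale W.scale_sum_right modes_def add.commute)
  qed
  also have "(\<Sum>i\<in>?A. sW (?c ^ i / fact i) (modes u v w N (int i + l)))
     = Sum_any (\<lambda>i::nat. sW (fps_exp ?c $ i) (modes u v w N (int i + l)))"
    using x0 by (subst Sum_any_eq_sum[of ?A]) (auto simp: modes_def add.commute)
  also have "\<dots> = W.pair (fls_X_intpow l * lexp ?c) (modes u v w N)"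
    unfolding lexp_def by (simp only: mult.commute[of "fls_X_intpow l"] W.pair_mult_X_intpow W.pair_fps)
  finally show ?thesis .
qed

text \<open>The same modes have two exponential expansions, from (u,v) and, through skew symmetry
  and x -> -x, from (v,u). Independence of exponentials makes their coefficients agree one by one,
  and these coefficients are those of (x1-x2)^k times the two products.\<close>

lemma locality:
  assumes vac: "\<And>x. \<exists>k. cleared_bounded k x vac \<and> exp_expansion k x vac"
    and uv: "cleared_bounded k u v" "exp_expansion k u v"
    and vu: "cleared_bounded k v u" "exp_expansion k v u"
  shows "W.jacobi_left (int k) m n (product u v w) = W.jacobi_right (int k) m n (opposite u v w)"
proof (cases "m \<in> frac_int T \<and> n \<in> frac_int T")
  case False
  then show ?thesis using jacobi_left_product_frac jacobi_right_opposite_frac by metis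
next
  case True
  define N where "N = m + n + of_nat k + 1"
  define t where "t = of_nat k - 1 - N"
  have N: "N \<in> frac_int T" unfolding N_def using True T by (simp add: frac_int_add)
  let ?A = "cleared k u v w N" and ?B = "cleared k v u w N" and ?e = "lexpm1 powi (- int k)"
  \<comment> \<open>Reflection sends the exponent p to t - p, where t is the total degree of the
    cleared product in x1 and x2.\<close>
  define B' where "B' q = sW ((-1) ^ k) (?A (t - q))" for q
  have fA: "finite {p. ?A p \<noteq> 0}" and fB: "finite {p. ?B p \<noteq> 0}" by (simp_all add: finite_cleared uv vu)
  have fA': "finite {q. ?A (t - q) \<noteq> 0}"
    using finite_vimageI[OF fA, of "\<lambda>q. t - q"] by (simp add: vimage_def inj_def)
  then have fB': "finite {p. B' p \<noteq> 0}" by (simp add: B'_def)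
  have basis: "W.exp_sum (fls_X_intpow l * ?e) ?B = W.exp_sum (fls_X_intpow l * ?e) B'" for l
  proof -
    let ?c = "of_rat N + 1 :: complex" and ?S = "{p. ?A p \<noteq> 0}"
    have "W.exp_sum (fls_X_intpow l * ?e) ?B = W.pair (fls_X_intpow l) (modes v u w N)"
      by (rule exp_expansionD[OF vu(2) N, symmetric])
    also have "\<dots> = sW (- ((-1) powi l)) (W.exp_sum (fls_X_intpow l * lexp ?c * ?e) ?A)"
      by (simp only: W.pair_X_intpow modes_skew[OF vac N] exp_expansionD[OF uv(2) N])
    also have "\<dots> = (\<Sum>p\<in>?S. sW (- ((-1) powi l) * fls_residue (fls_X_intpow l * lexp ?c * ?e * lexp (of_rat p))) (?A p))"
      by (subst W.exp_sum_eq_sum[OF fA]) (simp_all add: W.scale_sum_right)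
    also have "\<dots> = (\<Sum>p\<in>?S. sW ((-1) ^ k) (sW (fls_residue (fls_X_intpow l * ?e * lexp (of_rat (t - p)))) (?A p)))"
    proof (rule sum.cong)
      fix p
      have 1: "fls_X_intpow l * lexp ?c * ?e * lexp (of_rat p) = fls_X_intpow l * lexp (?c + of_rat p) * ?e"
        by (simp add: lexp_add mult_ac)
      have 2: "of_nat k - (?c + of_rat p) = of_rat (t - p)"
        by (simp add: t_def of_rat_diff)
      have 3: "- ((-1) powi l) * - ((-1) powi l * (-1) ^ k * z) = (-1) ^ k * z" for z :: complex
        by (simp flip: mult.assoc power_int_mult_distrib)
      show "sW (- ((-1) powi l) * fls_residue (fls_X_intpow l * lexp ?c * ?e * lexp (of_rat p))) (?A p)
          = sW ((-1) ^ k) (sW (fls_residue (fls_X_intpow l * ?e * lexp (of_rat (t - p)))) (?A p))"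
        unfolding 1 residue_reflect[of l "?c + of_rat p" k] 2 3 W.scale_scale by (simp only: mult_ac)
    qed simp
    also have "\<dots> = sW ((-1) ^ k) (Sum_any (\<lambda>p. sW (fls_residue (fls_X_intpow l * ?e * lexp (of_rat (t - p)))) (?A p)))"
      by (subst Sum_any_eq_sum[OF fA]) (auto simp: W.scale_sum_right)
    also have "\<dots> = W.exp_sum (fls_X_intpow l * ?e) B'"
      unfolding B'_def W.exp_sum_scale[OF fA'] W.exp_sum_reflect ..
    finally show ?thesis .
  qed
  have all: "W.exp_sum (f * ?e) ?B = W.exp_sum (f * ?e) B'" for f
    by (rule W.cont_eq[OF W.cont_mult[OF W.cont_exp_sum[OF fB]] W.cont_mult[OF W.cont_exp_sum[OF fB']]])
      (rule basis)
  \<comment> \<open>The factor (e^x-1)^(-k) is invertible and can be absorbed into the arbitrary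
    test series.\<close>
  have "W.exp_sum f ?B = W.exp_sum f B'" for f
    using all[of "f * lexpm1 powi int k"] by (simp add: mult.assoc power_int_minus)
  then have "?B (- n - 1) = B' (- n - 1)" by (rule W.exp_sum_inj[OF fB fB'])
  moreover have "t - (- n - 1) = - m - 1" by (simp add: t_def N_def)
  ultimately have "?B (- n - 1) = sW ((-1) ^ k) (?A (- m - 1))" by (simp only: B'_def)
  also have "?A (- m - 1) = W.jacobi_left (int k) m n (product u v w)"
    by (simp add: cleared_def N_def)
  also have "?B (- n - 1) = W.jacobi_left (int k) n m (product v u w)"
    by (simp add: cleared_def N_def)
  finally show ?thesis unfolding opposite_eq W.jacobi_right_swap
    by (simp flip: power_mult_distrib)
qed

lemma phi_coordinated_imp_jacobi:
  assumes "\<And>u v. \<exists>k. cleared_bounded k u v \<and> exp_expansion k u v"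
  shows phi_jacobi
  unfolding phi_jacobi_def
proof (intro allI impI ballI)
  fix r u v w l and m n :: rat
  assume r: "r < T" "u \<in> E r" and m: "m - of_nat r / of_nat T \<in> \<int>" and n: "n \<in> frac_int T"
  obtain k1 k2 where "cleared_bounded k1 u v \<and> exp_expansion k1 u v"
    "cleared_bounded k2 v u \<and> exp_expansion k2 v u"
    using assms by metis
  from cleared_mono[OF this(1), of "max k1 k2"] cleared_mono[OF this(2), of "max k1 k2"]
  obtain k where uv: "cleared_bounded k u v" "exp_expansion k u v"
    and vu: "cleared_bounded k v u" "exp_expansion k v u"
    by auto
  show "W.jacobi_left l m n (product u v w) - W.jacobi_right l m n (opposite u v w)
       = W.pair (lexp (of_rat m + 1) * lexpm1 powi l) (modes u v w (m + n + of_int l + 1))"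
    by (rule locality_imp_jacobi[OF uv r locality[OF assms uv vu] m n])
qed

text \<open>At l = k the right side of the Jacobi identity pairs a series of order k with modes that
  vanish from k on. For m outside the coset of r/T every term is zero.\<close>

lemma jacobi_imp_locality:
  assumes phi_jacobi "r < T" "u \<in> E r" "\<And>j. j \<ge> int k \<Longrightarrow> YV u j v = 0"
  shows "W.jacobi_left (int k) m n (product u v w) = W.jacobi_right (int k) m n (opposite u v w)"
proof (cases "n \<in> frac_int T")
  case False
  then show ?thesis using jacobi_left_product_frac jacobi_right_opposite_frac by metis
next
  case n: True
  show ?thesis
  proof (cases "m - of_nat r / of_nat T \<in> \<int>")
    case True
    have "W.pair (lexp (of_rat m + 1) * lexpm1 powi int k) (modes u v w (m + n + of_int (int k) + 1)) = 0"
      by (rule W.pair_vanish[where K = "int k"]) (use assms(4) in \<open>simp_all add: modes_def subdegree_powi del: power_int_of_nat\<close>)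
    then show ?thesis
      using assms(1)[unfolded phi_jacobi_def, rule_format, OF assms(2,3) True n, of "int k" v w] by simp
  next
    case False
    have "m + of_int i - of_nat r / of_nat T \<notin> \<int>" for i
    proof
      assume "m + of_int i - of_nat r / of_nat T \<in> \<int>"
      from Ints_diff[OF this Ints_of_int[of i]] False show False by (simp add: algebra_simps)
    qed
    from this[of "int k - int i" for i] this[of "int i" for i]
    have "Y u (m + of_nat k - of_nat i) x = 0" "Y u (m + of_nat i) x = 0" for i x
      by (simp_all add: Y_eigenspace[OF assms(2,3)] add_diff_eq)
    then show ?thesis by (simp add: W.jacobi_left_sum W.jacobi_right_sum product_def opposite_def)
  qed
qed

text \<open>For a fixed m in the coset of r/T, the Jacobi identities over all l verify the expansion
  axiom on the series e^((m+1)x) (e^x-1)^l. There is one of each order, so continuity gives all test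
  series.\<close>

lemma jacobi_imp_phi_coordinated_eigenspace:
  assumes phi_jacobi "r < T" "u \<in> E r" "\<And>j. j \<ge> int k \<Longrightarrow> YV u j v = 0"
  shows "cleared_bounded k u v \<and> exp_expansion k u v"
proof
  have loc: "W.jacobi_left (int k) m n (product u v w) = W.jacobi_right (int k) m n (opposite u v w)" for m n w
    by (rule jacobi_imp_locality[OF assms(1-3)]) (rule assms(4))
  show "cleared_bounded k u v" unfolding cleared_bounded_def
  proof
    fix w
    obtain N where N: "\<And>n. n \<ge> N \<Longrightarrow> Y v n w = 0" using Y_truncation by blast
    obtain M where M: "\<And>n. n \<ge> M \<Longrightarrow> Y u n w = 0" using Y_truncation by blast
    have "cleared_product_coeff sW Y k u v w p q = 0" if "p < min (- N - 1) (- M - 1) \<or> q < min (- N - 1) (- M - 1)" for p q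
    \<comment> \<open>A small q makes the modes of v kill w. For a small p, locality first puts u
      next to w.\<close>
    proof (cases "q < - N - 1")
      case True
      then have "Y v (- q - 1 + of_nat i) w = 0" for i by (intro N) (simp add: add_increasing2)
      then show ?thesis by (simp add: cleared_product_coeff_eq W.jacobi_left_sum product_def)
    next
      case False
      with that have "p < - M - 1" by auto
      then have "Y u (- p - 1 + of_nat i) w = 0" for i by (intro M) (simp add: add_increasing2)
      then show ?thesis unfolding cleared_product_coeff_eq loc by (simp add: W.jacobi_right_sum opposite_def)
    qed
    then show "\<exists>N. \<forall>p q. p < N \<or> q < N \<longrightarrow> cleared_product_coeff sW Y k u v w p q = 0" by blast
  qed
  then have fin: "finite {p. cleared k u v w N p \<noteq> 0}" for w N by (rule finite_cleared)
  show "exp_expansion k u v" unfolding exp_expansion_def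
  proof (intro allI ballI)
    fix w N f assume N: "N \<in> frac_int T"
    define m where "m = rat_of_nat r / of_nat T"
    let ?b = "\<lambda>l. lexp (of_rat m + 1) * lexpm1 powi l"
    show "W.pair f (modes u v w N) = W.exp_sum (f * lexpm1 powi (- int k)) (cleared k u v w N)"
    proof (rule W.cont_eq_on_filtered_basis[where b = ?b and \<phi> = "\<lambda>f. W.pair f (modes u v w N)"
          and \<psi> = "\<lambda>f. W.exp_sum (f * lexpm1 powi (- int k)) (cleared k u v w N)"])
      show "W.cont (\<lambda>f. W.pair f (modes u v w N))" by (rule W.cont_pair[OF bounded_above_modes])
      show "W.cont (\<lambda>f. W.exp_sum (f * lexpm1 powi (- int k)) (cleared k u v w N))"
        by (rule W.cont_mult[OF W.cont_exp_sum[OF fin]])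
      show "?b l \<noteq> 0 \<and> fls_subdegree (?b l) = l" for l by (simp add: subdegree_powi)
      show "W.pair (?b l) (modes u v w N) = W.exp_sum (?b l * lexpm1 powi (- int k)) (cleared k u v w N)" for l
      proof -
        \<comment> \<open>Chosen so that the constant mode index m+n+l+1 is the prescribed N for
          every l.\<close>
        define n where "n = N - m - of_int l - 1"
        have e: "m + n + of_int l + 1 = N" by (simp add: n_def)
        have "n \<in> frac_int T" unfolding n_def m_def using N T by (simp add: frac_int_diff)
        moreover have "m - of_nat r / of_nat T \<in> \<int>" by (simp add: m_def)
        ultimately have "W.jacobi_left l m n (product u v w) - W.jacobi_right l m n (opposite u v w)
            = W.pair (?b l) (modes u v w N)"
          using assms(1-3) unfolding phi_jacobi_def by (metis e)
        moreover have "W.jacobi_left l m n (product u v w) - W.jacobi_right l m n (opposite u v w) =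
          W.exp_sum (?b l * lexpm1 powi (- int k))
            (\<lambda>p. W.jacobi_left (int k) (- p - 1) (m + n + of_int l + 1 + p - of_nat k) (product u v w))"
        proof (rule W.jacobi_delta_exp_sum[OF left_bounded_product right_bounded_opposite loc])
          fix a b assume "a - m \<notin> \<int>"
          then show "product u v w a b = 0"
            using assms(2,3) by (simp add: product_def Y_eigenspace m_def)
        qed
        then have "W.jacobi_left l m n (product u v w) - W.jacobi_right l m n (opposite u v w) =
          W.exp_sum (?b l * lexpm1 powi (- int k)) (cleared k u v w N)"
          unfolding cleared_def e .
        ultimately show ?thesis by simp
      qed
    qed
  qed
qed

lemma cleared_add_left: "cleared k (u + u') v w N p = cleared k u v w N p + cleared k u' v w N p"
  by (simp add: cleared_def W.jacobi_left_add[symmetric] product_def[abs_def] Y_add_left)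

lemma cleared_zero_left: "cleared k 0 v w N p = 0"
  by (simp add: cleared_def W.jacobi_left_sum product_def)

lemma phi_coordinated_add:
  assumes "cleared_bounded k u v \<and> exp_expansion k u v" "cleared_bounded k u' v \<and> exp_expansion k u' v"
  shows "cleared_bounded k (u + u') v \<and> exp_expansion k (u + u') v"
proof
  have add: "cleared_product_coeff sW Y k (u + u') v w p q =
    cleared_product_coeff sW Y k u v w p q + cleared_product_coeff sW Y k u' v w p q" for w p q
    by (simp add: cleared_product_coeff_eq W.jacobi_left_add[symmetric] product_def[abs_def] Y_add_left)
  show "cleared_bounded k (u + u') v" unfolding cleared_bounded_def
  proof
    fix w
    obtain M M' where "\<And>p q. p < M \<or> q < M \<Longrightarrow> cleared_product_coeff sW Y k u v w p q = 0"
      "\<And>p q. p < M' \<or> q < M' \<Longrightarrow> cleared_product_coeff sW Y k u' v w p q = 0"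
      using assms unfolding cleared_bounded_def by metis
    then have "\<forall>p q. p < min M M' \<or> q < min M M' \<longrightarrow> cleared_product_coeff sW Y k (u + u') v w p q = 0"
      by (auto simp: add)
    then show "\<exists>N. \<forall>p q. p < N \<or> q < N \<longrightarrow> cleared_product_coeff sW Y k (u + u') v w p q = 0" by blast
  qed
  interpret l: Vector_Spaces.linear sV sV "\<lambda>u. YV u j v" for j by (rule linear_left)
  have "modes (u + u') v w N = (\<lambda>j. modes u v w N j + modes u' v w N j)" for w N
    by (simp add: modes_def fun_eq_iff l.add Y_add_left)
  moreover have "cleared k (u + u') v w N = (\<lambda>p. cleared k u v w N p + cleared k u' v w N p)" for w N
    by (simp add: fun_eq_iff cleared_add_left)
  moreover have "finite {p. cleared k u v w N p \<noteq> 0}" "finite {p. cleared k u' v w N p \<noteq> 0}" for w N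
    using assms by (auto intro: finite_cleared)
  ultimately show "exp_expansion k (u + u') v"
    using assms unfolding exp_expansion_def
    by (simp add: W.pair_add_right[OF bounded_above_modes bounded_above_modes] W.exp_sum_add)
qed

lemma phi_coordinated_zero: "cleared_bounded k 0 v \<and> exp_expansion k 0 v"
proof
  show "cleared_bounded k 0 v" unfolding cleared_bounded_def cleared_product_coeff_eq
    by (simp add: W.jacobi_left_sum product_def)
  interpret l: Vector_Spaces.linear sV sV "\<lambda>u. YV u j v" for j by (rule linear_left)
  show "exp_expansion k 0 v" unfolding exp_expansion_def
    by (simp add: modes_def[abs_def] l.zero cleared_zero_left W.exp_sum_def)
qed

text \<open>The Jacobi identity concerns eigenvectors, the axiom arbitrary u. One k serves all T
  eigencomponents of u, so the axiom follows by additivity.\<close>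

lemma jacobi_imp_phi_coordinated:
  assumes phi_jacobi
  shows "\<exists>k. cleared_bounded k u v \<and> exp_expansion k u v"
proof -
  obtain f where f: "\<And>r. r < T \<Longrightarrow> f r \<in> E r" and u: "u = (\<Sum>r<T. f r)"
    using eigenspace_decomposition by blast
  obtain K where K: "\<And>r n. n \<ge> K r \<Longrightarrow> YV (f r) n v = 0"
    using choice[of "\<lambda>r N. \<forall>n\<ge>N. YV (f r) n v = 0"] truncation by blast
  define k where "k = Max ((\<lambda>r. nat (K r)) ` {..<T})"
  have "YV (f r) j v = 0" if "r < T" "j \<ge> int k" for r j
  proof (rule K)
    have "nat (K r) \<le> k" unfolding k_def by (rule Max_ge) (use that in auto)
    then show "K r \<le> j" using that(2) by linarith
  qed
  then have "cleared_bounded k (f r) v \<and> exp_expansion k (f r) v" if "r < T" for r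
    using jacobi_imp_phi_coordinated_eigenspace[OF assms that f[OF that]] that by blast
  then have "cleared_bounded k (\<Sum>r<t. f r) v \<and> exp_expansion k (\<Sum>r<t. f r) v" if "t \<le> T" for t
    using that
  proof (induction t)
    case 0
    then show ?case using phi_coordinated_zero by simp
  next
    case (Suc t)
    then show ?case using phi_coordinated_add by (simp add: Suc_le_eq)
  qed
  then show ?thesis unfolding u by blast
qed

theorem phi_coordinated_module_iff_jacobi:
  "phi_coordinated_module sV YV vac g T sW Y \<longleftrightarrow> phi_jacobi"
  unfolding phi_coordinated_module_iff
  using phi_coordinated_imp_jacobi jacobi_imp_phi_coordinated by blast

end

subsection \<open>Divided derivatives and leading coefficients\<close>

text \<open>The i-th derivative divided by i!. On z^m it produces binom(m,i) z^(m-i), the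
  coefficients of the commutator formula.\<close>

definition hasse :: "nat \<Rightarrow> complex fls \<Rightarrow> complex fls" where
  "hasse i f = Abs_fls (\<lambda>n. (of_int (n + int i) gchoose i) * f $$ (n + int i))"

lemma hasse_nth: "hasse i f $$ n = (of_int (n + int i) gchoose i) * f $$ (n + int i)"
  unfolding hasse_def
  by (rule nth_Abs_fls_lower_bound[where N = "fls_subdegree f - int i"]) simp

lemma hasse_add: "hasse i (f + g) = hasse i f + hasse i g"
  by (rule fls_eqI) (simp add: hasse_nth algebra_simps)

lemma hasse_scale: "hasse i (fls_const c * f) = fls_const c * hasse i f"
  by (rule fls_eqI) (simp add: hasse_nth)

lemma hasse_0 [simp]: "hasse 0 f = f"
  by (rule fls_eqI) (simp add: hasse_nth)

lemma hasse_X_intpow: "hasse i (fls_X_intpow m) = fls_const (of_int m gchoose i) * fls_X_intpow (m - int i)"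
proof (rule fls_eqI)
  fix n
  show "hasse i (fls_X_intpow m) $$ n = (fls_const (of_int m gchoose i) * fls_X_intpow (m - int i)) $$ n"
    by (cases "n = m - int i") (auto simp: hasse_nth)
qed

lemma hasse_deriv: "fls_deriv (hasse i f) = of_nat (Suc i) * hasse (Suc i) f"
proof (rule fls_eqI)
  fix n
  have "of_nat (Suc i) * (of_int (n + int (Suc i)) gchoose Suc i :: complex)
      = (of_int (n + int (Suc i)) - of_nat i) * (of_int (n + int (Suc i)) gchoose i)"
    using gbinomial_mult_1[of "of_int (n + int (Suc i)) :: complex" i] by (simp add: algebra_simps)
  then have *: "of_int (n + 1) * (of_int (n + int (Suc i)) gchoose i) =
      of_nat (Suc i) * (of_int (n + int (Suc i)) gchoose Suc i :: complex)" by simp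
  have "n + 1 + int i = n + int (Suc i)" by simp
  then have "fls_deriv (hasse i f) $$ n = of_int (n + 1) * ((of_int (n + int (Suc i)) gchoose i) * f $$ (n + int (Suc i)))"
    by (simp only: fls_deriv_nth hasse_nth)
  then show "fls_deriv (hasse i f) $$ n = (of_nat (Suc i) * hasse (Suc i) f) $$ n"
    by (simp only: fls_mult_of_nat_nth hasse_nth mult.assoc[symmetric] *)
qed

definition lead_coefficient :: "complex fls \<Rightarrow> complex" where
  "lead_coefficient f = f $$ fls_subdegree f"

lemma lead_coefficient_mult:
  "f \<noteq> 0 \<Longrightarrow> g \<noteq> 0 \<Longrightarrow> lead_coefficient (f * g) = lead_coefficient f * lead_coefficient g"
  by (simp add: lead_coefficient_def)

lemma lead_coefficient_powi:
  assumes "f \<noteq> 0" "lead_coefficient f = 1"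
  shows "lead_coefficient (f powi n) = 1"
proof -
  have p: "lead_coefficient (f ^ k) = 1" for k
    using assms by (induction k) (simp_all add: lead_coefficient_mult, simp add: lead_coefficient_def)
  have "lead_coefficient (inverse (f ^ k)) * lead_coefficient (f ^ k) = 1" for k
    using lead_coefficient_mult[of "inverse (f ^ k)" "f ^ k"] assms by (simp, simp add: lead_coefficient_def)
  then show ?thesis using p by (cases "n \<ge> 0") (simp_all add: power_int_def power_inverse)
qed

text \<open>The leading coefficient 1 makes u_j v the top-weight term of the corresponding Zhu
  mode.\<close>

lemma llog_powi_lbinom_nth: "(llog powi j * lbinom a) $$ j = 1"
proof -
  have "lead_coefficient llog = 1"
    by (simp add: lead_coefficient_def) (simp add: llog_def fps_ln_nth)
  then have "lead_coefficient (llog powi j) = 1" by (simp add: lead_coefficient_powi)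
  moreover have "lead_coefficient (lbinom a) = 1"
    by (simp add: lead_coefficient_def) (simp add: lbinom_def)
  ultimately have "lead_coefficient (llog powi j * lbinom a) = 1"
    by (simp add: lead_coefficient_mult)
  then show ?thesis by (simp add: lead_coefficient_def subdegree_powi)
qed

text \<open>
  The zero mode of Zhu's vertex operators \<open>Y[u,x] = Y((1+z)^L(0) u, z)\<close>, \<open>z = e^x - 1\<close>, is obtained
  by pairing \<open>Y(\<omega>,z)\<close> with this series.
\<close>

definition zhu_series :: "complex fls" where "zhu_series = lbinom 1 * llog"

lemma zhu_series_deriv: "fls_deriv zhu_series = llog + 1"
  by (simp add: zhu_series_def lbinom_deriv llog_deriv fls_const_1 flip: lbinom_add)

lemma hasse_1_zhu: "hasse 1 zhu_series = llog + 1"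
  using hasse_deriv[of 0 zhu_series] by (simp add: zhu_series_deriv)

text \<open>The second derivative of (1+z) log(1+z) is (1+z)^(-1), so the divided derivative of
  order j >= 2 is a multiple of (1+z)^(1-j). This is exactly the change of the weight factor from u
  to omega_j u.\<close>

lemma hasse_zhu_ge_2:
  "hasse (Suc (Suc i)) zhu_series = fls_const (zhu_series $$ int (Suc (Suc i))) * lbinom (- 1 - of_nat i)"
proof -
  have "\<exists>c. hasse (Suc (Suc i)) zhu_series = fls_const c * lbinom (- 1 - of_nat i)"
  proof (induction i)
    case 0
    have "of_nat (Suc (Suc 0)) * hasse (Suc (Suc 0)) zhu_series = lbinom (- 1)"
      using hasse_deriv[of 1 zhu_series, symmetric] by (simp only: hasse_1_zhu) (simp add: llog_deriv)
    then have "fls_const (1/2) * (fls_const 2 * hasse (Suc (Suc 0)) zhu_series) = fls_const (1/2) * lbinom (- 1)"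
      by (simp only: fls_const_numeral) simp
    then have "fls_const (1/2 * 2) * hasse (Suc (Suc 0)) zhu_series = fls_const (1/2) * lbinom (- 1)"
      by (simp only: mult.assoc[symmetric] fls_const_mult_const)
    then show ?case by (intro exI[of _ "1/2"]) (simp add: fls_const_1)
  next
    case (Suc i)
    then obtain c where c: "hasse (Suc (Suc i)) zhu_series = fls_const c * lbinom (- 1 - of_nat i)" by blast
    let ?n = "of_nat (Suc (Suc (Suc i))) :: complex" and ?d = "c * (- 1 - of_nat i)"
    have n: "?n \<noteq> 0" by (rule of_nat_neq_0)
    have "fls_const ?n * hasse (Suc (Suc (Suc i))) zhu_series = fls_deriv (fls_const c * lbinom (- 1 - of_nat i))"
      using hasse_deriv[of "Suc (Suc i)" zhu_series, symmetric] by (simp only: c fls_of_nat)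
    also have "\<dots> = fls_const ?d * lbinom (- 1 - of_nat (Suc i))"
      by (simp add: lbinom_deriv mult.assoc[symmetric] algebra_simps)
    finally have "fls_const (1 / ?n) * (fls_const ?n * hasse (Suc (Suc (Suc i))) zhu_series) =
       fls_const (1 / ?n) * (fls_const ?d * lbinom (- 1 - of_nat (Suc i)))" by simp
    then have "fls_const (1 / ?n * ?n) * hasse (Suc (Suc (Suc i))) zhu_series =
       fls_const (1 / ?n * ?d) * lbinom (- 1 - of_nat (Suc i))"
      by (simp only: mult.assoc[symmetric] fls_const_mult_const)
    moreover have "1 / ?n * ?n = 1" using n by simp
    ultimately show ?case by (intro exI[of _ "1 / ?n * ?d"]) (simp only: fls_const_1 mult_1)
  qed
  then obtain c where c: "hasse (Suc (Suc i)) zhu_series = fls_const c * lbinom (- 1 - of_nat i)" by blast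
  \<comment> \<open>Evaluation at z = 0 identifies the constant left open by the induction.\<close>
  have "hasse (Suc (Suc i)) zhu_series $$ 0 = zhu_series $$ int (Suc (Suc i))"
    unfolding hasse_nth by (simp only: add_0 of_int_of_nat_eq) (simp flip: binomial_gbinomial del: of_nat_Suc)
  moreover have "(fls_const c * lbinom (- 1 - of_nat i)) $$ 0 = c" by (simp add: lbinom_def)
  ultimately show ?thesis using c by simp
qed

lemma zhu_series_low: "n \<le> 0 \<Longrightarrow> zhu_series $$ n = 0" "zhu_series $$ 1 = 1"
proof -
  have sd: "fls_subdegree zhu_series = 1" by (simp add: zhu_series_def)
  then show "zhu_series $$ n = 0" if "n \<le> 0" using that by (intro fls_eq0_below_subdegree) simp
  have "zhu_series = llog powi 1 * lbinom 1" by (simp add: zhu_series_def)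
  then show "zhu_series $$ 1 = 1" by (metis llog_powi_lbinom_nth)
qed

subsection \<open>Residues of vertex operators\<close>

context vertex_operator_algebra
begin

text \<open>\<open>Res\<^sub>z f(z) Y(u,z) v\<close>\<close>

definition res :: "complex fls \<Rightarrow> 'v \<Rightarrow> 'v \<Rightarrow> 'v" where
  "res f u v = pair f (\<lambda>i. Y u i v)"

lemma cont_res: "cont (\<lambda>f. res f u v)"
  unfolding res_def by (rule cont_pair[OF bounded_above_modes])

lemma res_X_intpow: "res (fls_X_intpow n) u v = Y u n v"
  by (simp add: res_def pair_X_intpow)

lemma Y_add_right: "Y u n (v + w) = Y u n v + Y u n w"
  and Y_scale_right: "Y u n (s c v) = s c (Y u n v)"
  and Y_add_left: "Y (u + u') n v = Y u n v + Y u' n v"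
  and Y_scale_left: "Y (s c u) n v = s c (Y u n v)"
proof -
  interpret l: Vector_Spaces.linear s s "Y u n" by (rule linear_right)
  interpret r: Vector_Spaces.linear s s "\<lambda>u. Y u n v" by (rule linear_left)
  show "Y u n (v + w) = Y u n v + Y u n w" "Y u n (s c v) = s c (Y u n v)"
    "Y (u + u') n v = Y u n v + Y u' n v" "Y (s c u) n v = s c (Y u n v)"
    by (rule l.add, rule l.scale, rule r.add, rule r.scale)
qed

lemma linearI: "(\<And>x y. f (x + y) = f x + f y) \<Longrightarrow> (\<And>c x. f (s c x) = s c (f x)) \<Longrightarrow> Vector_Spaces.linear s s f"
  by unfold_locales

lemma linear_res_right: "Vector_Spaces.linear s s (res f u)"
  by (rule linearI)
    (simp_all add: res_def Y_add_right Y_scale_right pair_add_right[OF bounded_above_modes bounded_above_modes] pair_scale_right)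

lemma linear_res_left: "Vector_Spaces.linear s s (\<lambda>u. res f u v)"
  by (rule linearI)
    (simp_all add: res_def Y_add_left Y_scale_left pair_add_right[OF bounded_above_modes bounded_above_modes] pair_scale_right)

lemma res_right_simps: "res f u (v + w) = res f u v + res f u w" "res f u (s c v) = s c (res f u v)"
  "res f u 0 = 0" "res f u (v - w) = res f u v - res f u w" "res f u (\<Sum>i\<in>I. F i) = (\<Sum>i\<in>I. res f u (F i))"
proof -
  interpret l: Vector_Spaces.linear s s "res f u" by (rule linear_res_right)
  show "res f u (v + w) = res f u v + res f u w" "res f u (s c v) = s c (res f u v)"
  "res f u 0 = 0" "res f u (v - w) = res f u v - res f u w" "res f u (\<Sum>i\<in>I. F i) = (\<Sum>i\<in>I. res f u (F i))"
    by (rule l.add, rule l.scale, rule l.zero, rule l.diff, rule l.sum)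
qed

lemma res_left_simps: "res f (u + u') v = res f u v + res f u' v" "res f (s c u) v = s c (res f u v)"
  "res f 0 v = 0" "res f (u - u') v = res f u v - res f u' v" "res f (\<Sum>i\<in>I. F i) v = (\<Sum>i\<in>I. res f (F i) v)"
proof -
  interpret l: Vector_Spaces.linear s s "\<lambda>u. res f u v" by (rule linear_res_left)
  show "res f (u + u') v = res f u v + res f u' v" "res f (s c u) v = s c (res f u v)"
  "res f 0 v = 0" "res f (u - u') v = res f u v - res f u' v" "res f (\<Sum>i\<in>I. F i) v = (\<Sum>i\<in>I. res f (F i) v)"
    by (rule l.add, rule l.scale, rule l.zero, rule l.diff, rule l.sum)
qed

lemma commutator:
  "Y a m (Y b n v) - Y b n (Y a m v) =
    Sum_any (\<lambda>i::nat. s (of_int m gchoose i) (Y (Y a (int i) b) (m + n - int i) v))"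
proof -
  have z: "(of_int 0 gchoose i :: complex) = 0" if "i \<noteq> 0" for i
    using that gchoose_0_Suc by (cases i) auto
  have "Sum_any (\<lambda>i::nat. s ((-1) ^ i * (of_int 0 gchoose i)) (Y a (m + 0 - int i) (Y b (n + int i) v))) =
      (\<Sum>i\<in>{0::nat}. s ((-1) ^ i * (of_int 0 gchoose i)) (Y a (m + 0 - int i) (Y b (n + int i) v)))"
    by (rule Sum_any_eq_sum) (use z in auto)
  moreover have "Sum_any (\<lambda>i::nat. s ((-1) powi (0 - int i) * (of_int 0 gchoose i)) (Y b (n + 0 - int i) (Y a (m + int i) v))) =
      (\<Sum>i\<in>{0::nat}. s ((-1) powi (0 - int i) * (of_int 0 gchoose i)) (Y b (n + 0 - int i) (Y a (m + int i) v)))"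
    by (rule Sum_any_eq_sum) (use z in auto)
  ultimately show ?thesis using jacobi[of 0 a m b n v] by simp
qed

lemma cont_hasse:
  assumes "cont \<phi>"
  shows "cont (\<lambda>f. \<phi> (hasse i f))"
proof -
  obtain M where M: "\<And>f. (\<forall>i<M. f $$ i = 0) \<Longrightarrow> \<phi> f = 0" by (rule contE[OF assms]) blast
  show ?thesis
    by (rule contI[where M = "M + int i"])
      (simp_all add: hasse_add hasse_scale contD(1,2)[OF assms] M hasse_nth)
qed

text \<open>The commutator formula with test series in place of the monomials z1^m and z2^n,
  extended by continuity in one variable at a time.\<close>

lemma res_commutator:
  assumes I: "\<And>i. i \<ge> I \<Longrightarrow> Y a (int i) b = 0"
  shows "res f a (res h b v) - res h b (res f a v) = (\<Sum>i<I. res (hasse i f * h) (Y a (int i) b) v)"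
proof -
  have r: "cont (\<lambda>h. res f a (res h b v))" for f by (rule cont_linear[OF linear_res_right cont_res])
  have l: "cont (\<lambda>f. res h b (res f a v))" for h by (rule cont_linear[OF linear_res_right cont_res])
  have 1: "res (fls_X_intpow m) a (res (fls_X_intpow n) b v) - res (fls_X_intpow n) b (res (fls_X_intpow m) a v)
      = (\<Sum>i<I. res (hasse i (fls_X_intpow m) * fls_X_intpow n) (Y a (int i) b) v)" for m n
  proof -
    have "res (hasse i (fls_X_intpow m) * fls_X_intpow n) x v = s (of_int m gchoose i) (Y x (m + n - int i) v)" for i x
    proof -
      have "hasse i (fls_X_intpow m) * fls_X_intpow n = fls_const (of_int m gchoose i) * fls_X_intpow (m + n - int i)"
        by (simp only: hasse_X_intpow mult.assoc fls_X_intpow_times_fls_X_intpow) (simp add: algebra_simps)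
      then show ?thesis by (simp only: contD(2)[OF cont_res] res_X_intpow)
    qed
    then have "(\<Sum>i<I. res (hasse i (fls_X_intpow m) * fls_X_intpow n) (Y a (int i) b) v)
       = (\<Sum>i<I. s (of_int m gchoose i) (Y (Y a (int i) b) (m + n - int i) v))" by simp
    also have "\<dots> = Sum_any (\<lambda>i. s (of_int m gchoose i) (Y (Y a (int i) b) (m + n - int i) v))"
      by (rule Sum_any_eq_sum[symmetric]) (use I in auto)
    finally show ?thesis by (simp only: res_X_intpow commutator)
  qed
  have 2: "res f a (res (fls_X_intpow n) b v) - res (fls_X_intpow n) b (res f a v)
      = (\<Sum>i<I. res (hasse i f * fls_X_intpow n) (Y a (int i) b) v)" for f n
    by (rule cont_eq[where \<phi> = "\<lambda>f. res f a (res (fls_X_intpow n) b v) - res (fls_X_intpow n) b (res f a v)"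
          and \<psi> = "\<lambda>f. \<Sum>i<I. res (hasse i f * fls_X_intpow n) (Y a (int i) b) v"])
      (auto intro!: cont_diff cont_res l cont_sum cont_hasse[OF cont_mult[OF cont_res]] simp: 1)
  show ?thesis
    by (rule cont_eq[where \<phi> = "\<lambda>h. res f a (res h b v) - res h b (res f a v)"
          and \<psi> = "\<lambda>h. \<Sum>i<I. res (hasse i f * h) (Y a (int i) b) v"])
      (auto intro!: cont_diff cont_res r cont_sum cont_mult_left[OF cont_res] simp: 2)
qed

text \<open>Integration by parts, since L(-1) acts as the derivative of the vertex operator.\<close>

lemma res_L_minus_one: "res f (Y \<omega> 0 u) v = - res (fls_deriv f) u v"
proof (rule cont_eq[where \<phi> = "\<lambda>f. res f (Y \<omega> 0 u) v" and \<psi> = "\<lambda>f. - res (fls_deriv f) u v"])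
  have "fls_deriv f = hasse 1 f" for f using hasse_deriv[of 0 f] by simp
  then show "cont (\<lambda>f. - res (fls_deriv f) u v)"
    by (simp only:) (rule cont_uminus[OF cont_hasse[OF cont_res]])
  show "res (fls_X_intpow n) (Y \<omega> 0 u) v = - res (fls_deriv (fls_X_intpow n)) u v" for n
  proof -
    have "fls_deriv (fls_X_intpow n) = fls_const (of_int n :: complex) * fls_X_intpow (n - 1)"
    proof (rule fls_eqI)
      fix k
      show "fls_deriv (fls_X_intpow n) $$ k = (fls_const (of_int n :: complex) * fls_X_intpow (n - 1)) $$ k"
        by (cases "k = n - 1") auto
    qed
    then show ?thesis
      by (simp only: contD(2)[OF cont_res] res_X_intpow L_minus_one_derivative of_int_minus scale_minus_left)
  qed
qed (rule cont_res)

end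

subsection \<open>Weight components\<close>

context vertex_operator_algebra
begin

abbreviation "V h \<equiv> weight_space s Y \<omega> h"

definition component :: "'v \<Rightarrow> int \<Rightarrow> 'v" where
  "component v = (THE f. finite {i. f i \<noteq> 0} \<and> (\<forall>i. f i \<in> V i) \<and> v = Sum_any f)"

lemma component_eqI:
  assumes "finite {i. f i \<noteq> 0}" "\<And>i. f i \<in> V i" "v = Sum_any f"
  shows "component v = f"
  unfolding component_def
  by (rule the1_equality) (use grading assms in \<open>auto simp: direct_sum_def\<close>)

lemma component_props:
  "finite {i. component v i \<noteq> 0}" "component v i \<in> V i" "v = Sum_any (component v)"
proof -
  have "\<exists>!f. finite {i. f i \<noteq> 0} \<and> (\<forall>i. f i \<in> V i) \<and> v = Sum_any f"
    using grading by (auto simp: direct_sum_def)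
  from theI'[OF this] show "finite {i. component v i \<noteq> 0}" "component v i \<in> V i" "v = Sum_any (component v)"
    unfolding component_def by auto
qed

lemma V_subspace: "subspace (V h)"
  using grading by (auto simp: direct_sum_def)

lemmas V_closed = subspace_0[OF V_subspace] subspace_add[OF V_subspace] subspace_scale[OF V_subspace]

lemma component_add: "component (v + w) h = component v h + component w h"
proof -
  have "component (v + w) = (\<lambda>h. component v h + component w h)"
  proof (rule component_eqI)
    show "finite {i. component v i + component w i \<noteq> 0}"
      by (rule finite_subset[of _ "{i. component v i \<noteq> 0} \<union> {i. component w i \<noteq> 0}"])
        (auto simp: component_props)
    show "v + w = Sum_any (\<lambda>h. component v h + component w h)"
      by (simp add: Sum_any.distrib component_props(1) flip: component_props(3))
  qed (simp add: V_closed component_props)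
  then show ?thesis by simp
qed

lemma component_scale: "component (s c v) h = s c (component v h)"
proof -
  have "component (s c v) = (\<lambda>h. s c (component v h))"
  proof (rule component_eqI)
    show "finite {i. s c (component v i) \<noteq> 0}"
      by (rule finite_subset[OF _ component_props(1)[of v]]) auto
    have "s c v = s c (\<Sum>h\<in>{i. component v i \<noteq> 0}. component v h)"
      using component_props(3)[of v] by (simp add: Sum_any.expand_set)
    also have "\<dots> = Sum_any (\<lambda>h. s c (component v h))"
      by (subst Sum_any_eq_sum[OF component_props(1)[of v]]) (auto simp: scale_sum_right)
    finally show "s c v = Sum_any (\<lambda>h. s c (component v h))" .
  qed (simp add: V_closed component_props)
  then show ?thesis by simp
qed

lemma linear_component: "Vector_Spaces.linear s s (\<lambda>v. component v h)"
  by (rule linearI) (simp_all add: component_add component_scale)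

lemma component_simps: "component 0 h = 0" "component (v - w) h = component v h - component w h"
proof -
  interpret l: Vector_Spaces.linear s s "\<lambda>v. component v h" by (rule linear_component)
  show "component 0 h = 0" "component (v - w) h = component v h - component w h"
    by (rule l.zero, rule l.diff)
qed

lemma component_homogeneous: "v \<in> V h \<Longrightarrow> component v k = (if k = h then v else 0)"
proof -
  assume v: "v \<in> V h"
  have "component v = (\<lambda>k. if k = h then v else 0)"
  proof (rule component_eqI)
    show "finite {i. (if i = h then v else 0) \<noteq> 0}" by (rule finite_subset[of _ "{h}"]) auto
    show "v = Sum_any (\<lambda>k. if k = h then v else 0)"
      by (subst Sum_any_eq_sum[of "{h}"]) auto
  qed (use v V_closed in auto)
  then show ?thesis by simp
qed

lemma sum_components:
  assumes "finite S" "\<And>h. h \<notin> S \<Longrightarrow> component v h = 0"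
  shows "v = (\<Sum>h\<in>S. component v h)"
  using component_props(3)[of v] Sum_any_eq_sum[of S "component v"] assms by simp

lemma homogeneous_induct [case_names add homogeneous]:
  assumes "\<And>v w. P v \<Longrightarrow> P w \<Longrightarrow> P (v + w)" "\<And>h v. v \<in> V h \<Longrightarrow> P v"
  shows "P v"
proof -
  have "P (\<Sum>h\<in>S. component v h)" if "finite S" for S
    using that
  proof (induction S)
    case empty
    then show ?case using assms(2)[of 0 0] V_closed by simp
  next
    case (insert x F)
    then show ?case using assms component_props(2)[of v x] by simp
  qed
  then show ?thesis
    using sum_components[OF component_props(1)[of v], of v] component_props(1)[of v] by force
qed

text \<open>In the commutator with L(0) = omega_1 only omega_0 u and omega_1 u appear: the first
  gives -n-1 by the derivative property, the second the weight h.\<close>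

lemma weight_Y:
  assumes "u \<in> V h" "v \<in> V k"
  shows "Y u n v \<in> V (h + k - n - 1)"
proof -
  have u: "Y \<omega> 1 u = s (of_int h) u" and v: "Y \<omega> 1 v = s (of_int k) v"
    using assms by (auto simp: weight_space_def)
  let ?F = "\<lambda>i::nat. s (of_int 1 gchoose i) (Y (Y \<omega> (int i) u) (1 + n - int i) v)"
  have g1: "((1::complex) gchoose i) = 0" if "i \<notin> {0, 1}" for i
  proof -
    have "1 < i" using that by auto
    then show ?thesis using binomial_eq_0[of 1 i] by (metis binomial_gbinomial of_nat_0 of_nat_1)
  qed
  have "Sum_any ?F = (\<Sum>i\<in>{0, 1}. ?F i)"
    by (rule Sum_any_eq_sum) (use g1 in auto)
  also have "\<dots> = s (of_int (h - n - 1)) (Y u n v)"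
    by (simp add: u L_minus_one_derivative Y_scale_left flip: scale_left_distrib)
  finally have "Y \<omega> 1 (Y u n v) = s (of_int (h - n - 1)) (Y u n v) + s (of_int k) (Y u n v)"
    using commutator[of \<omega> 1 u n v] by (simp add: v Y_scale_right algebra_simps)
  then show ?thesis by (simp add: weight_space_def algebra_simps flip: scale_left_distrib)
qed

lemma omega_weight: "\<omega> \<in> V 2"
proof -
  obtain c where "Y \<omega> (0 + 1) (Y \<omega> (-2 + 1) vac) - Y \<omega> (-2 + 1) (Y \<omega> (0 + 1) vac)
        = s (of_int (0 - (-2))) (Y \<omega> (0 + (-2) + 1) vac)
          + (if 0 + (-2) = (0::int) then s (of_int (0 ^ 3 - 0) / 12 * c) vac else 0)"
    using virasoro by blast
  then show ?thesis by (simp add: creation weight_space_def)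
qed

lemma weight_omega: "v \<in> V k \<Longrightarrow> Y \<omega> n v \<in> V (k - n + 1)"
  using weight_Y[OF omega_weight, of v k n] by (simp add: algebra_simps)

lemma vac_weight: "vac \<in> V 0"
  by (simp add: weight_space_def creation)

text \<open>The sum of the weight spaces of weight less than h: the filtration for which L[0] and
  the isomorphism are triangular.\<close>

definition below :: "int \<Rightarrow> 'v set" where
  "below h = {v. \<forall>k\<ge>h. component v k = 0}"

lemma below_subspace: "subspace (below h)"
  by (rule subspaceI) (auto simp: below_def component_simps component_add component_scale)

lemmas below_closed = subspace_0[OF below_subspace] subspace_add[OF below_subspace]
  subspace_scale[OF below_subspace] subspace_diff[OF below_subspace] subspace_sum[OF below_subspace]

lemma V_below: "v \<in> V k \<Longrightarrow> k < h \<Longrightarrow> v \<in> below h"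
  by (auto simp: below_def component_homogeneous)

lemma below_mono: "v \<in> below h \<Longrightarrow> h \<le> k \<Longrightarrow> v \<in> below k"
  by (auto simp: below_def)

lemma below_image:
  assumes "Vector_Spaces.linear s s L" "\<And>k x. k < h \<Longrightarrow> x \<in> V k \<Longrightarrow> L x \<in> below m" "v \<in> below h"
  shows "L v \<in> below m"
proof -
  interpret l: Vector_Spaces.linear s s L by fact
  let ?S = "{i. component v i \<noteq> 0}"
  have "v = (\<Sum>h\<in>?S. component v h)" by (rule sum_components) (use component_props in auto)
  then have "L v = (\<Sum>h\<in>?S. L (component v h))" by (metis l.sum)
  also have "\<dots> \<in> below m"
  proof (rule below_closed)
    fix k assume "k \<in> ?S"
    then have "k < h" using assms(3) unfolding below_def by (metis (mono_tags, lifting) mem_Collect_eq not_le)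
    then show "L (component v k) \<in> below m" using assms(2) component_props(2) by blast
  qed
  finally show ?thesis .
qed

text \<open>Descent through the filtration, ending at 0 because the weights are bounded below. A
  step treats the component of weight k < h and may use the claim on everything of lower
  weight.\<close>

lemma below_induct [consumes 1, case_names bottom step]:
  assumes "v \<in> below h"
    and "P 0"
    and step: "\<And>k v. k < h \<Longrightarrow> v \<in> below (k + 1) \<Longrightarrow> (\<And>x. x \<in> below k \<Longrightarrow> P x) \<Longrightarrow> P v"
  shows "P v"
proof -
  obtain N where N: "\<And>k. k < N \<Longrightarrow> V k = {0}" using bounded_below by blast
  have "v \<in> below k \<Longrightarrow> k \<le> h \<Longrightarrow> P v" for k v
  proof (induction "nat (k - N)" arbitrary: k v)
    case 0
    have "component v i = 0" for i
    proof (cases "i < k")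
      case True
      then have "V i = {0}" using 0(1) by (intro N) linarith
      then show ?thesis using component_props(2)[of v i] by simp
    next
      case False
      then show ?thesis using 0(2) by (simp add: below_def)
    qed
    then have "v = 0" using component_props(3)[of v] by simp
    then show ?case using assms(2) by simp
  next
    case (Suc n)
    show ?case
    proof (rule step[of "k - 1"])
      fix x assume "x \<in> below (k - 1)"
      then show "P x" using Suc.hyps Suc.prems by (intro Suc.hyps(1)[of "k - 1"]) auto
    qed (use Suc.prems in auto)
  qed
  then show ?thesis using assms(1) by blast
qed

lemma below_top:
  assumes "v \<in> below (k + 1)"
  shows "v - component v k \<in> below k"
proof -
  have "component v i = 0" if "i > k" for i using assms that by (simp add: below_def)
  then show ?thesis
    by (auto simp: below_def component_simps component_homogeneous[OF component_props(2)])
qed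

lemma in_some_below: "\<exists>h. v \<in> below h"
proof -
  let ?S = "{i. component v i \<noteq> 0}"
  have "finite (insert 0 ?S)" using component_props by simp
  then have "i \<le> Max (insert 0 ?S)" if "i \<in> ?S" for i using that by simp
  then have "v \<in> below (Max (insert 0 ?S) + 1)" by (force simp: below_def)
  then show ?thesis by blast
qed

subsection \<open>Zhu's vertex operators\<close>

definition L0_zhu :: "'v \<Rightarrow> 'v" where "L0_zhu = res zhu_series \<omega>"

lemma linear_L0_zhu: "Vector_Spaces.linear s s L0_zhu"
  unfolding L0_zhu_def by (rule linear_res_right)

lemma omega_modes_eventually_0: "\<exists>I. \<forall>i\<ge>I. Y \<omega> (int i) u = 0"
proof -
  obtain N where "\<forall>n\<ge>N. Y \<omega> n u = 0" using truncation by blast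
  then show ?thesis by (intro exI[of _ "nat N"]) auto
qed

lemma L0_zhu_expand:
  assumes "u \<in> V h" "\<And>i. i \<ge> I \<Longrightarrow> Y \<omega> (int i) u = 0"
  shows "L0_zhu u = s (of_int h) u + (\<Sum>i\<in>{2..<I}. s (zhu_series $$ int i) (Y \<omega> (int i) u))"
proof -
  \<comment> \<open>The margin 2 guarantees that the index 1, which contributes L(0), lies in the
    range.\<close>
  let ?I = "I + 2"
  have "L0_zhu u = (\<Sum>i\<in>{1..<int ?I}. s (zhu_series $$ i) (Y \<omega> i u))"
    unfolding L0_zhu_def res_def
  proof (rule pair_eq_sum)
    show "Y \<omega> i u = 0" if "int ?I \<le> i" for i
      using that assms(2)[of "nat i"] by simp
  qed (simp add: zhu_series_low)
  also have "\<dots> = (\<Sum>i\<in>{1..<?I}. s (zhu_series $$ int i) (Y \<omega> (int i) u))"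
    by (rule sum.reindex_bij_witness[of _ int nat]) auto
  also have "\<dots> = s (zhu_series $$ 1) (Y \<omega> 1 u) + (\<Sum>i\<in>{2..<?I}. s (zhu_series $$ int i) (Y \<omega> (int i) u))"
    by (subst sum.atLeast_Suc_lessThan) (simp_all add: numeral_2_eq_2)
  also have "(\<Sum>i\<in>{2..<?I}. s (zhu_series $$ int i) (Y \<omega> (int i) u)) = (\<Sum>i\<in>{2..<I}. s (zhu_series $$ int i) (Y \<omega> (int i) u))"
    by (rule sum.mono_neutral_right) (use assms(2) in auto)
  finally show ?thesis using assms(1) by (simp add: zhu_series_low weight_space_def)
qed

lemma L0_zhu_triangular:
  assumes "u \<in> V h"
  shows "L0_zhu u - s (of_int h) u \<in> below h"
proof -
  obtain I where "\<And>i. i \<ge> I \<Longrightarrow> Y \<omega> (int i) u = 0" using omega_modes_eventually_0 by blast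
  from L0_zhu_expand[OF assms this]
  have "L0_zhu u - s (of_int h) u = (\<Sum>i\<in>{2..<I}. s (zhu_series $$ int i) (Y \<omega> (int i) u))" by simp
  also have "\<dots> \<in> below h"
    by (intro below_closed V_below[OF weight_omega[OF assms]]) auto
  finally show ?thesis .
qed

text \<open>\<open>Res\<^sub>x f(x) Y[u,x] v\<close> for homogeneous \<open>u\<close> and its linear extension; note \<open>dx = (1+z)^(-1) dz\<close>.\<close>

definition zhu_weight :: "int \<Rightarrow> complex fls \<Rightarrow> complex fls" where
  "zhu_weight h f = fls_compose_fps f (fps_ln 1) * lbinom (of_int h - 1)"

definition zhu_res :: "complex fls \<Rightarrow> 'v \<Rightarrow> 'v \<Rightarrow> 'v" where
  "zhu_res f u v = Sum_any (\<lambda>h. res (zhu_weight h f) (component u h) v)"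

lemma zhu_res_eq_sum:
  assumes "finite S" "\<And>h. h \<notin> S \<Longrightarrow> component u h = 0"
  shows "zhu_res f u v = (\<Sum>h\<in>S. res (zhu_weight h f) (component u h) v)"
  unfolding zhu_res_def by (rule Sum_any_eq_sum) (use assms in \<open>auto simp: res_left_simps\<close>)

lemma zhu_res_homogeneous: "u \<in> V h \<Longrightarrow> zhu_res f u v = res (zhu_weight h f) u v"
  by (subst zhu_res_eq_sum[of "{h}"]) (auto simp: component_homogeneous)

lemma cont_zhu_res: "cont (\<lambda>f. zhu_res f u v)"
proof -
  have "(\<lambda>f. zhu_res f u v) = (\<lambda>f. \<Sum>h\<in>{h. component u h \<noteq> 0}. res (zhu_weight h f) (component u h) v)"
    by (rule ext, rule zhu_res_eq_sum) (use component_props in auto)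
  moreover have "cont (\<lambda>f. res (zhu_weight h f) x v)" for h x
    unfolding zhu_weight_def
    by (rule cont_compose[where \<phi> = "\<lambda>f. res (f * lbinom (of_int h - 1)) x v"]) (auto intro: cont_mult[OF cont_res])
  ultimately show ?thesis by (simp only:) (rule cont_sum)
qed

lemma linear_zhu_res_right: "Vector_Spaces.linear s s (zhu_res f u)"
proof -
  have z: "zhu_res f u v = (\<Sum>h\<in>{h. component u h \<noteq> 0}. res (zhu_weight h f) (component u h) v)" for v
    by (rule zhu_res_eq_sum) (auto simp: component_props)
  show ?thesis by (rule linearI) (simp_all add: z res_right_simps sum.distrib scale_sum_right)
qed

lemma linear_zhu_res_left: "Vector_Spaces.linear s s (\<lambda>u. zhu_res f u v)"
proof (rule linearI)
  fix x y c
  let ?S = "{h. component x h \<noteq> 0} \<union> {h. component y h \<noteq> 0}"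
  have "zhu_res f u v = (\<Sum>h\<in>?S. res (zhu_weight h f) (component u h) v)" if "u \<in> {x, y, x + y, s c x}" for u
    by (rule zhu_res_eq_sum) (use that component_props in \<open>auto simp: component_add component_scale\<close>)
  then show "zhu_res f (x + y) v = zhu_res f x v + zhu_res f y v" "zhu_res f (s c x) v = s c (zhu_res f x v)"
    by (simp_all add: component_add component_scale res_left_simps sum.distrib scale_sum_right)
qed

lemma zhu_res_simps:
  "zhu_res f u (v + w) = zhu_res f u v + zhu_res f u w"  "zhu_res f u (s c v) = s c (zhu_res f u v)"
  "zhu_res f u (v - w) = zhu_res f u v - zhu_res f u w"
  "zhu_res f (u + u') v = zhu_res f u v + zhu_res f u' v" "zhu_res f (s c u) v = s c (zhu_res f u v)"
  "zhu_res f (u - u') v = zhu_res f u v - zhu_res f u' v"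
  "zhu_res f (\<Sum>i\<in>I. F i) v = (\<Sum>i\<in>I. zhu_res f (F i) v)"
proof -
  interpret r: Vector_Spaces.linear s s "zhu_res f u" by (rule linear_zhu_res_right)
  interpret l: Vector_Spaces.linear s s "\<lambda>u. zhu_res f u v" by (rule linear_zhu_res_left)
  show "zhu_res f u (v + w) = zhu_res f u v + zhu_res f u w"  "zhu_res f u (s c v) = s c (zhu_res f u v)"
  "zhu_res f u (v - w) = zhu_res f u v - zhu_res f u w"
  "zhu_res f (u + u') v = zhu_res f u v + zhu_res f u' v" "zhu_res f (s c u) v = s c (zhu_res f u v)"
  "zhu_res f (u - u') v = zhu_res f u v - zhu_res f u' v"
  "zhu_res f (\<Sum>i\<in>I. F i) v = (\<Sum>i\<in>I. zhu_res f (F i) v)"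
    by (rule r.add, rule r.scale, rule r.diff, rule l.add, rule l.scale, rule l.diff, rule l.sum)
qed

lemma zhu_weight_X: "zhu_weight h (fls_X_intpow j) = llog powi j * lbinom (of_int h - 1)"
  by (simp only: zhu_weight_def X_compose_ln)

text \<open>The two summands on the left are the i = 1 and i = 0 terms of the commutator of L[0]
  with a Zhu mode, the latter after integration by parts. Their logarithmic parts cancel because
  (1+z) log(1+z) g' = j g + (h-1) log(1+z) g.\<close>

lemma zhu_weight_X_identity:
  "of_int h * ((llog + 1) * zhu_weight h (fls_X_intpow j)) - fls_deriv (zhu_series * zhu_weight h (fls_X_intpow j))
    = fls_const (of_int (h - 1 - j)) * zhu_weight h (fls_X_intpow j)"
proof -
  let ?g = "zhu_weight h (fls_X_intpow j)"
  let ?a = "of_int h - 1 :: complex"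
  have l: "llog * llog powi (j - 1) = llog powi j"
    using power_int_add_1'[of llog "j - 1"] by simp
  have b: "lbinom 1 * lbinom (- 1) = 1" "lbinom 1 * lbinom (?a - 1) = lbinom ?a"
    by (simp_all flip: lbinom_add)
  have "fls_deriv ?g = of_int j * (lbinom (-1) * llog powi (j - 1)) * lbinom ?a + llog powi j * (fls_const ?a * lbinom (?a - 1))"
    by (simp add: zhu_weight_X fls_deriv_powi llog_deriv lbinom_deriv)
  then have "zhu_series * fls_deriv ?g =
      of_int j * ((lbinom 1 * lbinom (-1)) * (llog * llog powi (j - 1)) * lbinom ?a)
      + fls_const ?a * llog * (llog powi j * (lbinom 1 * lbinom (?a - 1)))"
    by (simp add: zhu_series_def algebra_simps)
  also have "\<dots> = of_int j * ?g + fls_const ?a * llog * ?g"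
    unfolding b l by (simp add: zhu_weight_X)
  finally have D: "fls_deriv (zhu_series * ?g) = (llog + 1) * ?g + (of_int j * ?g + fls_const ?a * llog * ?g)"
    by (simp add: zhu_series_deriv algebra_simps)
  have A: "fls_const ?a = of_int h - 1" and B: "fls_const (of_int (h - 1 - j)) = (of_int h - 1 - of_int j :: complex fls)"
    by (simp_all add: fls_of_int fls_minus_const[symmetric] fls_const_1 del: fls_minus_const)
  show ?thesis unfolding B D A by (simp add: algebra_simps)
qed

text \<open>In the commutator formula the terms with i >= 2 make up the Zhu mode of L[0]u - hu,
  while i = 0 and i = 1 together give h-1-j. Adding h back leaves the shift -(j+1) that L(0) has on
  ordinary modes.\<close>

lemma L0_zhu_derivation_homogeneous:
  assumes u: "u \<in> V h"
  shows "L0_zhu (zhu_res (fls_X_intpow j) u v) = zhu_res (fls_X_intpow j) u (L0_zhu v)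
    + zhu_res (fls_X_intpow j) (L0_zhu u) v - s (of_int (j + 1)) (zhu_res (fls_X_intpow j) u v)"
proof -
  let ?X = "fls_X_intpow j" and ?g = "zhu_weight h (fls_X_intpow j)"
  obtain I' where I': "\<And>i. i \<ge> I' \<Longrightarrow> Y \<omega> (int i) u = 0" using omega_modes_eventually_0 by blast
  define I where "I = I' + 2"
  have I: "Y \<omega> (int i) u = 0" if "i \<ge> I" for i using that by (intro I') (simp add: I_def)
  have w: "zhu_res ?X u x = res ?g u x" for x by (rule zhu_res_homogeneous[OF u])
  \<comment> \<open>The factor (1+z)^(1-i) combines with (1+z)^(h-1) to the weight factor of omega_i
    u, which has weight h-i+1.\<close>
  have hi: "res (hasse i zhu_series * ?g) (Y \<omega> (int i) u) v = s (zhu_series $$ int i) (zhu_res ?X (Y \<omega> (int i) u) v)"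
    if "i \<ge> 2" for i
  proof -
    obtain k where k: "i = Suc (Suc k)" using \<open>i \<ge> 2\<close> by (metis Suc_diff_Suc add_2_eq_Suc le_add_diff_inverse)
    have e: "- 1 - of_nat k + (of_int h - 1) = (of_int (h - int i + 1) - 1 :: complex)" by (simp add: k)
    have "hasse i zhu_series * ?g = fls_const (zhu_series $$ int i) * (llog powi j * (lbinom (- 1 - of_nat k) * lbinom (of_int h - 1)))"
      unfolding k hasse_zhu_ge_2 zhu_weight_X by (simp only: mult_ac)
    also have "\<dots> = fls_const (zhu_series $$ int i) * zhu_weight (h - int i + 1) ?X"
      unfolding lbinom_add[symmetric] e zhu_weight_X ..
    finally show ?thesis
      by (simp only: contD(2)[OF cont_res] zhu_res_homogeneous[OF weight_omega[OF u]])
  qed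
  have "L0_zhu (zhu_res ?X u v) - zhu_res ?X u (L0_zhu v) = (\<Sum>i<I. res (hasse i zhu_series * ?g) (Y \<omega> (int i) u) v)"
    unfolding L0_zhu_def w by (rule res_commutator[OF I])
  also have "{..<I} = insert 0 (insert 1 {2..<I})" by (auto simp: I_def)
  also have "(\<Sum>i\<in>insert 0 (insert 1 {2..<I}). res (hasse i zhu_series * ?g) (Y \<omega> (int i) u) v) =
      res (zhu_series * ?g) (Y \<omega> 0 u) v + (res ((llog + 1) * ?g) (Y \<omega> 1 u) v +
       (\<Sum>i\<in>{2..<I}. res (hasse i zhu_series * ?g) (Y \<omega> (int i) u) v))"
    by (simp add: hasse_1_zhu[simplified])
  also have "(\<Sum>i\<in>{2..<I}. res (hasse i zhu_series * ?g) (Y \<omega> (int i) u) v) =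
      zhu_res ?X (\<Sum>i\<in>{2..<I}. s (zhu_series $$ int i) (Y \<omega> (int i) u)) v"
    by (simp add: hi zhu_res_simps)
  also have "(\<Sum>i\<in>{2..<I}. s (zhu_series $$ int i) (Y \<omega> (int i) u)) = L0_zhu u - s (of_int h) u"
    using L0_zhu_expand[OF u I] by simp
  also have "res (zhu_series * ?g) (Y \<omega> 0 u) v = - res (fls_deriv (zhu_series * ?g)) u v"
    by (rule res_L_minus_one)
  also have "res ((llog + 1) * ?g) (Y \<omega> 1 u) v = res (of_int h * ((llog + 1) * ?g)) u v"
    using u by (simp add: weight_space_def res_left_simps fls_of_int contD(2)[OF cont_res])
  also have "- res (fls_deriv (zhu_series * ?g)) u v + (res (of_int h * ((llog + 1) * ?g)) u v +
      zhu_res ?X (L0_zhu u - s (of_int h) u) v) =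
      res (of_int h * ((llog + 1) * ?g) - fls_deriv (zhu_series * ?g)) u v + zhu_res ?X (L0_zhu u - s (of_int h) u) v"
    by (simp add: contD(4)[OF cont_res])
  also have "\<dots> = s (of_int (h - 1 - j)) (zhu_res ?X u v) + zhu_res ?X (L0_zhu u) v - s (of_int h) (zhu_res ?X u v)"
    unfolding zhu_weight_X_identity contD(2)[OF cont_res] zhu_res_simps w by simp
  finally have "L0_zhu (zhu_res ?X u v) - zhu_res ?X u (L0_zhu v) =
    zhu_res ?X (L0_zhu u) v + (s (of_int (h - 1 - j)) (zhu_res ?X u v) - s (of_int h) (zhu_res ?X u v))" by simp
  also have "s (of_int (h - 1 - j)) (zhu_res ?X u v) - s (of_int h) (zhu_res ?X u v) = - s (of_int (j + 1)) (zhu_res ?X u v)"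
    by (simp flip: scale_left_diff_distrib scale_minus_left)
  finally show ?thesis by (simp add: algebra_simps)
qed

lemma L0_zhu_simps: "L0_zhu (x + y) = L0_zhu x + L0_zhu y" "L0_zhu (s c x) = s c (L0_zhu x)"
  "L0_zhu 0 = 0" "L0_zhu (x - y) = L0_zhu x - L0_zhu y"
  by (simp_all add: L0_zhu_def res_right_simps)

lemma L0_zhu_derivation:
  "L0_zhu (zhu_res (fls_X_intpow j) u v) = zhu_res (fls_X_intpow j) u (L0_zhu v)
    + zhu_res (fls_X_intpow j) (L0_zhu u) v - s (of_int (j + 1)) (zhu_res (fls_X_intpow j) u v)"
proof (induction u rule: homogeneous_induct)
  case (add x y)
  then show ?case by (simp add: L0_zhu_simps zhu_res_simps scale_right_distrib)
next
  case (homogeneous h x)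
  then show ?case by (rule L0_zhu_derivation_homogeneous)
qed

text \<open>Since the test series starts at z^j, only a_i b with i >= j occur. For weights at most
  h-1 and k-1 these have weight at most h+k-j-3.\<close>

lemma zhu_res_below:
  assumes "x \<in> below h" "y \<in> below k"
  shows "zhu_res (fls_X_intpow j) x y \<in> below (h + k - j - 2)"
proof -
  have 1: "zhu_res (fls_X_intpow j) a b \<in> below (h + k - j - 2)"
    if a: "a \<in> V h'" "h' < h" and b: "b \<in> V k'" "k' < k" for a b h' k'
  proof -
    obtain K where K: "\<And>n. n \<ge> K \<Longrightarrow> Y a n b = 0" using truncation by blast
    have "zhu_res (fls_X_intpow j) a b = (\<Sum>i\<in>{j..<K}. s (zhu_weight h' (fls_X_intpow j) $$ i) (Y a i b))"
      unfolding zhu_res_homogeneous[OF a(1)] res_def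
    proof (rule pair_eq_sum[OF K])
      show "zhu_weight h' (fls_X_intpow j) $$ i = 0" if "i < j" for i
        unfolding zhu_weight_X using that by (intro fls_eq0_below_subdegree) (simp add: subdegree_powi)
    qed
    also have "\<dots> \<in> below (h + k - j - 2)"
      by (intro below_closed V_below[OF weight_Y[OF a(1) b(1)]]) (use a b in auto)
    finally show ?thesis .
  qed
  have "zhu_res (fls_X_intpow j) a y \<in> below (h + k - j - 2)" if "a \<in> V h'" "h' < h" for a h'
    by (rule below_image[OF linear_zhu_res_right 1[OF that] assms(2)])
  then show ?thesis by (rule below_image[OF linear_zhu_res_left _ assms(1)])
qed

lemma zhu_res_leading:
  assumes "u \<in> V h" "v \<in> V k"
  shows "zhu_res (fls_X_intpow j) u v - Y u j v \<in> below (h + k - j - 1)"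
proof -
  obtain K' where K': "\<And>n. n \<ge> K' \<Longrightarrow> Y u n v = 0" using truncation by blast
  \<comment> \<open>Taking K > j keeps the leading index j in the range of summation.\<close>
  define K where "K = max K' (j + 1)"
  have K: "Y u n v = 0" if "n \<ge> K" for n using that by (intro K') (simp add: K_def)
  let ?f = "zhu_weight h (fls_X_intpow j)"
  have "zhu_res (fls_X_intpow j) u v = (\<Sum>i\<in>{j..<K}. s (?f $$ i) (Y u i v))"
    unfolding zhu_res_homogeneous[OF assms(1)] res_def
  proof (rule pair_eq_sum[OF K])
    show "?f $$ i = 0" if "i < j" for i
      unfolding zhu_weight_X using that by (intro fls_eq0_below_subdegree) (simp add: subdegree_powi)
  qed
  also have "{j..<K} = insert j {j + 1..<K}" by (auto simp: K_def)
  also have "(\<Sum>i\<in>insert j {j + 1..<K}. s (?f $$ i) (Y u i v)) = Y u j v + (\<Sum>i\<in>{j + 1..<K}. s (?f $$ i) (Y u i v))"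
  proof -
    have "?f $$ j = 1" unfolding zhu_weight_X by (rule llog_powi_lbinom_nth)
    then show ?thesis by simp
  qed
  finally have "zhu_res (fls_X_intpow j) u v - Y u j v = (\<Sum>i\<in>{j + 1..<K}. s (?f $$ i) (Y u i v))" by simp
  also have "\<dots> \<in> below (h + k - j - 1)"
    by (intro below_closed V_below[OF weight_Y[OF assms]]) auto
  finally show ?thesis .
qed

subsection \<open>The isomorphism onto Zhu's vertex algebra\<close>

lemma L0_zhu_below: "x \<in> below h \<Longrightarrow> L0_zhu x \<in> below h"
proof (rule below_image[OF linear_L0_zhu])
  fix k x assume k: "k < h" and x: "x \<in> V k"
  have "L0_zhu x = (L0_zhu x - s (of_int k) x) + s (of_int k) x" by simp
  also have "\<dots> \<in> below h"
    using below_mono[OF L0_zhu_triangular[OF x], of h] V_below[OF x k] k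
    by (intro below_closed(2) below_closed(3)) auto
  finally show "L0_zhu x \<in> below h" .
qed

text \<open>On the component of top weight k < h, L[0] acts as k modulo lower weights, so eigenvalue
  h forces that component to vanish.\<close>

lemma L0_zhu_eigenvector_below:
  assumes "x \<in> below h" "L0_zhu x = s (of_int h) x"
  shows "x = 0"
  using assms(1,1,2)
proof (induction rule: below_induct)
  case bottom
  then show ?case by simp
next
  case (step k v)
  have "component (L0_zhu v) k = s (of_int k) (component v k)"
  proof -
    let ?w = "component v k"
    have "L0_zhu v - s (of_int k) ?w = (L0_zhu ?w - s (of_int k) ?w) + L0_zhu (v - ?w)"
      by (simp add: L0_zhu_simps)
    also have "\<dots> \<in> below k"
      by (intro below_closed L0_zhu_triangular component_props L0_zhu_below below_top step.hyps)
    finally have "component (L0_zhu v - s (of_int k) ?w) k = 0" by (simp add: below_def)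
    then show ?thesis
      by (simp add: component_simps component_scale component_homogeneous[OF component_props(2)])
  qed
  then have "s (of_int h - of_int k) (component v k) = 0"
    using step.prems by (simp add: component_scale scale_left_diff_distrib)
  then have "component v k = 0" using step.hyps(1) by simp
  then have "v \<in> below k" using below_top[OF step.hyps(2)] by simp
  then show ?case using step by blast
qed

text \<open>On the top component k the operator L[0] - h is the nonzero scalar k - h up to lower
  weights. Divide by it and correct the lower-weight error recursively.\<close>

lemma L0_zhu_minus_weight_surj:
  assumes "y \<in> below h"
  shows "\<exists>x\<in>below h. L0_zhu x - s (of_int h) x = y"
  using assms(1)
proof (induction rule: below_induct)
  case bottom
  then show ?case by (intro bexI[of _ 0]) (simp_all add: L0_zhu_simps below_closed)
next
  case (step k v)
  define x0 where "x0 = s (1 / (of_int k - of_int h)) (component v k)"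
  have x0: "x0 \<in> V k" unfolding x0_def by (intro V_closed component_props)
  have "s (of_int k - of_int h) x0 = component v k" using step.hyps(1) by (simp add: x0_def)
  then have "v - (L0_zhu x0 - s (of_int h) x0) = (v - component v k) - (L0_zhu x0 - s (of_int k) x0)"
    by (simp add: scale_left_diff_distrib algebra_simps)
  also have "\<dots> \<in> below k"
    by (intro below_closed below_top step.hyps L0_zhu_triangular x0)
  finally obtain x where x: "x \<in> below h" "L0_zhu x - s (of_int h) x = v - (L0_zhu x0 - s (of_int h) x0)"
    using step.IH by blast
  then have "L0_zhu (x0 + x) - s (of_int h) (x0 + x) = v"
    by (simp add: L0_zhu_simps scale_right_distrib algebra_simps)
  moreover have "x0 + x \<in> below h"
    using x(1) V_below[OF x0 step.hyps(1)] by (rule below_closed(2)[rotated])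
  ultimately show ?case by blast
qed

definition is_zhu_lift :: "int \<Rightarrow> 'v \<Rightarrow> 'v \<Rightarrow> bool" where
  "is_zhu_lift h v x \<longleftrightarrow> x - v \<in> below h \<and> L0_zhu x = s (of_int h) x"

lemma zhu_lift_ex1:
  assumes "v \<in> V h"
  shows "\<exists>!x. is_zhu_lift h v x"
proof (rule ex_ex1I)
  \<comment> \<open>The correction x of lower weight must satisfy (L[0] - h) x = -(L[0] - h)
    v.\<close>
  have "s (-1) (L0_zhu v - s (of_int h) v) \<in> below h"
    by (rule below_closed(3)[OF L0_zhu_triangular[OF assms]])
  from L0_zhu_minus_weight_surj[OF this] obtain x where
    "x \<in> below h" "L0_zhu x - s (of_int h) x = s (-1) (L0_zhu v - s (of_int h) v)" by blast
  then have "is_zhu_lift h v (v + x)"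
    by (simp add: is_zhu_lift_def L0_zhu_simps scale_right_distrib algebra_simps)
  then show "\<exists>x. is_zhu_lift h v x" ..
next
  fix x y assume "is_zhu_lift h v x" "is_zhu_lift h v y"
  then have x: "x - v \<in> below h" "L0_zhu x = s (of_int h) x" and y: "y - v \<in> below h" "L0_zhu y = s (of_int h) y"
    by (simp_all add: is_zhu_lift_def)
  have "(x - v) - (y - v) \<in> below h" by (rule below_closed(4)[OF x(1) y(1)])
  moreover have "L0_zhu (x - y) = s (of_int h) (x - y)"
    by (simp add: x(2) y(2) L0_zhu_simps scale_right_diff_distrib)
  ultimately show "x = y" using L0_zhu_eigenvector_below[of "x - y" h] by simp
qed

definition zhu_iso :: "'v \<Rightarrow> 'v" where
  "zhu_iso v = Sum_any (\<lambda>h. THE x. is_zhu_lift h (component v h) x)"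

lemma zhu_lift_0: "(THE x. is_zhu_lift h 0 x) = 0"
  by (rule the1_equality[OF zhu_lift_ex1])
    (auto simp: is_zhu_lift_def V_closed below_closed L0_zhu_simps)

text \<open>Compatibility with modes, the vacuum, linear combinations and g are all proved by
  exhibiting a vector with these two properties.\<close>

lemma zhu_iso_eqI:
  assumes "v \<in> V h" "x - v \<in> below h" "L0_zhu x = s (of_int h) x"
  shows "zhu_iso v = x"
proof -
  have "zhu_iso v = (\<Sum>k\<in>{h}. THE x. is_zhu_lift k (component v k) x)"
    unfolding zhu_iso_def
    by (rule Sum_any_eq_sum) (auto simp: component_homogeneous[OF assms(1)] zhu_lift_0)
  also have "\<dots> = x"
    using the1_equality[OF zhu_lift_ex1[OF assms(1)], of x] assms(2,3)
    by (simp add: component_homogeneous[OF assms(1)] is_zhu_lift_def)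
  finally show ?thesis .
qed

lemma zhu_iso_lift:
  assumes "v \<in> V h"
  shows "zhu_iso v - v \<in> below h" "L0_zhu (zhu_iso v) = s (of_int h) (zhu_iso v)"
proof -
  obtain x where x: "x - v \<in> below h" "L0_zhu x = s (of_int h) x"
    using zhu_lift_ex1[OF assms] by (auto simp: is_zhu_lift_def)
  with zhu_iso_eqI[OF assms x] show "zhu_iso v - v \<in> below h" "L0_zhu (zhu_iso v) = s (of_int h) (zhu_iso v)"
    by simp_all
qed

lemma zhu_iso_eq_sum:
  assumes "finite S" "\<And>h. h \<notin> S \<Longrightarrow> component v h = 0"
  shows "zhu_iso v = (\<Sum>h\<in>S. zhu_iso (component v h))"
proof -
  have "zhu_iso (component v h) = (THE x. is_zhu_lift h (component v h) x)" for h
    using the1_equality[OF zhu_lift_ex1[OF component_props(2)], of h v "zhu_iso (component v h)"]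
      zhu_iso_lift[OF component_props(2)[of v h]] by (simp add: is_zhu_lift_def)
  moreover have "zhu_iso v = (\<Sum>h\<in>S. THE x. is_zhu_lift h (component v h) x)"
    unfolding zhu_iso_def by (rule Sum_any_eq_sum) (use assms zhu_lift_0 in auto)
  ultimately show ?thesis by simp
qed

lemma linear_zhu_iso: "Vector_Spaces.linear s s zhu_iso"
proof (rule linearI)
  fix x y c
  let ?S = "{h. component x h \<noteq> 0} \<union> {h. component y h \<noteq> 0}"
  have e: "zhu_iso u = (\<Sum>h\<in>?S. zhu_iso (component u h))" if "u \<in> {x, y, x + y, s c x}" for u
    by (rule zhu_iso_eq_sum) (use that component_props in \<open>auto simp: component_add component_scale\<close>)
  have "zhu_iso (a + b) = zhu_iso a + zhu_iso b" if "a \<in> V h" "b \<in> V h" for a b h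
  proof (rule zhu_iso_eqI[of _ h])
    have "zhu_iso a + zhu_iso b - (a + b) = (zhu_iso a - a) + (zhu_iso b - b)" by simp
    also have "\<dots> \<in> below h" by (intro below_closed zhu_iso_lift that)
    finally show "zhu_iso a + zhu_iso b - (a + b) \<in> below h" .
  qed (use that in \<open>simp_all add: V_closed L0_zhu_simps zhu_iso_lift scale_right_distrib\<close>)
  note add = this[OF component_props(2) component_props(2)]
  have "zhu_iso (s c a) = s c (zhu_iso a)" if "a \<in> V h" for a h
  proof (rule zhu_iso_eqI[of _ h])
    have "s c (zhu_iso a) - s c a = s c (zhu_iso a - a)" by (simp add: scale_right_diff_distrib)
    also have "\<dots> \<in> below h" by (intro below_closed zhu_iso_lift that)
    finally show "s c (zhu_iso a) - s c a \<in> below h" .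
  qed (use that in \<open>simp_all add: V_closed L0_zhu_simps zhu_iso_lift mult.commute\<close>)
  note scale = this[OF component_props(2)]
  show "zhu_iso (x + y) = zhu_iso x + zhu_iso y" "zhu_iso (s c x) = s c (zhu_iso x)"
    by (simp_all add: e add scale component_add component_scale sum.distrib scale_sum_right)
qed

lemma zhu_iso_simps: "zhu_iso (x + y) = zhu_iso x + zhu_iso y" "zhu_iso (s c x) = s c (zhu_iso x)"
  "zhu_iso 0 = 0" "zhu_iso (x - y) = zhu_iso x - zhu_iso y"
proof -
  interpret l: Vector_Spaces.linear s s zhu_iso by (rule linear_zhu_iso)
  show "zhu_iso (x + y) = zhu_iso x + zhu_iso y" "zhu_iso (s c x) = s c (zhu_iso x)"
    "zhu_iso 0 = 0" "zhu_iso (x - y) = zhu_iso x - zhu_iso y"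
    by (rule l.add, rule l.scale, rule l.zero, rule l.diff)
qed

lemma zhu_iso_below: "v \<in> below h \<Longrightarrow> zhu_iso v \<in> below h"
proof (rule below_image[OF linear_zhu_iso])
  fix k x assume k: "k < h" and x: "x \<in> V k"
  have "zhu_iso x = (zhu_iso x - x) + x" by simp
  also have "\<dots> \<in> below h"
    using below_mono[OF zhu_iso_lift(1)[OF x], of h] V_below[OF x k] k by (intro below_closed(2)) auto
  finally show "zhu_iso x \<in> below h" .
qed

text \<open>The map is the identity plus terms of lower weight, so it is injective and surjective by
  descent through the filtration.\<close>

lemma bij_zhu_iso: "bij zhu_iso"
proof (rule bijI)
  have "v = 0" if "zhu_iso v = 0" for v
  proof -
    obtain h where "v \<in> below h" using in_some_below by blast
    then show ?thesis using that
    proof (induction rule: below_induct)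
      case bottom
      then show ?case by simp
    next
      case (step k v)
      let ?w = "component v k"
      have "?w = - ((zhu_iso ?w - ?w) + zhu_iso (v - ?w))"
        using step.prems by (simp add: zhu_iso_simps)
      also have "\<dots> = s (-1) ((zhu_iso ?w - ?w) + zhu_iso (v - ?w))" by simp
      also have "\<dots> \<in> below k"
        by (intro below_closed zhu_iso_lift component_props zhu_iso_below below_top step.hyps)
      finally have "component ?w k = 0" by (simp add: below_def)
      then have "?w = 0" by (simp add: component_homogeneous[OF component_props(2)])
      then have "v \<in> below k" using below_top[OF step.hyps(2)] by simp
      then show ?case using step by blast
    qed
  qed
  then show "inj zhu_iso"
    by (intro injI) (metis eq_iff_diff_eq_0 zhu_iso_simps(4))
next
  have "\<exists>v. zhu_iso v = y" for y
  proof -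
    obtain h where "y \<in> below h" using in_some_below by blast
    then show ?thesis
    proof (induction rule: below_induct)
      case bottom
      then show ?case using zhu_iso_simps(3) by blast
    next
      case (step k v)
      let ?w = "component v k"
      have "v - zhu_iso ?w = (v - ?w) - (zhu_iso ?w - ?w)" by simp
      also have "\<dots> \<in> below k"
        by (intro below_closed zhu_iso_lift component_props below_top step.hyps)
      finally obtain x where "zhu_iso x = v - zhu_iso ?w" using step.IH by blast
      then have "zhu_iso (x + ?w) = v" by (simp add: zhu_iso_simps)
      then show ?case by blast
    qed
  qed
  then show "surj zhu_iso" by (metis surjI)
qed

lemma zhu_iso_vac: "zhu_iso vac = vac"
proof (rule zhu_iso_eqI[OF vac_weight])
  have "L0_zhu vac = s (of_int 0) vac + (\<Sum>i\<in>{2..<0}. s (zhu_series $$ int i) (Y \<omega> (int i) vac))"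
    by (rule L0_zhu_expand[OF vac_weight]) (simp add: creation)
  then show "L0_zhu vac = s (of_int 0) vac" by simp
qed (simp add: below_closed)

lemma zhu_iso_mode: "zhu_iso (Y u j v) = zhu_res (fls_X_intpow j) (zhu_iso u) (zhu_iso v)"
proof (induction u rule: homogeneous_induct)
  case (add x y)
  then show ?case by (simp add: Y_add_left zhu_iso_simps zhu_res_simps)
next
  case u: (homogeneous h u)
  show ?case
  proof (induction v rule: homogeneous_induct)
    case (add x y)
    then show ?case by (simp add: Y_add_right zhu_iso_simps zhu_res_simps)
  next
    case v: (homogeneous k v)
    let ?X = "fls_X_intpow j" and ?u = "zhu_iso u" and ?v = "zhu_iso v"
    let ?c = "h + k - j - 1"
    have "?u - u \<in> below h" "v \<in> below (k + 1)" "?u \<in> below (h + 1)" "?v - v \<in> below k"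
      using zhu_iso_lift[OF u] zhu_iso_lift[OF v] V_below[OF u] V_below[OF v] zhu_iso_below by auto
    from zhu_res_below[OF this(1,2), of j] zhu_res_below[OF this(3,4), of j]
    have "zhu_res ?X (?u - u) v \<in> below (h + (k + 1) - j - 2)" "zhu_res ?X ?u (?v - v) \<in> below ((h + 1) + k - j - 2)" .
    \<comment> \<open>In each correction one factor drops below its own weight while the other is
      merely below its weight plus 1, so both results lie below the weight of u_j v.\<close>
    moreover have "h + (k + 1) - j - 2 = ?c" "(h + 1) + k - j - 2 = ?c" by simp_all
    ultimately have b: "zhu_res ?X (?u - u) v \<in> below ?c" "zhu_res ?X ?u (?v - v) \<in> below ?c" by metis+
    show ?case
    proof (rule zhu_iso_eqI[OF weight_Y[OF u v]])
      have "zhu_res ?X ?u ?v - Y u j v =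
          (zhu_res ?X u v - Y u j v) + (zhu_res ?X (?u - u) v + zhu_res ?X ?u (?v - v))"
        by (simp add: zhu_res_simps)
      also have "\<dots> \<in> below ?c" by (intro below_closed(2) zhu_res_leading u v b)
      finally show "zhu_res ?X ?u ?v - Y u j v \<in> below ?c" .
      have "L0_zhu (zhu_res ?X ?u ?v) = s (of_int k) (zhu_res ?X ?u ?v) + s (of_int h) (zhu_res ?X ?u ?v)
          - s (of_int (j + 1)) (zhu_res ?X ?u ?v)"
        unfolding L0_zhu_derivation zhu_iso_lift(2)[OF u] zhu_iso_lift(2)[OF v] zhu_res_simps ..
      also have "\<dots> = s (of_int ?c) (zhu_res ?X ?u ?v)"
        by (simp add: algebra_simps flip: scale_left_distrib scale_left_diff_distrib)
      finally show "L0_zhu (zhu_res ?X ?u ?v) = s (of_int ?c) (zhu_res ?X ?u ?v)" .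
    qed
  qed
qed

lemma zhu_iso_pair:
  "zhu_iso (pair f (\<lambda>j. Y u j v)) = zhu_res f (zhu_iso u) (zhu_iso v)"
  by (rule cont_eq[where \<phi> = "\<lambda>f. zhu_iso (pair f (\<lambda>j. Y u j v))" and \<psi> = "\<lambda>f. zhu_res f (zhu_iso u) (zhu_iso v)"])
    (auto intro!: cont_linear[OF linear_zhu_iso cont_pair[OF bounded_above_modes]] cont_zhu_res
      simp: pair_X_intpow zhu_iso_mode)

end

subsection \<open>Changing coordinates\<close>

context complex_space
begin

lemma jacobi_left_add_bounded:
  assumes "left_bounded P" "left_bounded Q"
  shows "jacobi_left l m n (\<lambda>a b. P a b + Q a b) = jacobi_left l m n P + jacobi_left l m n Q"
  unfolding jacobi_left_def scale_right_distrib
  by (rule Sum_any.distrib; rule finite_left) (fact assms)+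

lemma jacobi_right_add_bounded:
  assumes "right_bounded P" "right_bounded Q"
  shows "jacobi_right l m n (\<lambda>a b. P a b + Q a b) = jacobi_right l m n P + jacobi_right l m n Q"
  unfolding jacobi_right_def scale_right_distrib
  by (rule Sum_any.distrib; rule finite_right) (fact assms)+

end

context vertex_operator_algebra
begin

definition zhu_inv :: "'v \<Rightarrow> 'v" where "zhu_inv = inv zhu_iso"

lemma zhu_inv_iso [simp]: "zhu_inv (zhu_iso v) = v" "zhu_iso (zhu_inv v) = v"
  using bij_zhu_iso by (simp_all add: zhu_inv_def bij_is_inj bij_is_surj surj_f_inv_f)

lemma zhu_inv_eqI: "zhu_iso x = y \<Longrightarrow> zhu_inv y = x"
  by auto

lemma linear_zhu_inv: "Vector_Spaces.linear s s zhu_inv"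
  by (rule linearI; rule zhu_inv_eqI) (simp_all add: zhu_iso_simps)

lemma zhu_inv_add: "zhu_inv (x + y) = zhu_inv x + zhu_inv y"
proof -
  interpret l: Vector_Spaces.linear s s zhu_inv by (rule linear_zhu_inv)
  show ?thesis by (rule l.add)
qed

lemma additive_zero_if_components:
  fixes D :: "'v \<Rightarrow> 'c::ab_group_add"
  assumes "\<And>x y. D (x + y) = D x + D y" "\<And>h. D (component v h) = 0"
  shows "D v = 0"
proof -
  have D0: "D 0 = 0" using assms(1)[of 0 0] by simp
  have "D (\<Sum>h\<in>S. component v h) = 0" if "finite S" for S
    using that by (induction S) (simp_all add: assms D0)
  then show ?thesis
    using sum_components[OF component_props(1)[of v], of v] component_props(1)[of v] by force
qed

end

section \<open>Compatibility with the automorphism and transport of module operators\<close>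

context twisted_setup
begin

lemma g_Y: "g (YV u n v) = YV (g u) n (g v)" and g_omega: "g \<omega> = \<omega>" and g_vac: "g vac = vac"
  using automorphism by (auto simp: voa_automorphism_def)

lemma g_simps: "g (x + y) = g x + g y" "g (x - y) = g x - g y" "g (sV c x) = sV c (g x)" "g 0 = 0"
proof -
  interpret l: Vector_Spaces.linear sV sV g by (rule linear_g)
  show "g (x + y) = g x + g y" "g (x - y) = g x - g y" "g (sV c x) = sV c (g x)" "g 0 = 0"
    by (rule l.add, rule l.diff, rule l.scale, rule l.zero)
qed

lemma g_weight: "v \<in> V h \<Longrightarrow> g v \<in> V h"
  using g_Y[of \<omega> 1 v] by (simp add: weight_space_def g_omega g_simps)

lemma component_g: "component (g v) h = g (component v h)"
proof -
  interpret l: Vector_Spaces.linear sV sV g by (rule linear_g)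
  let ?S = "{h. component v h \<noteq> 0}"
  have "component (g v) = (\<lambda>h. g (component v h))"
  proof (rule component_eqI)
    show "finite {i. g (component v i) \<noteq> 0}"
      by (rule finite_subset[OF _ component_props(1)[of v]]) (auto simp: g_simps)
    have "v = (\<Sum>h\<in>?S. component v h)" by (rule sum_components) (auto simp: component_props)
    then have "g v = (\<Sum>h\<in>?S. g (component v h))" by (metis l.sum)
    also have "\<dots> = Sum_any (\<lambda>h. g (component v h))"
      by (rule Sum_any_eq_sum[symmetric]) (auto simp: component_props g_simps)
    finally show "g v = Sum_any (\<lambda>h. g (component v h))" .
  qed (simp add: g_weight component_props)
  then show ?thesis by simp
qed

lemma L0_zhu_g: "L0_zhu (g v) = g (L0_zhu v)"
  unfolding L0_zhu_def res_def linear_pair[OF linear_g vertex_operator_algebra.bounded_above_modes[OF vertex_operator_algebra_axioms]]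
  by (simp add: g_Y g_omega)

lemma below_g: "v \<in> below h \<Longrightarrow> g v \<in> below h"
  by (simp add: below_def component_g g_simps)

text \<open>Since g fixes omega it commutes with L[0] and preserves weights, so g of a lift is the
  lift of g v. Hence eigenspaces are respected.\<close>

lemma zhu_iso_g: "zhu_iso (g v) = g (zhu_iso v)"
proof (induction v rule: homogeneous_induct)
  case (add x y)
  then show ?case by (simp add: g_simps zhu_iso_simps)
next
  case (homogeneous h v)
  show ?case
  proof (rule zhu_iso_eqI[OF g_weight[OF homogeneous]])
    show "g (zhu_iso v) - g v \<in> below h"
      using below_g[OF zhu_iso_lift(1)[OF homogeneous]] by (simp add: g_simps)
    show "L0_zhu (g (zhu_iso v)) = sV (of_int h) (g (zhu_iso v))"
      by (simp add: L0_zhu_g zhu_iso_lift(2)[OF homogeneous] g_simps)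
  qed
qed

lemma zhu_inv_g: "zhu_inv (g v) = g (zhu_inv v)"
  by (rule zhu_inv_eqI) (simp add: zhu_iso_g)

lemma eigenspace_zhu_iso: "v \<in> E r \<Longrightarrow> zhu_iso v \<in> E r"
  and eigenspace_component: "v \<in> E r \<Longrightarrow> component v h \<in> E r"
  using zhu_iso_g[of v] component_g[of v h]
  by (auto simp: eigenspace_def zhu_iso_simps component_scale)

lemma eigenspace_zhu_inv: "v \<in> E r \<Longrightarrow> zhu_inv v \<in> E r"
proof -
  interpret l: Vector_Spaces.linear sV sV zhu_inv by (rule linear_zhu_inv)
  show "v \<in> E r \<Longrightarrow> zhu_inv v \<in> E r"
    using zhu_inv_g[of v] by (auto simp: eigenspace_def l.scale)
qed

text \<open>
  For \<open>v\<close> of weight \<open>h\<close>, multiplication of \<open>Y(v,x)\<close> by \<open>x^(e h)\<close> is a shift of the modes;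
  \<open>shift_modes id (-1)\<close> and \<open>shift_modes id 1\<close> pass between \<open>Y(v,x)\<close> and \<open>Y(x^L(0) v,x)\<close>.
\<close>

definition shift_modes :: "('v \<Rightarrow> 'v) \<Rightarrow> int \<Rightarrow> ('v \<Rightarrow> rat \<Rightarrow> 'w \<Rightarrow> 'w) \<Rightarrow> 'v \<Rightarrow> rat \<Rightarrow> 'w \<Rightarrow> 'w" where
  "shift_modes B e Y v n w = Sum_any (\<lambda>h. Y (B (component v h)) (n + of_int (e * h)) w)"

definition to_phi :: "('v \<Rightarrow> rat \<Rightarrow> 'w \<Rightarrow> 'w) \<Rightarrow> 'v \<Rightarrow> rat \<Rightarrow> 'w \<Rightarrow> 'w" where
  "to_phi Y v = shift_modes id 1 Y (zhu_iso v)"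

text \<open>The shift must use the weight of v, and \<open>zhu_inv\<close> does not preserve
  weights; it is therefore applied inside, after v has been split into components.\<close>

definition from_phi :: "('v \<Rightarrow> rat \<Rightarrow> 'w \<Rightarrow> 'w) \<Rightarrow> 'v \<Rightarrow> rat \<Rightarrow> 'w \<Rightarrow> 'w" where
  "from_phi Y = shift_modes zhu_inv (- 1) Y"

lemma shift_modes_eq_sum:
  assumes "\<And>n w. Y 0 n w = 0" "B 0 = 0" "finite S" "\<And>h. h \<notin> S \<Longrightarrow> component v h = 0"
  shows "shift_modes B e Y v n w = (\<Sum>h\<in>S. Y (B (component v h)) (n + of_int (e * h)) w)"
  unfolding shift_modes_def by (rule Sum_any_eq_sum) (use assms in auto)

lemma operators_linear:
  assumes "twisted_vertex_operators sV vac g T sW Y"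
  shows "Vector_Spaces.linear sW sW (Y v n)" "Vector_Spaces.linear sV sW (\<lambda>v. Y v n w)" "Y 0 n w = 0"
proof -
  show "Vector_Spaces.linear sW sW (Y v n)" "Vector_Spaces.linear sV sW (\<lambda>v. Y v n w)"
    using assms by (auto simp: twisted_vertex_operators_def bilinear_modes_def)
  then interpret l: Vector_Spaces.linear sV sW "\<lambda>v. Y v n w" by simp
  show "Y 0 n w = 0" by (rule l.zero)
qed

lemma shift_modes_homogeneous:
  assumes "\<And>n w. Y 0 n w = 0" "B 0 = 0" "v \<in> V h"
  shows "shift_modes B e Y v n w = Y (B v) (n + of_int (e * h)) w"
  by (subst shift_modes_eq_sum[where Y = Y and B = B and S = "{h}", OF assms(1,2)]) (auto simp: component_homogeneous[OF assms(3)])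

lemma linearI_operators: "(\<And>x y. f (x + y) = f x + f y) \<Longrightarrow> (\<And>c x. f (sV c x) = sW c (f x)) \<Longrightarrow> Vector_Spaces.linear sV sW f"
  and linearI_module: "(\<And>x y. f' (x + y) = f' x + f' y) \<Longrightarrow> (\<And>c x. f' (sW c x) = sW c (f' x)) \<Longrightarrow> Vector_Spaces.linear sW sW f'"
  by unfold_locales

lemma twisted_vertex_operators_shift_modes:
  assumes Y: "twisted_vertex_operators sV vac g T sW Y"
    and B: "Vector_Spaces.linear sV sV B" "B vac = vac" "\<And>v r. v \<in> E r \<Longrightarrow> B v \<in> E r"
  shows "twisted_vertex_operators sV vac g T sW (shift_modes B e Y)"
proof -
  interpret b: Vector_Spaces.linear sV sV B by (rule B)
  interpret r: Vector_Spaces.linear sW sW "Y v n" for v n by (rule operators_linear[OF Y])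
  interpret l: Vector_Spaces.linear sV sW "\<lambda>v. Y v n w" for n w by (rule operators_linear[OF Y])
  note sm = shift_modes_eq_sum[of Y B, OF l.zero b.zero]
  let ?S = "\<lambda>v. {h. component v h \<noteq> 0}"
  have S: "shift_modes B e Y v n w = (\<Sum>h\<in>?S v. Y (B (component v h)) (n + of_int (e * h)) w)" for v n w
    by (rule sm) (auto simp: component_props)
  have "Vector_Spaces.linear sW sW (shift_modes B e Y v n)" for v n
    by (rule linearI_module) (simp_all add: S r.add r.scale sum.distrib W.scale_sum_right)
  moreover have "Vector_Spaces.linear sV sW (\<lambda>v. shift_modes B e Y v n w)" for n w
  proof (rule linearI_operators)
    fix x y c
    have "shift_modes B e Y v n w = (\<Sum>h\<in>?S x \<union> ?S y. Y (B (component v h)) (n + of_int (e * h)) w)"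
      if "v \<in> {x, y, x + y, sV c x}" for v
      by (rule sm) (use that component_props in \<open>auto simp: component_add component_scale\<close>)
    then show "shift_modes B e Y (x + y) n w = shift_modes B e Y x n w + shift_modes B e Y y n w"
      "shift_modes B e Y (sV c x) n w = sW c (shift_modes B e Y x n w)"
      by (simp_all add: component_add component_scale b.add b.scale l.add l.scale sum.distrib W.scale_sum_right)
  qed
  moreover have "shift_modes B e Y v n w = 0" if "n \<notin> frac_int T" for v n w
  proof -
    have "n + of_int (e * h) \<notin> frac_int T" for h
      using that frac_int_diff[OF _ frac_int_of_int[OF T], of "n + of_int (e * h)" "e * h"] by auto
    then show ?thesis using Y by (simp add: S twisted_vertex_operators_def)
  qed
  moreover have "\<exists>N. \<forall>n\<ge>N. shift_modes B e Y v n w = 0" for v w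
  proof -
    have "eventually (\<lambda>n. Y (B (component v h)) (n + of_int (e * h)) w = 0) at_top" for h
    proof -
      obtain N where N: "\<And>n. n \<ge> N \<Longrightarrow> Y (B (component v h)) n w = 0"
        using Y unfolding twisted_vertex_operators_def by blast
      show ?thesis unfolding eventually_at_top_linorder
        by (rule exI[of _ "N - of_int (e * h)"]) (auto intro!: N simp: algebra_simps)
    qed
    then have "eventually (\<lambda>n. \<forall>h\<in>?S v. Y (B (component v h)) (n + of_int (e * h)) w = 0) at_top"
      using component_props(1) by (intro eventually_ball_finite) auto
    then show ?thesis unfolding eventually_at_top_linorder by (simp add: S) (metis (mono_tags, lifting) mem_Collect_eq sum.neutral)
  qed
  moreover have "shift_modes B e Y vac n w = (if n = - 1 then w else 0)" for n w
    using shift_modes_homogeneous[of Y B, OF l.zero b.zero vac_weight] Y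
    by (simp add: B(2) twisted_vertex_operators_def)
  moreover have "shift_modes B e Y v n w = 0" if "r < T" "v \<in> E r" "n - of_nat r / of_nat T \<notin> \<int>" for r v n w
  proof -
    have "n + of_int (e * h) - of_nat r / of_nat T \<notin> \<int>" for h
    proof
      assume "n + of_int (e * h) - of_nat r / of_nat T \<in> \<int>"
      from Ints_diff[OF this Ints_of_int[of "e * h"]] that(3) show False by (simp add: algebra_simps)
    qed
    then have "Y (B (component v h)) (n + of_int (e * h)) w = 0" for h
      using Y that(1) B(3)[OF eigenspace_component[OF that(2), of h]] unfolding twisted_vertex_operators_def by blast
    then show ?thesis by (simp add: S)
  qed
  ultimately show ?thesis unfolding twisted_vertex_operators_def bilinear_modes_def by blast
qed

lemma twisted_vertex_operators_to_phi:
  assumes "twisted_vertex_operators sV vac g T sW Y"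
  shows "twisted_vertex_operators sV vac g T sW (to_phi Y)"
proof -
  have "Vector_Spaces.linear sV sV id" by (rule linearI) auto
  from twisted_vertex_operators_shift_modes[OF assms this, of 1]
  have Y: "twisted_vertex_operators sV vac g T sW (shift_modes id 1 Y)" by simp
  have "Vector_Spaces.linear sV sW (\<lambda>v. shift_modes id 1 Y (zhu_iso v) n w)" for n w
  proof -
    interpret l: Vector_Spaces.linear sV sW "\<lambda>v. shift_modes id 1 Y v n w" by (rule operators_linear[OF Y])
    show ?thesis by (rule linearI_operators) (simp_all add: zhu_iso_simps l.add l.scale)
  qed
  then show ?thesis using Y
    by (auto simp: twisted_vertex_operators_def bilinear_modes_def to_phi_def zhu_iso_vac eigenspace_zhu_iso)
qed

lemma twisted_vertex_operators_from_phi: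
  assumes "twisted_vertex_operators sV vac g T sW Y"
  shows "twisted_vertex_operators sV vac g T sW (from_phi Y)"
  unfolding from_phi_def
  by (rule twisted_vertex_operators_shift_modes[OF assms linear_zhu_inv])
    (simp_all add: eigenspace_zhu_inv zhu_inv_eqI[OF zhu_iso_vac])

lemma zhu_inv_0: "zhu_inv 0 = 0"
  by (rule zhu_inv_eqI) (rule zhu_iso_simps)

text \<open>Composing the two translations shifts each component by h and by -h; what remains is the
  sum over components at an unshifted index.\<close>

lemma sum_component_operators:
  assumes Y: "twisted_vertex_operators sV vac g T sW Y" and B: "Vector_Spaces.linear sV sV B"
  shows "Sum_any (\<lambda>h. Y (B (component v h)) n w) = Y (B v) n w"
proof -
  interpret b: Vector_Spaces.linear sV sV B by (rule B)
  interpret l: Vector_Spaces.linear sV sW "\<lambda>v. Y v n w" by (rule operators_linear[OF Y])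
  let ?S = "{h. component v h \<noteq> 0}"
  have "Sum_any (\<lambda>h. Y (B (component v h)) n w) = (\<Sum>h\<in>?S. Y (B (component v h)) n w)"
    by (rule Sum_any_eq_sum) (auto simp: component_props b.zero l.zero)
  also have "\<dots> = Y (B (\<Sum>h\<in>?S. component v h)) n w" by (simp only: b.sum l.sum)
  also have "(\<Sum>h\<in>?S. component v h) = v" by (rule sum_components[symmetric]) (auto simp: component_props)
  finally show ?thesis .
qed

lemma to_phi_homogeneous:
  assumes "twisted_vertex_operators sV vac g T sW Y" "v \<in> V h"
  shows "to_phi Y (zhu_inv v) n w = Y v (n + of_int h) w"
  unfolding to_phi_def
  using shift_modes_homogeneous[of Y id, OF operators_linear(3)[OF assms(1)] _ assms(2), of 1] by simp

lemma from_phi_homogeneous: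
  assumes "twisted_vertex_operators sV vac g T sW Y" "v \<in> V h"
  shows "from_phi Y v n w = Y (zhu_inv v) (n - of_int h) w"
  unfolding from_phi_def
  using shift_modes_homogeneous[of Y zhu_inv, OF operators_linear(3)[OF assms(1)] zhu_inv_0 assms(2), of "-1"] by simp

lemma to_phi_from_phi:
  assumes "twisted_vertex_operators sV vac g T sW Y"
  shows "to_phi (from_phi Y) = Y"
proof (intro ext)
  fix v n w
  have "to_phi (from_phi Y) v n w = Sum_any (\<lambda>h. Y (zhu_inv (component (zhu_iso v) h)) n w)"
    unfolding to_phi_def shift_modes_def
    by (rule Sum_any.cong) (simp add: from_phi_homogeneous[OF assms component_props(2)])
  also have "\<dots> = Y v n w" by (simp add: sum_component_operators[OF assms linear_zhu_inv])
  finally show "to_phi (from_phi Y) v n w = Y v n w" .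
qed

lemma from_phi_to_phi:
  assumes "twisted_vertex_operators sV vac g T sW Y"
  shows "from_phi (to_phi Y) = Y"
proof (intro ext)
  fix v n w
  have "from_phi (to_phi Y) v n w = Sum_any (\<lambda>h. Y (id (component v h)) n w)"
    unfolding from_phi_def shift_modes_def
    by (rule Sum_any.cong) (simp add: to_phi_homogeneous[OF assms component_props(2)])
  also have "\<dots> = Y v n w"
    by (subst sum_component_operators[OF assms]) (auto intro: linearI)
  finally show "from_phi (to_phi Y) v n w = Y v n w" .
qed

lemma shift_modes_intertwine:
  assumes Y: "twisted_vertex_operators sV vac g T sW Y" "twisted_vertex_operators sV vac g T sW Y'"
    and B: "B 0 = 0" and f: "Vector_Spaces.linear sW sW f" "\<And>v n w. f (Y v n w) = Y' v n (f w)"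
  shows "f (shift_modes B e Y v n w) = shift_modes B e Y' v n (f w)"
proof -
  interpret f: Vector_Spaces.linear sW sW f by (rule f)
  have "shift_modes B e Z v n w = (\<Sum>h\<in>{h. component v h \<noteq> 0}. Z (B (component v h)) (n + of_int (e * h)) w)"
    if "twisted_vertex_operators sV vac g T sW Z" for Z n w
    by (rule shift_modes_eq_sum[where Y = Z and B = B, OF operators_linear(3)[OF that] B]) (auto simp: component_props)
  then show ?thesis using Y by (simp add: f.sum f(2))
qed

end

section \<open>Comparison of the two Jacobi identities\<close>

context twisted_operators
begin

text \<open>Defects are additive in u and v. This reduces the comparison to vectors of pure weight,
  where the shift of modes is a single number.\<close>

definition phi_defect :: "'v \<Rightarrow> 'v \<Rightarrow> 'w \<Rightarrow> int \<Rightarrow> rat \<Rightarrow> rat \<Rightarrow> 'w" where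
  "phi_defect u v w l m n =
     W.jacobi_left l m n (product u v w) - W.jacobi_right l m n (opposite u v w)
     - W.pair (lexp (of_rat m + 1) * lexpm1 powi l) (modes u v w (m + n + of_int l + 1))"

definition twisted_defect :: "'v \<Rightarrow> 'v \<Rightarrow> 'w \<Rightarrow> int \<Rightarrow> rat \<Rightarrow> rat \<Rightarrow> 'w" where
  "twisted_defect u v w l m n =
     W.jacobi_left l m n (product u v w) - W.jacobi_right l m n (opposite u v w)
     - W.pair (lbinom (of_rat m)) (\<lambda>i. Y (YV u (l + i) v) (m + n - of_int i) w)"

lemma weak_twisted_module_iff:
  "weak_twisted_module sV YV vac g T sW Y \<longleftrightarrow> (\<forall>r<T. \<forall>u\<in>E r. \<forall>v w l. \<forall>m n.
     m - of_nat r / of_nat T \<in> \<int> \<longrightarrow> n \<in> frac_int T \<longrightarrow> twisted_defect u v w l m n = 0)"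
  using operators
  by (simp add: weak_twisted_module_def twisted_defect_def lbinom_def W.pair_fps W.jacobi_left_def
      W.jacobi_right_def product_def opposite_def)

lemma phi_jacobi_iff:
  "phi_jacobi \<longleftrightarrow> (\<forall>r<T. \<forall>u\<in>E r. \<forall>v w l. \<forall>m n.
     m - of_nat r / of_nat T \<in> \<int> \<longrightarrow> n \<in> frac_int T \<longrightarrow> phi_defect u v w l m n = 0)"
  by (simp add: phi_jacobi_def phi_defect_def)

lemma Y_add_right: "Y u n (w + w') = Y u n w + Y u n w'"
proof -
  interpret l: Vector_Spaces.linear sW sW "Y u n" by (rule Y_linear_right)
  show ?thesis by (rule l.add)
qed

lemma bounded_above_shifted_modes: "W.bounded_above (\<lambda>i. Y (YV u (l + i) v) (N i) w)"
proof -
  obtain K where K: "\<And>n. n \<ge> K \<Longrightarrow> YV u n v = 0" using truncation by blast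
  have "Y (YV u (l + i) v) (N i) w = 0" if "i \<ge> K - l" for i
    using that by (simp add: K)
  then show ?thesis unfolding W.bounded_above_def by blast
qed

lemma YV_add: "YV (u + u') j v = YV u j v + YV u' j v" "YV u j (v + v') = YV u j v + YV u j v'"
proof -
  interpret l: Vector_Spaces.linear sV sV "\<lambda>u. YV u j v" by (rule linear_left)
  interpret r: Vector_Spaces.linear sV sV "YV u j" by (rule linear_right)
  show "YV (u + u') j v = YV u j v + YV u' j v" "YV u j (v + v') = YV u j v + YV u j v'"
    by (rule l.add, rule r.add)
qed

lemma product_add:
  "product (u + u') v w = (\<lambda>a b. product u v w a b + product u' v w a b)"
  "product u (v + v') w = (\<lambda>a b. product u v w a b + product u v' w a b)"
  "opposite (u + u') v w = (\<lambda>a b. opposite u v w a b + opposite u' v w a b)"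
  "opposite u (v + v') w = (\<lambda>a b. opposite u v w a b + opposite u v' w a b)"
  by (simp_all add: product_def opposite_def fun_eq_iff Y_add_left Y_add_right)

lemma modes_add:
  "modes (u + u') v w N = (\<lambda>j. modes u v w N j + modes u' v w N j)"
  "modes u (v + v') w N = (\<lambda>j. modes u v w N j + modes u v' w N j)"
  by (simp_all add: modes_def fun_eq_iff YV_add Y_add_left)

lemmas jacobi_add = W.jacobi_left_add_bounded[OF left_bounded_product left_bounded_product]
  W.jacobi_right_add_bounded[OF right_bounded_opposite right_bounded_opposite]

lemma phi_defect_add:
  "phi_defect (u + u') v w l m n = phi_defect u v w l m n + phi_defect u' v w l m n"
  "phi_defect u (v + v') w l m n = phi_defect u v w l m n + phi_defect u v' w l m n"
  by (simp_all add: phi_defect_def product_add modes_add jacobi_add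
      W.pair_add_right[OF bounded_above_modes bounded_above_modes])

lemma twisted_defect_add:
  "twisted_defect (u + u') v w l m n = twisted_defect u v w l m n + twisted_defect u' v w l m n"
  "twisted_defect u (v + v') w l m n = twisted_defect u v w l m n + twisted_defect u v' w l m n"
  by (simp_all add: twisted_defect_def product_add YV_add Y_add_left jacobi_add
      W.pair_add_right[OF bounded_above_shifted_modes bounded_above_shifted_modes])

end

locale phi_correspondence = twisted_setup sV YV vac \<omega> sW g T
  + M: twisted_operators sV YV vac \<omega> sW g T Ym + P: twisted_operators sV YV vac \<omega> sW g T Yw
  for sV :: "complex \<Rightarrow> 'v::ab_group_add \<Rightarrow> 'v" and YV vac \<omega>
    and sW :: "complex \<Rightarrow> 'w::ab_group_add \<Rightarrow> 'w" and g T Ym Yw +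
  assumes correspond: "v \<in> V h \<Longrightarrow> Yw (zhu_inv v) n w = Ym v (n + of_int h) w"
begin

text \<open>The modes of u and v are shifted by h and k on both sides. In the iterate, applying the
  isomorphism is the substitution x = log(1+z), which turns the exponential test series into
  (1+z)^(m+h) z^l.\<close>

lemma defect_eq:
  assumes u: "u \<in> V h" and v: "v \<in> V k"
  shows "P.phi_defect (zhu_inv u) (zhu_inv v) w l m n =
    M.twisted_defect u v w l (m + of_int h) (n + of_int k)"
proof -
  have p: "P.product (zhu_inv u) (zhu_inv v) w a b = M.product u v w (a + of_int h) (b + of_int k)"
    "P.opposite (zhu_inv u) (zhu_inv v) w a b = M.opposite u v w (a + of_int h) (b + of_int k)" for a b
    by (simp_all add: P.product_def M.product_def P.opposite_def M.opposite_def correspond[OF u] correspond[OF v])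
  have L: "W.jacobi_left l m n (P.product (zhu_inv u) (zhu_inv v) w) =
      W.jacobi_left l (m + of_int h) (n + of_int k) (M.product u v w)"
    unfolding W.jacobi_left_def p by (rule Sum_any.cong) (simp add: algebra_simps)
  have R: "W.jacobi_right l m n (P.opposite (zhu_inv u) (zhu_inv v) w) =
      W.jacobi_right l (m + of_int h) (n + of_int k) (M.opposite u v w)"
    unfolding W.jacobi_right_def p by (rule Sum_any.cong) (simp add: algebra_simps)
  let ?N = "m + n + of_int l + 1" and ?f = "lexp (of_rat m + 1) * lexpm1 powi l"
  interpret y: Vector_Spaces.linear sV sW "\<lambda>v. Yw v ?N w" by (rule P.Y_linear_left)
  interpret zi: Vector_Spaces.linear sV sV zhu_inv by (rule linear_zhu_inv)
  \<comment> \<open>e^((m+1)x) becomes (1+z)^(m+1) and is multiplied by (1+z)^(h-1): the weight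
    factor and dx combine with the extra 1 to the exponent m + h.\<close>
  have f: "zhu_weight h ?f = lbinom (of_rat (m + of_int h)) * fls_X_intpow l"
  proof -
    have "zhu_weight h ?f = lbinom (of_rat m + 1) * lbinom (of_int h - 1) * fls_X powi l"
      unfolding zhu_weight_def
      by (simp only: fls_compose_fps_mult[OF fps_ln_nonzero fps_ln_0] fls_compose_fps_powi[OF fps_ln_nonzero fps_ln_0]
          lexp_compose_ln lexpm1_compose_ln mult_ac)
    then show ?thesis by (simp add: lbinom_add[symmetric] of_rat_add)
  qed
  have "W.pair ?f (P.modes (zhu_inv u) (zhu_inv v) w ?N)
      = Yw (pair ?f (\<lambda>j. YV (zhu_inv u) j (zhu_inv v))) ?N w"
    unfolding P.modes_def[abs_def]
    by (rule linear_pair[OF P.Y_linear_left vertex_operator_algebra.bounded_above_modes[OF vertex_operator_algebra_axioms], symmetric])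
  also have "pair ?f (\<lambda>j. YV (zhu_inv u) j (zhu_inv v)) = zhu_inv (zhu_res ?f u v)"
    by (rule zhu_inv_eqI[symmetric]) (simp add: zhu_iso_pair)
  also have "zhu_res ?f u v = pair (lbinom (of_rat (m + of_int h))) (\<lambda>i. YV u (i + l) v)"
    unfolding zhu_res_homogeneous[OF u] f res_def by (rule pair_mult_X_intpow)
  also have "Yw (zhu_inv (pair (lbinom (of_rat (m + of_int h))) (\<lambda>i. YV u (i + l) v))) ?N w =
      W.pair (lbinom (of_rat (m + of_int h))) (\<lambda>i. Yw (zhu_inv (YV u (i + l) v)) ?N w)"
  proof -
    obtain K where K: "\<And>n. n \<ge> K \<Longrightarrow> YV u n v = 0" using truncation by blast
    have "YV u (i + l) v = 0" if "i \<ge> K - l" for i using that by (intro K) simp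
    then have "bounded_above (\<lambda>i. YV u (i + l) v)" unfolding bounded_above_def by blast
    moreover have "Vector_Spaces.linear sV sW (\<lambda>x. Yw (zhu_inv x) ?N w)"
      by (rule linearI_operators) (simp_all add: zi.add zi.scale y.add y.scale)
    ultimately show ?thesis by (rule linear_pair[rotated])
  qed
  also have "\<dots> = W.pair (lbinom (of_rat (m + of_int h)))
      (\<lambda>i. Ym (YV u (l + i) v) ((m + of_int h) + (n + of_int k) - of_int i) w)"
  proof -
    \<comment> \<open>u_(l+i) v has weight h+k-l-i-1, which added to N = m+n+l+1 gives (m+h) + (n+k)
      - i.\<close>
    have "Yw (zhu_inv (YV u (i + l) v)) ?N w = Ym (YV u (l + i) v) ((m + of_int h) + (n + of_int k) - of_int i) w" for i
      unfolding correspond[OF weight_Y[OF u v]] by (simp add: algebra_simps)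
    then show ?thesis by simp
  qed
  finally show ?thesis by (simp only: P.phi_defect_def M.twisted_defect_def L R)
qed

text \<open>Weight components and the isomorphism preserve each eigenspace, and integer shifts
  preserve the coset of r/T and (1/T)Z. Both identities may therefore be tested on weight
  components, where the defects agree.\<close>

lemma weak_twisted_module_iff_phi_coordinated:
  "weak_twisted_module sV YV vac g T sW Ym \<longleftrightarrow> phi_coordinated_module sV YV vac g T sW Yw"
proof
  assume "weak_twisted_module sV YV vac g T sW Ym"
  then have M: "M.twisted_defect u v w l m n = 0"
    if "r < T" "u \<in> E r" "m - of_nat r / of_nat T \<in> \<int>" "n \<in> frac_int T" for r u v w l m n
    using that unfolding M.weak_twisted_module_iff by blast
  have "P.phi_defect u v w l m n = 0"
    if r: "r < T" "u \<in> E r" and m: "m - of_nat r / of_nat T \<in> \<int>" and n: "n \<in> frac_int T" for r u v w l m n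
  proof -
    let ?D = "\<lambda>x y. P.phi_defect (zhu_inv x) (zhu_inv y) w l m n"
    let ?u = "zhu_iso u" and ?v = "zhu_iso v"
    have D0: "?D (component ?u h) (component ?v k) = 0" for h k
      unfolding defect_eq[OF component_props(2) component_props(2)]
    proof (rule M[OF r(1)])
      show "component ?u h \<in> E r" by (intro eigenspace_component eigenspace_zhu_iso r)
      show "m + of_int h - of_nat r / of_nat T \<in> \<int>"
        using Ints_add[OF m Ints_of_int[of h]] by (simp add: algebra_simps)
      show "n + of_int k \<in> frac_int T" using n T by (simp add: frac_int_add)
    qed
    have "?D (component ?u h) ?v = 0" for h
      by (rule additive_zero_if_components[where D = "?D (component ?u h)"])
        (simp_all only: zhu_inv_add P.phi_defect_add D0)
    from additive_zero_if_components[where D = "\<lambda>x. ?D x ?v", OF _ this]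
    have "?D ?u ?v = 0" by (simp only: zhu_inv_add P.phi_defect_add)
    then show ?thesis by simp
  qed
  then show "phi_coordinated_module sV YV vac g T sW Yw"
    unfolding P.phi_coordinated_module_iff_jacobi P.phi_jacobi_iff by blast
next
  assume "phi_coordinated_module sV YV vac g T sW Yw"
  then have P: "P.phi_defect u v w l m n = 0"
    if "r < T" "u \<in> E r" "m - of_nat r / of_nat T \<in> \<int>" "n \<in> frac_int T" for r u v w l m n
    using that unfolding P.phi_coordinated_module_iff_jacobi P.phi_jacobi_iff by blast
  have "M.twisted_defect u v w l m n = 0"
    if r: "r < T" "u \<in> E r" and m: "m - of_nat r / of_nat T \<in> \<int>" and n: "n \<in> frac_int T" for r u v w l m n
  proof -
    let ?D = "\<lambda>x y. M.twisted_defect x y w l m n"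
    have D0: "?D (component u h) (component v k) = 0" for h k
    proof -
      have "P.phi_defect (zhu_inv (component u h)) (zhu_inv (component v k)) w l (m - of_int h) (n - of_int k) = 0"
      proof (rule P[OF r(1)])
        show "zhu_inv (component u h) \<in> E r" by (intro eigenspace_component eigenspace_zhu_inv r)
        show "m - of_int h - of_nat r / of_nat T \<in> \<int>"
          using Ints_diff[OF m Ints_of_int[of h]] by (simp add: algebra_simps)
        show "n - of_int k \<in> frac_int T" using n T by (simp add: frac_int_diff)
      qed
      then show ?thesis unfolding defect_eq[OF component_props(2) component_props(2)] by simp
    qed
    have "?D (component u h) v = 0" for h
      by (rule additive_zero_if_components[where D = "?D (component u h)"])
        (simp_all only: M.twisted_defect_add D0)
    from additive_zero_if_components[where D = "\<lambda>x. ?D x v", OF _ this]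
    show ?thesis by (simp only: M.twisted_defect_add)
  qed
  then show "weak_twisted_module sV YV vac g T sW Ym"
    unfolding M.weak_twisted_module_iff by blast
qed

end

section \<open>Gradings, the bijection and isomorphisms\<close>

context twisted_setup
begin

lemma weak_twisted_module_iff_to_phi:
  assumes "twisted_vertex_operators sV vac g T sW Y"
  shows "weak_twisted_module sV YV vac g T sW Y \<longleftrightarrow> phi_coordinated_module sV YV vac g T sW (to_phi Y)"
proof -
  interpret phi_correspondence sV YV vac \<omega> sW g T Y "to_phi Y"
    by unfold_locales (auto simp: assms twisted_vertex_operators_to_phi to_phi_homogeneous)
  show ?thesis by (rule weak_twisted_module_iff_phi_coordinated)
qed

lemma grading_subspace:
  assumes "frac_nat_grading T sW M"
  shows "W.subspace (M n)" "n \<notin> frac_nat T \<Longrightarrow> M n = {0}"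
  using assms by (auto simp: frac_nat_grading_def direct_sum_def)

text \<open>The shifted mode m + h sends degree n to n + h - (m+h) - 1 = n - m - 1, independently of
  h, so the condition extends to sums of different weights. Conversely each v of pure weight is
  recovered through \<open>zhu_inv\<close>.\<close>

lemma grading_to_phi:
  assumes Y: "twisted_vertex_operators sV vac g T sW Y" and M: "frac_nat_grading T sW M"
  shows "(\<forall>h. \<forall>v\<in>V h. \<forall>k\<in>frac_int T. \<forall>n\<in>frac_nat T. Y v k ` M n \<subseteq> M (n + of_int h - k - 1)) \<longleftrightarrow>
    (\<forall>v. \<forall>m\<in>frac_int T. \<forall>n\<in>frac_nat T. to_phi Y v m ` M n \<subseteq> M (n - m - 1))" (is "?L \<longleftrightarrow> ?R")
proof
  assume L: "?L"
  show "?R"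
  proof (intro allI ballI image_subsetI)
    fix v m n w assume m: "m \<in> frac_int T" and n: "n \<in> frac_nat T" and w: "w \<in> M n"
    have "Y (component (zhu_iso v) h) (m + of_int (1 * h)) w \<in> M (n - m - 1)" for h
    proof -
      have "m + of_int h \<in> frac_int T" using m T by (simp add: frac_int_add)
      then have "Y (component (zhu_iso v) h) (m + of_int h) w \<in> M (n + of_int h - (m + of_int h) - 1)"
        using L component_props(2) n w by blast
      then show ?thesis by simp
    qed
    then show "to_phi Y v m w \<in> M (n - m - 1)"
      unfolding to_phi_def shift_modes_def Sum_any.expand_set
      by (intro W.subspace_sum[OF grading_subspace(1)[OF M]]) simp
  qed
next
  assume R: "?R"
  show "?L"
  proof (intro allI ballI image_subsetI)
    fix h v k n w assume v: "v \<in> V h" and k: "k \<in> frac_int T" and n: "n \<in> frac_nat T" and w: "w \<in> M n"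
    have "k - of_int h \<in> frac_int T" using k T by (simp add: frac_int_diff)
    then have "to_phi Y (zhu_inv v) (k - of_int h) w \<in> M (n - (k - of_int h) - 1)"
      using R n w by blast
    then show "Y v k w \<in> M (n + of_int h - k - 1)"
      by (simp add: to_phi_homogeneous[OF Y v] algebra_simps)
  qed
qed

lemma admissible_iff_to_phi:
  assumes "twisted_vertex_operators sV vac g T sW Y"
  shows "(Y, M) \<in> admissible_twisted_modules sV YV vac \<omega> g T sW \<longleftrightarrow>
    (to_phi Y, M) \<in> graded_phi_coordinated_modules sV YV vac g T sW"
  unfolding admissible_twisted_modules_def graded_phi_coordinated_modules_def mem_Collect_eq prod.case
  using weak_twisted_module_iff_to_phi[OF assms] grading_to_phi[OF assms, of M] by blast

lemma module_operators:
  "(Y, M) \<in> admissible_twisted_modules sV YV vac \<omega> g T sW \<Longrightarrow> twisted_vertex_operators sV vac g T sW Y"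
  "(Y, M) \<in> graded_phi_coordinated_modules sV YV vac g T sW \<Longrightarrow> twisted_vertex_operators sV vac g T sW Y"
  by (auto simp: admissible_twisted_modules_def graded_phi_coordinated_modules_def
      weak_twisted_module_def phi_coordinated_module_def)

lemma bij_betw_to_phi:
  "bij_betw (\<lambda>(Y, M). (to_phi Y, M)) (admissible_twisted_modules sV YV vac \<omega> g T sW)
     (graded_phi_coordinated_modules sV YV vac g T sW)"
proof (rule bij_betw_byWitness[where f' = "\<lambda>(Y, M). (from_phi Y, M)"])
  show "\<forall>X\<in>admissible_twisted_modules sV YV vac \<omega> g T sW.
      (case case X of (Y, M) \<Rightarrow> (to_phi Y, M) of (Y, M) \<Rightarrow> (from_phi Y, M)) = X"
    using from_phi_to_phi module_operators(1) by auto
  show "\<forall>X\<in>graded_phi_coordinated_modules sV YV vac g T sW.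
      (case case X of (Y, M) \<Rightarrow> (from_phi Y, M) of (Y, M) \<Rightarrow> (to_phi Y, M)) = X"
    using to_phi_from_phi module_operators(2) by auto
  show "(\<lambda>(Y, M). (to_phi Y, M)) ` admissible_twisted_modules sV YV vac \<omega> g T sW
      \<subseteq> graded_phi_coordinated_modules sV YV vac g T sW"
    using admissible_iff_to_phi module_operators(1) by auto
  show "(\<lambda>(Y, M). (from_phi Y, M)) ` graded_phi_coordinated_modules sV YV vac g T sW
      \<subseteq> admissible_twisted_modules sV YV vac \<omega> g T sW"
  proof
    fix X assume "X \<in> (\<lambda>(Y, M). (from_phi Y, M)) ` graded_phi_coordinated_modules sV YV vac g T sW"
    then obtain Y M where X: "X = (from_phi Y, M)" and Y: "(Y, M) \<in> graded_phi_coordinated_modules sV YV vac g T sW"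
      by auto
    note t = module_operators(2)[OF Y]
    show "X \<in> admissible_twisted_modules sV YV vac \<omega> g T sW"
      unfolding X admissible_iff_to_phi[OF twisted_vertex_operators_from_phi[OF t]] to_phi_from_phi[OF t] by (rule Y)
  qed
qed

text \<open>Each translation expresses the new operators as finite sums of the old ones, with
  coefficients that depend only on V, so a linear map that intertwines one kind intertwines the
  other.\<close>

lemma intertwine_to_phi_iff:
  assumes Y: "twisted_vertex_operators sV vac g T sW Y" "twisted_vertex_operators sV vac g T sW Y'"
    and f: "Vector_Spaces.linear sW sW f"
  shows "(\<forall>v n w. f (Y v n w) = Y' v n (f w)) \<longleftrightarrow> (\<forall>v n w. f (to_phi Y v n w) = to_phi Y' v n (f w))"
proof
  assume "\<forall>v n w. f (Y v n w) = Y' v n (f w)"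
  then show "\<forall>v n w. f (to_phi Y v n w) = to_phi Y' v n (f w)"
    unfolding to_phi_def using shift_modes_intertwine[where Y = Y and Y' = Y' and B = id and f = f, OF Y _ f] by simp
next
  assume "\<forall>v n w. f (to_phi Y v n w) = to_phi Y' v n (f w)"
  then have "f (from_phi (to_phi Y) v n w) = from_phi (to_phi Y') v n (f w)" for v n w
    unfolding from_phi_def
    using shift_modes_intertwine[where Y = "to_phi Y" and Y' = "to_phi Y'" and B = zhu_inv and f = f,
        OF Y[THEN twisted_vertex_operators_to_phi] zhu_inv_0 f] by blast
  then show "\<forall>v n w. f (Y v n w) = Y' v n (f w)"
    by (simp add: from_phi_to_phi Y)
qed

lemma isomorphic_modules_to_phi_iff:
  assumes "twisted_vertex_operators sV vac g T sW Y" "twisted_vertex_operators sV vac g T sW Y'"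
  shows "isomorphic_modules sW (Y, M) (Y', M') \<longleftrightarrow> isomorphic_modules sW (to_phi Y, M) (to_phi Y', M')"
proof -
  have "Vector_Spaces.linear sW sW f \<and> bij f \<and> (\<forall>v n w. f (Y v n w) = Y' v n (f w)) \<and> (\<forall>n. f ` M n = M' n) \<longleftrightarrow>
    Vector_Spaces.linear sW sW f \<and> bij f \<and> (\<forall>v n w. f (to_phi Y v n w) = to_phi Y' v n (f w)) \<and> (\<forall>n. f ` M n = M' n)" for f
    using intertwine_to_phi_iff[OF assms, of f] by argo
  then show ?thesis unfolding isomorphic_modules_def fst_conv snd_conv by (simp only:)
qed

end

text \<open>The witness changes the operators and keeps the grading. Respecting and reflecting
  isomorphism makes it more than an equality of cardinalities: it descends to a bijection of
  isomorphism classes.\<close>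

theorem corollary5p17:
  fixes sV :: "complex \<Rightarrow> 'v::ab_group_add \<Rightarrow> 'v"
    and Y :: "'v \<Rightarrow> int \<Rightarrow> 'v \<Rightarrow> 'v" and vac \<omega> :: 'v
    and g :: "'v \<Rightarrow> 'v" and T :: nat
    and sW :: "complex \<Rightarrow> 'w::ab_group_add \<Rightarrow> 'w"
  assumes "vertex_operator_algebra sV Y vac \<omega>"
    and "voa_automorphism sV Y vac \<omega> g"
    and "T \<ge> 1" and "g ^^ T = id"
    and "vector_space sW"
  shows "\<exists>F. bij_betw F (admissible_twisted_modules sV Y vac \<omega> g T sW)
                         (graded_phi_coordinated_modules sV Y vac g T sW) \<and>
             (\<forall>X\<in>admissible_twisted_modules sV Y vac \<omega> g T sW.
              \<forall>X'\<in>admissible_twisted_modules sV Y vac \<omega> g T sW.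
                isomorphic_modules sW X X' \<longleftrightarrow> isomorphic_modules sW (F X) (F X'))"
proof -
  interpret V: vertex_operator_algebra sV Y vac \<omega> by fact
  interpret sW: vector_space sW by fact
  interpret twisted_setup sV Y vac \<omega> sW g T
    by unfold_locales (use assms in auto)
  show ?thesis
  proof (intro exI conjI ballI)
    show "bij_betw (\<lambda>(Y, M). (to_phi Y, M)) (admissible_twisted_modules sV Y vac \<omega> g T sW)
      (graded_phi_coordinated_modules sV Y vac g T sW)"
      by (rule bij_betw_to_phi)
  next
    fix X X' assume "X \<in> admissible_twisted_modules sV Y vac \<omega> g T sW" "X' \<in> admissible_twisted_modules sV Y vac \<omega> g T sW"
    then show "isomorphic_modules sW X X' \<longleftrightarrow> isomorphic_modules sW
        ((\<lambda>(Y, M). (to_phi Y, M)) X) ((\<lambda>(Y, M). (to_phi Y, M)) X')"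
      using isomorphic_modules_to_phi_iff module_operators(1) by (cases X; cases X') auto
  qed
qed

end
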